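(* Let $\mathbb{H}=\{(z_1,z_2)\in\mathbb{C}^2 : |z_1|<|z_2|<1\}$. Given any $p_0\in[1,2)$ with conjugate exponent $p_0'$ (so $\frac1{p_0}+\frac1{p_0'}=1$, with $p_0'=\infty$ if $p_0=1$), let $\mu(z)=|z_2|^{-(p_0+4)}$ for $z\in\mathbb{H}$. Then the weighted Bergman projection on $\mathbb{H}$ with the weight $\mu$ is $L^p(\mathbb{H},\mu)$ bounded if and only if $p\in(p_0,p_0')$.
   Context: For a domain $\Omega\subset\mathbb{C}^n$ and a continuous non-vanishing weight $\mu>0$ on $\Omega$, $L^p(\Omega,\mu)$ ($p\ge1$) is the space of measurable $f$ with $\|f\|_{L^p(\Omega,\mu)}=\left(\int_\Omega|f|^p\mu\,dV\right)^{1/p}<\infty$; $A^2(\Omega,\mu)$ is the closed subspace of holomorphic functions in $L^2(\Omega,\mu)$; the weighted Bergman projection on $\Omega$ with the weight $\mu$ is the orthogonal projection from $L^2(\Omega,\mu)$ onto $A^2(\Omega,\mu)$. It is $L^p(\Omega,\mu)$ bounded if, as usual, there is a constant $C$ such that $\|Tf\|_{L^p(\Omega,\mu)}\le C\|f\|_{L^p(\Omega,\mu)}$ for all $f\in L^p(\Omega,\mu)\cap L^2(\Omega,\mu)$, where $T$ denotes the projection. Throughout, $p\in[1,\infty)$. *)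

theory Defs
  imports "HOL-Analysis.Analysis"
begin

text \<open>
  Holomorphy in several variables: the real Frechet derivative exists at every point and is
  complex-linear; \<open>*s\<close> is multiplication by a complex scalar.  It is meant for open sets.
\<close>
definition holomorphic_Cn_on :: "(complex ^ 'n \<Rightarrow> complex) \<Rightarrow> (complex ^ 'n) set \<Rightarrow> bool"
  where "holomorphic_Cn_on f \<Omega> \<longleftrightarrow>
    (\<forall>z\<in>\<Omega>. \<exists>L. (f has_derivative L) (at z within \<Omega>) \<and> (\<forall>c v. L (c *s v) = c * L v))"

definition weighted_measure ::
    "(complex ^ 'n) set \<Rightarrow> (complex ^ 'n \<Rightarrow> real) \<Rightarrow> (complex ^ 'n) measure"
  where "weighted_measure \<Omega> \<mu> = density (lebesgue_on \<Omega>) (\<lambda>z. ennreal (\<mu> z))"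

text \<open>
  The norm takes values in \<open>[0,\<infinity>]\<close>, so that a bound on the norm of \<open>f\<close> includes the claim
  that \<open>f\<close> is in the space.
\<close>
definition Lp_norm ::
    "real \<Rightarrow> (complex ^ 'n) set \<Rightarrow> (complex ^ 'n \<Rightarrow> real) \<Rightarrow> (complex ^ 'n \<Rightarrow> complex) \<Rightarrow> ennreal"
  where "Lp_norm p \<Omega> \<mu> f =
    (let I = \<integral>\<^sup>+ z. ennreal (cmod (f z) powr p) \<partial>weighted_measure \<Omega> \<mu>
     in if I = \<infinity> then \<infinity> else ennreal (enn2real I powr (1 / p)))"

text \<open>
  The spaces consist of functions rather than classes modulo null sets, and the values of these
  functions outside \<open>\<Omega>\<close> are irrelevant.
\<close>
definition Lp_space ::
    "real \<Rightarrow> (complex ^ 'n) set \<Rightarrow> (complex ^ 'n \<Rightarrow> real) \<Rightarrow> (complex ^ 'n \<Rightarrow> complex) set"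
  where "Lp_space p \<Omega> \<mu> =
    {f. f \<in> borel_measurable (lebesgue_on \<Omega>) \<and> Lp_norm p \<Omega> \<mu> f < \<infinity>}"

definition bergman_space ::
    "(complex ^ 'n) set \<Rightarrow> (complex ^ 'n \<Rightarrow> real) \<Rightarrow> (complex ^ 'n \<Rightarrow> complex) set"
  where "bergman_space \<Omega> \<mu> = {f \<in> Lp_space 2 \<Omega> \<mu>. holomorphic_Cn_on f \<Omega>}"

definition L2_inner ::
    "(complex ^ 'n) set \<Rightarrow> (complex ^ 'n \<Rightarrow> real) \<Rightarrow>
      (complex ^ 'n \<Rightarrow> complex) \<Rightarrow> (complex ^ 'n \<Rightarrow> complex) \<Rightarrow> complex"
  where "L2_inner \<Omega> \<mu> f g = (LINT z|weighted_measure \<Omega> \<mu>. f z * cnj (g z))"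

text \<open>
  The orthogonal projection of \<open>f\<close> is the element \<open>g\<close> of the Bergman space for which \<open>f - g\<close> is
  orthogonal to that space.  On an open \<open>\<Omega>\<close> with a continuous positive weight, the holomorphic
  representative is determined at every point of \<open>\<Omega>\<close>; setting it to zero outside \<open>\<Omega>\<close> makes it
  unique as a total function.
\<close>
definition bergman_projection ::
    "(complex ^ 'n) set \<Rightarrow> (complex ^ 'n \<Rightarrow> real) \<Rightarrow>
      (complex ^ 'n \<Rightarrow> complex) \<Rightarrow> (complex ^ 'n \<Rightarrow> complex)"
  where "bergman_projection \<Omega> \<mu> f =
    (THE g. g \<in> bergman_space \<Omega> \<mu> \<and> (\<forall>z. z \<notin> \<Omega> \<longrightarrow> g z = 0) \<and>
       (\<forall>h\<in>bergman_space \<Omega> \<mu>. L2_inner \<Omega> \<mu> (\<lambda>z. f z - g z) h = 0))"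

definition Lp_bounded ::
    "real \<Rightarrow> (complex ^ 'n) set \<Rightarrow> (complex ^ 'n \<Rightarrow> real) \<Rightarrow>
      ((complex ^ 'n \<Rightarrow> complex) \<Rightarrow> (complex ^ 'n \<Rightarrow> complex)) \<Rightarrow> bool"
  where "Lp_bounded p \<Omega> \<mu> T \<longleftrightarrow>
    (\<exists>C::real. \<forall>f \<in> Lp_space p \<Omega> \<mu> \<inter> Lp_space 2 \<Omega> \<mu>.
       Lp_norm p \<Omega> \<mu> (T f) \<le> ennreal C * Lp_norm p \<Omega> \<mu> f)"

definition hartogs_triangle :: "(complex ^ 2) set"
  where "hartogs_triangle = {z. cmod (z $ 1) < cmod (z $ 2) \<and> cmod (z $ 2) < 1}"

end

theory Submission
  imports Defs "HOL-Complex_Analysis.Complex_Analysis"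
begin

text \<open>
  The map \<open>(v\<^sub>1, v\<^sub>2) \<mapsto> (v\<^sub>1 v\<^sub>2, v\<^sub>2)\<close> identifies the product of the disc and the punctured disc with
  the Hartogs triangle and turns the weighted measure into \<open>|v\<^sub>2| powr (- (p\<^sub>0 + 2)) dV(v)\<close>.  A
  square-integrable holomorphic function vanishes at \<open>v\<^sub>2 = 0\<close> to first order, so the projection is
  the product of the Bergman projection of the disc and of that of the disc with weight
  \<open>|v\<^sub>2| powr (- p\<^sub>0)\<close>, conjugated by \<open>v\<^sub>2\<close>; both kernels are explicit, and they reproduce by Cauchy's
  formula on circles and the fundamental theorem of calculus along radii.  The product kernel is
  dominated by \<open>|u\<^sub>2| |v\<^sub>2| / (|1 - u\<^sub>1 cnj v\<^sub>1|\<^sup>2 |1 - u\<^sub>2 cnj v\<^sub>2|\<^sup>2)\<close>, to which Schur's test applies for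
  \<open>p\<^sub>0 < p < p\<^sub>0'\<close>.  Outside this range, functions \<open>z\<^sub>2 k(|z\<^sub>2|)\<close> are projected to multiples of \<open>z\<^sub>2\<close>,
  which is not in \<open>L\<^sup>p\<close> for \<open>p \<le> p\<^sub>0\<close> and pairs unboundedly with \<open>L\<^sup>p\<close> for \<open>p \<ge> p\<^sub>0'\<close>.
\<close>

section \<open>Polar coordinates in the plane\<close>

text \<open>In the proof p0 is called \<open>s\<close>, and p < p0' is written
  \<open>p * (s - 1) < s\<close>, which covers s = 1 without an infinite exponent. The power v2^k is
  square-integrable for |v2|^(-(s+2)) exactly when 2k > s. Since 1 \<le> s < 2 this begins at k = 1,
  whence the factor v2 and the remaining weight |v2|^(-s). The same count puts z2 in L^p exactly
  when p > s, and duality turns this lower end into the upper end p0'. The Bergman projection is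
  given only by a definite description, so nothing about it is available in advance. The kernel
  operator must be shown to map L^2 into the Bergman space, to fix that space and to be
  self-adjoint; only then is it the projection. Self-adjointness needs absolute convergence of a
  double integral. This comes from Schur's test again: s < 2 puts p = 2 strictly inside the range,
  so the L^2 theory is an instance of the L^p bound.\<close>

lemma measurable_Complex [measurable]:
  "f \<in> borel_measurable M \<Longrightarrow> g \<in> borel_measurable M \<Longrightarrow> (\<lambda>x. Complex (f x) (g x)) \<in> borel_measurable M"
  unfolding Complex_eq by (intro borel_measurable_add borel_measurable_times borel_measurable_const) (auto simp: measurable_compose[OF _ borel_measurable_of_real])

lemma lborel_complex: "(lborel :: complex measure) = distr (lborel \<Otimes>\<^sub>M lborel) borel (\<lambda>(x, y). Complex x y)"
proof (rule lborel_eqI)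
  fix l u :: complex
  assume *: "\<And>b. b \<in> Basis \<Longrightarrow> l \<bullet> b \<le> u \<bullet> b"
  have le: "Re l \<le> Re u" "Im l \<le> Im u"
    using *[of 1] *[of \<i>] by (auto simp: Basis_complex_def)
  have "(\<lambda>(x, y). Complex x y) -` box l u = {Re l<..<Re u} \<times> {Im l<..<Im u}"
    by (auto simp: in_box_complex_iff)
  then show "emeasure (distr (lborel \<Otimes>\<^sub>M lborel) borel (\<lambda>(x, y). Complex x y)) (box l u)
      = ennreal (\<Prod>b\<in>Basis. (u - l) \<bullet> b)"
    using le by (subst emeasure_distr)
      (auto simp: lborel.emeasure_pair_measure_Times Basis_complex_def ennreal_mult space_pair_measure)
qed simp

text \<open>The substitution rule is applied on the compact intervals [-n, n], where arctan maps
  onto [arctan (-n), arctan n]; monotone convergence in n then exhausts the line on one side and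
  (-pi/2, pi/2) on the other.\<close>

lemma arctan_distr:
  "density lborel (indicator {-pi/2<..<pi/2}) = distr (density lborel (\<lambda>t. ennreal (1 / (1 + t\<^sup>2)))) borel arctan"
  (is "?L = ?R")
proof (rule measure_eqI)
  fix A assume "A \<in> sets ?L"
  then have A [measurable]: "A \<in> sets borel" by simp
  have eq: "(\<integral>\<^sup>+x. indicator A x * indicator {arctan (- real n)..arctan (real n)} x \<partial>lborel) =
      (\<integral>\<^sup>+t. ennreal (1 / (1 + t\<^sup>2)) * indicator A (arctan t) * indicator {- real n..real n} t \<partial>lborel)" (is "?a n = ?b n") for n
  proof -
    have "(\<integral>\<^sup>+x. ennreal (indicator A x * indicator {arctan (- real n)..arctan (real n)} x) \<partial>lborel) =
       (\<integral>\<^sup>+t. ennreal (indicator A (arctan t) * (1 / (1 + t\<^sup>2)) * indicator {- real n..real n} t) \<partial>lborel)"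
      by (rule nn_integral_substitution)
        (auto simp: set_borel_measurable_def inverse_eq_divide intro!: derivative_eq_intros continuous_intros sum_power2_eq_zero_iff
           simp: add_nonneg_eq_0_iff)
    moreover have "(\<integral>\<^sup>+x. ennreal (indicator A x * indicator {arctan (- real n)..arctan (real n)} x) \<partial>lborel) = ?a n"
      by (intro nn_integral_cong) (auto split: split_indicator)
    moreover have "(\<integral>\<^sup>+t. ennreal (indicator A (arctan t) * (1 / (1 + t\<^sup>2)) * indicator {- real n..real n} t) \<partial>lborel) = ?b n"
      by (intro nn_integral_cong) (auto split: split_indicator)
    ultimately show ?thesis by simp
  qed
  have "emeasure ?L A = (\<integral>\<^sup>+x. (SUP n. indicator A x * indicator {arctan (- real n)..arctan (real n)} x) \<partial>lborel)"
  proof (subst emeasure_density, simp, simp, rule nn_integral_cong)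
    fix x :: real
    have "(SUP n. indicator {arctan (- real n)..arctan (real n)} x) = (indicator {-pi/2<..<pi/2} x :: ennreal)"
    proof (cases "x \<in> {-pi/2<..<pi/2}")
      case True
      obtain n :: nat where n: "\<bar>tan x\<bar> \<le> real n" using real_arch_simple by blast
      have "arctan (- real n) \<le> arctan (tan x)" "arctan (tan x) \<le> arctan (real n)"
        using n by (auto simp only: arctan_le_iff)
      with True have "x \<in> {arctan (- real n)..arctan (real n)}" by (auto simp: arctan_tan)
      then have "(1::ennreal) \<le> (SUP n. indicator {arctan (- real n)..arctan (real n)} x)"
        by (intro SUP_upper2[of n]) auto
      moreover have "(SUP n. indicator {arctan (- real n)..arctan (real n)} x) \<le> (1::ennreal)"
        by (intro SUP_least) (auto split: split_indicator)
      ultimately show ?thesis using True by (auto intro: antisym)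
    next
      case False
      have "x \<notin> {arctan (- real n)..arctan (real n)}" for n
        using False arctan_lbound[of "- real n"] arctan_ubound[of "real n"] by (auto simp del: arctan_minus)
      then have "indicator {arctan (- real n)..arctan (real n)} x = (0::ennreal)" for n
        by (rule indicator_simps(2))
      with False show ?thesis by simp
    qed
    then show "indicator {- pi / 2<..<pi / 2} x * indicator A x = (SUP n. indicator A x * indicator {arctan (- real n)..arctan (real n)} x :: ennreal)"
      by (subst SUP_mult_left_ennreal[symmetric]) (simp add: mult.commute)
  qed
  also have "\<dots> = (SUP n. ?a n)"
  proof (rule nn_integral_monotone_convergence_SUP)
    have "arctan (- real n) \<ge> arctan (- real m)" "arctan (real n) \<le> arctan (real m)" if "n \<le> m" for n m
      using that by (auto simp only: arctan_le_iff)
    then show "incseq (\<lambda>n x. indicator A x * indicator {arctan (- real n)..arctan (real n)} x :: ennreal)"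
      by (auto simp: incseq_def le_fun_def indicator_def intro: order_trans)
  qed simp
  also have "\<dots> = (SUP n. ?b n)" by (simp only: eq)
  also have "\<dots> = (\<integral>\<^sup>+t. (SUP n. ennreal (1 / (1 + t\<^sup>2)) * indicator A (arctan t) * indicator {- real n..real n} t) \<partial>lborel)"
    by (rule nn_integral_monotone_convergence_SUP[symmetric])
       (auto simp: incseq_def le_fun_def indicator_def)
  also have "\<dots> = (\<integral>\<^sup>+t. ennreal (1 / (1 + t\<^sup>2)) * indicator A (arctan t) \<partial>lborel)"
  proof (rule nn_integral_cong)
    fix t :: real
    obtain n :: nat where n: "\<bar>t\<bar> \<le> real n" using real_arch_simple by blast
    have "(SUP n. indicator {- real n..real n} t) = (1::ennreal)"
      by (rule antisym, intro SUP_least, simp split: split_indicator, intro SUP_upper2[of n])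
         (use n in \<open>auto simp: indicator_def\<close>)
    then show "(SUP n. ennreal (1 / (1 + t\<^sup>2)) * indicator A (arctan t) * indicator {- real n..real n} t) =
        ennreal (1 / (1 + t\<^sup>2)) * indicator A (arctan t)"
      by (subst SUP_mult_left_ennreal[symmetric]) simp
  qed
  also have "\<dots> = emeasure ?R A"
    using measurable_sets_borel[OF borel_measurable_arctan A]
    by (subst emeasure_distr; (subst emeasure_density)?) (auto simp: indicator_def intro!: nn_integral_cong)
  finally show "emeasure ?L A = emeasure ?R A" .
qed simp

lemma nn_integral_complex:
  assumes [measurable]: "f \<in> borel_measurable borel"
  shows "(\<integral>\<^sup>+z. f z \<partial>(lborel :: complex measure)) = (\<integral>\<^sup>+x. \<integral>\<^sup>+y. f (Complex x y) \<partial>lborel \<partial>lborel)"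
  by (subst lborel_complex, subst nn_integral_distr)
     (auto simp: split_beta' lborel.nn_integral_fst[symmetric])

lemma rcis_measurable [measurable]: "(\<lambda>(r, \<theta>). rcis r \<theta>) \<in> borel_measurable (borel \<Otimes>\<^sub>M borel)"
  unfolding rcis_def cis_conv_exp borel_prod split_beta'
  by (intro borel_measurable_continuous_onI continuous_intros)

text \<open>Substitute \<open>y = x t\<close>, then \<open>x = r / sqrt (1 + t\<^sup>2)\<close>, and finally \<open>t = tan \<theta>\<close>.\<close>
lemma polar_right_half_plane:
  assumes [measurable]: "f \<in> borel_measurable borel"
  shows "(\<integral>\<^sup>+z. f z * indicator {z. 0 < Re z} z \<partial>lborel) =
    (\<integral>\<^sup>+\<theta>. indicator {-pi/2<..<pi/2} \<theta> * (\<integral>\<^sup>+r. indicator {0<..} r * (ennreal r * f (rcis r \<theta>)) \<partial>lborel) \<partial>lborel)"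
proof -
  have "(\<integral>\<^sup>+z. f z * indicator {z. 0 < Re z} z \<partial>lborel) =
      (\<integral>\<^sup>+x. indicator {0<..} x * (\<integral>\<^sup>+y. f (Complex x y) \<partial>lborel) \<partial>lborel)"
    by (subst nn_integral_complex) (auto intro!: nn_integral_cong simp: indicator_def simp flip: nn_integral_cmult)
  also have "\<dots> = (\<integral>\<^sup>+x. \<integral>\<^sup>+t. indicator {0<..} x * (ennreal x * f (Complex x (x * t))) \<partial>lborel \<partial>lborel)"
  proof (rule nn_integral_cong)
    fix x :: real
    show "indicator {0<..} x * (\<integral>\<^sup>+y. f (Complex x y) \<partial>lborel) = (\<integral>\<^sup>+t. indicator {0<..} x * (ennreal x * f (Complex x (x * t))) \<partial>lborel)"
    proof (cases "0 < x")
      case True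
      then show ?thesis
        by (subst nn_integral_real_affine[of _ x 0]) (auto simp: nn_integral_cmult)
    qed simp
  qed
  also have "\<dots> = (\<integral>\<^sup>+t. \<integral>\<^sup>+x. indicator {0<..} x * (ennreal x * f (Complex x (x * t))) \<partial>lborel \<partial>lborel)"
    by (rule lborel_pair.Fubini'[symmetric]) measurable
  also have "\<dots> = (\<integral>\<^sup>+t. ennreal (1 / (1 + t\<^sup>2)) * (\<integral>\<^sup>+r. indicator {0<..} r * (ennreal r * f (rcis r (arctan t))) \<partial>lborel) \<partial>lborel)"
  proof (rule nn_integral_cong)
    fix t :: real
    \<comment> \<open>\<open>c\<close> is cos (arctan t), so x = c r turns (x, x t) into the point
      with polar coordinates r and arctan t. One factor \<open>c\<close> comes from dx, a second one
      from the factor x already present; together they give 1 / (1 + t^2).\<close>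
    define c where "c = 1 / sqrt (1 + t\<^sup>2)"
    have c: "0 < c" "c * c = 1 / (1 + t\<^sup>2)"
      unfolding c_def by (auto simp: add_pos_nonneg)
    have "(\<integral>\<^sup>+x. indicator {0<..} x * (ennreal x * f (Complex x (x * t))) \<partial>lborel) =
        ennreal c * (\<integral>\<^sup>+r. indicator {0<..} (c * r) * (ennreal (c * r) * f (Complex (c * r) (c * r * t))) \<partial>lborel)"
      using c by (subst nn_integral_real_affine[of _ c 0]) auto
    also have "\<dots> = ennreal c * (\<integral>\<^sup>+r. ennreal c * (indicator {0<..} r * (ennreal r * f (rcis r (arctan t)))) \<partial>lborel)"
    proof (rule arg_cong2[where f = "(*)"], rule refl, rule nn_integral_cong)
      fix r :: real
      have "Complex (c * r) (c * r * t) = rcis r (arctan t)"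
        by (simp add: complex_eq_iff c_def cos_arctan sin_arctan)
      then show "indicator {0<..} (c * r) * (ennreal (c * r) * f (Complex (c * r) (c * r * t))) =
          ennreal c * (indicator {0<..} r * (ennreal r * f (rcis r (arctan t))))"
        using c by (auto simp: indicator_def zero_less_mult_iff ennreal_mult mult_ac)
    qed
    also have "\<dots> = ennreal (c * c) * (\<integral>\<^sup>+r. indicator {0<..} r * (ennreal r * f (rcis r (arctan t))) \<partial>lborel)"
      using c(1) by (simp add: nn_integral_cmult ennreal_mult mult.assoc)
    finally show "(\<integral>\<^sup>+x. indicator {0<..} x * (ennreal x * f (Complex x (x * t))) \<partial>lborel) =
       ennreal (1 / (1 + t\<^sup>2)) * (\<integral>\<^sup>+r. indicator {0<..} r * (ennreal r * f (rcis r (arctan t))) \<partial>lborel)"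
      using c by simp
  qed
  also have "\<dots> = (\<integral>\<^sup>+\<theta>. (\<integral>\<^sup>+r. indicator {0<..} r * (ennreal r * f (rcis r \<theta>)) \<partial>lborel)
       \<partial>distr (density lborel (\<lambda>t. ennreal (1 / (1 + t\<^sup>2)))) borel arctan)"
    by (subst nn_integral_distr; (subst nn_integral_density)?) auto
  also have "\<dots> = (\<integral>\<^sup>+\<theta>. indicator {-pi/2<..<pi/2} \<theta> * (\<integral>\<^sup>+r. indicator {0<..} r * (ennreal r * f (rcis r \<theta>)) \<partial>lborel) \<partial>lborel)"
    by (subst arctan_distr[symmetric], subst nn_integral_density) auto
  finally show ?thesis .
qed

text \<open>The window [a, a + 1) contains one integer k. Moving the part left of k by one period to
  the right produces [k, k + 1), which is an integer translate of the unit interval.\<close>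

lemma nn_integral_periodic:
  fixes g :: "real \<Rightarrow> ennreal"
  assumes [measurable]: "g \<in> borel_measurable borel" and per: "\<And>t. g (t + 1) = g t"
  shows "(\<integral>\<^sup>+t. g t * indicator {a..<a + 1} t \<partial>lborel) = (\<integral>\<^sup>+t. g t * indicator {0..1} t \<partial>lborel)"
proof -
  define k where "k = \<lceil>a\<rceil>"
  have k: "a \<le> of_int k" "of_int k < a + 1" unfolding k_def by linarith+
  have per_int: "g (of_int k + t) = g t" for t
  proof -
    have nat: "g (t + real n) = g t" for n t
    proof (induction n arbitrary: t)
      case (Suc n)
      then show ?case using per[of "t + real n"] by (simp add: ac_simps)
    qed simp
    show ?thesis
    proof (cases "0 \<le> k")
      case True
      then show ?thesis using nat[of t "nat k"] by (simp add: add.commute)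
    next
      case False
      then show ?thesis using nat[of "of_int k + t" "nat (- k)"] by (simp add: add.commute)
    qed
  qed
  have "(\<integral>\<^sup>+t. g t * indicator {a..<a + 1} t \<partial>lborel) =
      (\<integral>\<^sup>+t. g t * indicator {a..<of_int k} t + g t * indicator {of_int k..<a + 1} t \<partial>lborel)"
    using k by (intro nn_integral_cong) (auto simp: indicator_def)
  also have "\<dots> = (\<integral>\<^sup>+t. g t * indicator {a..<of_int k} t \<partial>lborel) + (\<integral>\<^sup>+t. g t * indicator {of_int k..<a + 1} t \<partial>lborel)"
    by (rule nn_integral_add) auto
  also have "(\<integral>\<^sup>+t. g t * indicator {a..<of_int k} t \<partial>lborel) =
      (\<integral>\<^sup>+t. g (-1 + 1 * t) * indicator {a..<of_int k} (-1 + 1 * t) \<partial>lborel)"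
    by (subst nn_integral_real_affine[of _ 1 "-1"]) auto
  also have "\<dots> = (\<integral>\<^sup>+t. g t * indicator {a + 1..<of_int k + 1} t \<partial>lborel)"
  proof (rule nn_integral_cong)
    fix t :: real
    show "g (-1 + 1 * t) * indicator {a..<of_int k} (-1 + 1 * t) = g t * indicator {a + 1..<of_int k + 1} t"
      using per[of "t - 1"] by (simp add: indicator_def algebra_simps)
  qed
  also have "\<dots> + (\<integral>\<^sup>+t. g t * indicator {of_int k..<a + 1} t \<partial>lborel) =
     (\<integral>\<^sup>+t. g t * indicator {a + 1..<of_int k + 1} t + g t * indicator {of_int k..<a + 1} t \<partial>lborel)"
    by (rule nn_integral_add[symmetric]) auto
  also have "\<dots> = (\<integral>\<^sup>+t. g t * indicator {of_int k..<of_int k + 1} t \<partial>lborel)"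
    using k by (intro nn_integral_cong) (auto simp: indicator_def)
  also have "\<dots> = (\<integral>\<^sup>+t. g (of_int k + 1 * t) * indicator {of_int k..<of_int k + 1} (of_int k + 1 * t) \<partial>lborel)"
    by (subst nn_integral_real_affine[of _ 1 "of_int k"]) auto
  \<comment> \<open>The closed unit interval on the right differs from the half-open one by the null
    set {1}.\<close>
  also have "\<dots> = (\<integral>\<^sup>+t. g t * indicator {0..1} t \<partial>lborel)"
    using AE_lborel_singleton[of 1]
    by (intro nn_integral_cong_AE) (auto simp: per_int indicator_def)
  finally show ?thesis .
qed

lemma nn_integral_complex_uminus:
  assumes [measurable]: "f \<in> borel_measurable borel"
  shows "(\<integral>\<^sup>+z. f (- z) \<partial>(lborel :: complex measure)) = (\<integral>\<^sup>+z. f z \<partial>lborel)"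
proof -
  have "(lborel :: complex measure) = distr lborel borel uminus"
    using lborel_affine[of "-1" "0 :: complex"] by (simp add: density_1)
  then have "(\<integral>\<^sup>+z. f z \<partial>lborel) = (\<integral>\<^sup>+z. f z \<partial>distr lborel borel uminus)" by simp
  also have "\<dots> = (\<integral>\<^sup>+z. f (- z) \<partial>lborel)"
    by (rule nn_integral_distr) auto
  finally show ?thesis ..
qed

text \<open>The left half-plane is the reflection of the right one, which shifts the angle by pi;
  the two ranges of angles fill one period up to null sets. The angle is written 2 pi t with t in
  [0, 1] so as to agree with the parametrization of \<open>circlepath\<close>.\<close>

lemma nn_integral_polar:
  assumes [measurable]: "f \<in> borel_measurable borel"
  shows "(\<integral>\<^sup>+z. f z \<partial>lborel) =
    (\<integral>\<^sup>+t. (\<integral>\<^sup>+r. indicator {0<..} r * (ennreal (2 * pi * r) * f (rcis r (2 * pi * t))) \<partial>lborel) * indicator {0..1} t \<partial>lborel)"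
proof -
  define F where "F \<theta> = (\<integral>\<^sup>+r. indicator {0<..} r * (ennreal r * f (rcis r \<theta>)) \<partial>lborel)" for \<theta>
  have [measurable]: "F \<in> borel_measurable borel" unfolding F_def by measurable
  have per: "F (\<theta> + 2 * pi) = F \<theta>" for \<theta>
    unfolding F_def rcis_def by (simp add: cis_mult[symmetric])
  \<comment> \<open>The imaginary axis, which belongs to neither half-plane, is a null set by
    Fubini.\<close>
  have "emeasure lborel {z. Re z = 0} = (\<integral>\<^sup>+z. indicator {z. Re z = 0} z \<partial>lborel)"
    by (subst nn_integral_indicator) auto
  also have "\<dots> = (\<integral>\<^sup>+x. indicator {0} x * (\<integral>\<^sup>+y. 1 \<partial>(lborel :: real measure)) \<partial>(lborel :: real measure))"
    by (subst nn_integral_complex) (auto intro!: nn_integral_cong simp: indicator_def)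
  also have "\<dots> = (\<integral>\<^sup>+x. 0 \<partial>(lborel :: real measure))"
    using AE_lborel_singleton[of 0] by (intro nn_integral_cong_AE) (auto simp: indicator_def)
  finally have "AE z in lborel. Re z \<noteq> 0"
    by (intro AE_I[of _ _ "{z. Re z = 0}"]) auto
  then have "(\<integral>\<^sup>+z. f z \<partial>lborel) =
     (\<integral>\<^sup>+z. f z * indicator {z. 0 < Re z} z + f z * indicator {z. Re z < 0} z \<partial>lborel)"
    by (intro nn_integral_cong_AE) (auto simp: indicator_def)
  also have "\<dots> = (\<integral>\<^sup>+z. f z * indicator {z. 0 < Re z} z \<partial>lborel) + (\<integral>\<^sup>+z. f z * indicator {z. Re z < 0} z \<partial>lborel)"
    by (rule nn_integral_add) auto
  also have "(\<integral>\<^sup>+z. f z * indicator {z. Re z < 0} z \<partial>lborel) = (\<integral>\<^sup>+z. f (- z) * indicator {z. 0 < Re z} z \<partial>lborel)"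
    by (subst nn_integral_complex_uminus[symmetric]) (auto simp: indicator_def)
  also have "\<dots> = (\<integral>\<^sup>+\<theta>. indicator {-pi/2<..<pi/2} \<theta> * F (\<theta> + pi) \<partial>lborel)"
    unfolding F_def by (subst polar_right_half_plane) (auto simp: rcis_def cis_mult[symmetric])
  also have "\<dots> = (\<integral>\<^sup>+\<theta>. indicator {pi/2<..<3*pi/2} \<theta> * F \<theta> \<partial>lborel)"
    by (subst nn_integral_real_affine[of _ 1 "-pi"]) (auto simp: indicator_def intro!: nn_integral_cong)
  also have "(\<integral>\<^sup>+z. f z * indicator {z. 0 < Re z} z \<partial>lborel) = (\<integral>\<^sup>+\<theta>. indicator {-pi/2<..<pi/2} \<theta> * F \<theta> \<partial>lborel)"
    unfolding F_def by (rule polar_right_half_plane) measurable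
  also have "\<dots> + (\<integral>\<^sup>+\<theta>. indicator {pi/2<..<3*pi/2} \<theta> * F \<theta> \<partial>lborel) =
      (\<integral>\<^sup>+\<theta>. indicator {-pi/2<..<pi/2} \<theta> * F \<theta> + indicator {pi/2<..<3*pi/2} \<theta> * F \<theta> \<partial>lborel)"
    by (rule nn_integral_add[symmetric]) auto
  also have "\<dots> = (\<integral>\<^sup>+\<theta>. F \<theta> * indicator {-pi/2..<3*pi/2} \<theta> \<partial>lborel)"
    using AE_lborel_singleton[of "-pi/2"] AE_lborel_singleton[of "pi/2"]
    by (intro nn_integral_cong_AE) (auto simp: indicator_def)
  \<comment> \<open>Rescaling the angle by 2 pi makes the period 1 and the window [-1/4, 3/4), which
    periodicity moves to [0, 1].\<close>
  also have "\<dots> = ennreal (2 * pi) * (\<integral>\<^sup>+t. F (2 * pi * t) * indicator {-1/4..<-1/4 + 1} t \<partial>lborel)"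
  proof -
    have "-pi/2 \<le> 2 * pi * t \<longleftrightarrow> -1/4 \<le> t" "2 * pi * t < 3*pi/2 \<longleftrightarrow> t < -1/4 + 1" for t
      using mult_le_cancel_left_pos[of "2 * pi" "-1/4" t] mult_less_cancel_left_pos[of "2 * pi" t "3/4"] by auto
    then have "indicator {-pi/2..<3*pi/2} (2 * pi * t) = (indicator {-1/4..<-1/4 + 1} t :: ennreal)" for t
      by (simp add: indicator_def)
    then show ?thesis
      by (subst nn_integral_real_affine[of _ "2 * pi" 0]) auto
  qed
  also have "\<dots> = ennreal (2 * pi) * (\<integral>\<^sup>+t. F (2 * pi * t) * indicator {0..1} t \<partial>lborel)"
    using per by (subst nn_integral_periodic) (auto simp: distrib_left)
  also have "\<dots> = (\<integral>\<^sup>+t. (ennreal (2 * pi) * F (2 * pi * t)) * indicator {0..1} t \<partial>lborel)"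
    by (subst nn_integral_cmult[symmetric]) (auto simp: mult.assoc)
  also have "(\<lambda>t. ennreal (2 * pi) * F (2 * pi * t)) =
     (\<lambda>t. \<integral>\<^sup>+r. indicator {0<..} r * (ennreal (2 * pi * r) * f (rcis r (2 * pi * t))) \<partial>lborel)"
    unfolding F_def
    by (subst nn_integral_cmult[symmetric])
       (auto intro!: nn_integral_cong simp: indicator_def ennreal_mult' mult_ac)
  finally show ?thesis .
qed

text \<open>In polar coordinates multiplication by c scales the radius, which gives |c| once from dr
  and once from the factor r, and shifts the angle by Arg c, which periodicity absorbs. This is the
  Jacobian of the map to the Hartogs triangle and of dilations of discs.\<close>

lemma nn_integral_complex_cmult:
  assumes f [measurable]: "f \<in> borel_measurable borel" and c: "c \<noteq> 0"
  shows "(\<integral>\<^sup>+z. f z \<partial>(lborel :: complex measure)) = ennreal ((cmod c)\<^sup>2) * (\<integral>\<^sup>+z. f (c * z) \<partial>lborel)"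
proof -
  define a where "a = Arg c / (2 * pi)"
  have ca: "rcis (cmod c) (2 * pi * a) = c" by (simp add: a_def rcis_cmod_Arg)
  define F where "F \<theta> = (\<integral>\<^sup>+r. indicator {0<..} r * (ennreal (2 * pi * r) * f (rcis r \<theta>)) \<partial>lborel)" for \<theta>
  have [measurable]: "F \<in> borel_measurable borel" unfolding F_def by measurable
  have per: "F (2 * pi * (t + 1)) = F (2 * pi * t)" for t
    unfolding F_def rcis_def by (simp add: cis_mult[symmetric] distrib_left)
  have cF: "ennreal ((cmod c)\<^sup>2) * (\<integral>\<^sup>+r. indicator {0<..} r * (ennreal (2 * pi * r) * f (c * rcis r (2 * pi * t))) \<partial>lborel)
      = F (2 * pi * (a + t))" for t
  proof -
    have "F (2 * pi * (a + t)) = cmod c * (\<integral>\<^sup>+r. indicator {0<..} (cmod c * r) *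
        (ennreal (2 * pi * (cmod c * r)) * f (rcis (cmod c * r) (2 * pi * (a + t)))) \<partial>lborel)"
      unfolding F_def using c by (subst nn_integral_real_affine[of _ "cmod c" 0]) auto
    also have "\<dots> = cmod c * (\<integral>\<^sup>+r. cmod c * (indicator {0<..} r *
        (ennreal (2 * pi * r) * f (c * rcis r (2 * pi * t)))) \<partial>lborel)"
    proof (rule arg_cong2[where f = "(*)"], rule refl, rule nn_integral_cong)
      fix r :: real
      have "rcis (cmod c * r) (2 * pi * (a + t)) = c * rcis r (2 * pi * t)"
        by (subst (2) ca[symmetric]) (simp only: rcis_mult distrib_left)
      then show "indicator {0<..} (cmod c * r) *
        (ennreal (2 * pi * (cmod c * r)) * f (rcis (cmod c * r) (2 * pi * (a + t)))) = cmod c * (indicator {0<..} r *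
        (ennreal (2 * pi * r) * f (c * rcis r (2 * pi * t))))"
        using c by (auto simp: indicator_def zero_less_mult_iff ennreal_mult'' mult_ac simp flip: ennreal_mult')
    qed
    also have "\<dots> = ennreal ((cmod c)\<^sup>2) * (\<integral>\<^sup>+r. indicator {0<..} r * (ennreal (2 * pi * r) * f (c * rcis r (2 * pi * t))) \<partial>lborel)"
      by (simp add: nn_integral_cmult ennreal_mult power2_eq_square mult.assoc)
    finally show ?thesis ..
  qed
  define H where "H t = (\<integral>\<^sup>+r. indicator {0<..} r * (ennreal (2 * pi * r) * f (c * rcis r (2 * pi * t))) \<partial>lborel)" for t
  have [measurable]: "H \<in> borel_measurable borel" unfolding H_def by measurable
  have "(\<integral>\<^sup>+z. f (c * z) \<partial>lborel) = (\<integral>\<^sup>+t. H t * indicator {0..1} t \<partial>lborel)"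
    unfolding H_def by (rule nn_integral_polar) measurable
  then have "ennreal ((cmod c)\<^sup>2) * (\<integral>\<^sup>+z. f (c * z) \<partial>lborel) = (\<integral>\<^sup>+t. F (2 * pi * (a + t)) * indicator {0..1} t \<partial>lborel)"
    unfolding cF[folded H_def, symmetric] by (simp add: nn_integral_cmult mult.assoc)
  also have "\<dots> = (\<integral>\<^sup>+t. F (2 * pi * (a + 1 * t)) * indicator {a..<a + 1} (a + 1 * t) \<partial>lborel)"
    by (rule nn_integral_cong_AE, rule eventually_mono[OF AE_lborel_singleton[of 1]]) (auto simp: indicator_def)
  also have "\<dots> = (\<integral>\<^sup>+t. F (2 * pi * t) * indicator {a..<a + 1} t \<partial>lborel)"
    by (subst (2) nn_integral_real_affine[of _ 1 a]) auto
  also have "\<dots> = (\<integral>\<^sup>+t. F (2 * pi * t) * indicator {0..1} t \<partial>lborel)"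
    using per by (intro nn_integral_periodic) auto
  also have "\<dots> = (\<integral>\<^sup>+z. f z \<partial>lborel)"
    unfolding F_def by (rule nn_integral_polar[symmetric]) fact
  finally show ?thesis ..
qed

section \<open>Weighted measures on the disc in polar coordinates\<close>

text \<open>
  Since \<open>0 powr 0 = 0\<close>, the density vanishes at the origin even for \<open>a = 0\<close>; this changes only a
  null set.
\<close>
definition disc_measure :: "real \<Rightarrow> complex measure"
  where "disc_measure a = density lborel (\<lambda>w. ennreal (indicator (ball 0 1) w * cmod w powr (- a)))"

text \<open>The radial factor of \<open>disc_measure a\<close>: the weight r^(-a) times the area
  element r dr, with 2 pi from normalizing the angle to an interval of length 1.\<close>

definition radial_measure :: "real \<Rightarrow> real measure"
  where "radial_measure a = density lborel (\<lambda>r. ennreal (indicator {0<..<1} r * (2 * pi * r powr (1 - a))))"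

definition circle_measure :: "real measure"
  where "circle_measure = density lborel (indicator {0..1})"

lemma sets_disc_measure [simp, measurable_cong]: "sets (disc_measure a) = sets borel"
  and sets_radial_measure [simp, measurable_cong]: "sets (radial_measure a) = sets borel"
  and sets_circle_measure [simp, measurable_cong]: "sets circle_measure = sets borel"
  by (simp_all add: disc_measure_def radial_measure_def circle_measure_def)

lemma space_disc_measure [simp]: "space (disc_measure a) = UNIV"
  and space_radial_measure [simp]: "space (radial_measure a) = UNIV"
  and space_circle_measure [simp]: "space circle_measure = UNIV"
  by (simp_all add: disc_measure_def radial_measure_def circle_measure_def)

lemma sigma_finite_disc_measure: "sigma_finite_measure (disc_measure a)"
  and sigma_finite_radial_measure: "sigma_finite_measure (radial_measure a)"
  and sigma_finite_circle_measure: "sigma_finite_measure circle_measure"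
  unfolding disc_measure_def radial_measure_def circle_measure_def
  by (intro sigma_finite_measure.sigma_finite_iff_density_finite[OF sigma_finite_lborel, THEN iffD2]; simp add: indicator_def)+

interpretation disc: pair_sigma_finite "disc_measure a" "disc_measure b" for a b
  by (simp add: pair_sigma_finite_def sigma_finite_disc_measure)

interpretation polar: pair_sigma_finite "radial_measure a" circle_measure for a
  by (simp add: pair_sigma_finite_def sigma_finite_radial_measure sigma_finite_circle_measure)

lemma AE_disc_measure: "AE w in disc_measure a. w \<noteq> 0 \<and> cmod w < 1"
  unfolding disc_measure_def using AE_lborel_singleton[of 0]
  by (subst AE_density) (auto simp: indicator_def elim: eventually_mono)

lemma AE_radial_measure: "AE r in radial_measure a. 0 < r \<and> r < 1"
  unfolding radial_measure_def by (subst AE_density) (auto simp: indicator_def)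

lemma rcis_circle_measurable [measurable]:
  "(\<lambda>(r, t). rcis r (2 * pi * t)) \<in> borel_measurable (borel \<Otimes>\<^sub>M borel)"
  by measurable

lemma disc_measure_polar:
  "disc_measure a = distr (radial_measure a \<Otimes>\<^sub>M circle_measure) borel (\<lambda>(r, t). rcis r (2 * pi * t))"
proof (rule measure_eqI)
  fix A assume "A \<in> sets (disc_measure a)"
  then have [measurable]: "A \<in> sets borel" by simp
  have [measurable]: "(ball 0 1 :: complex set) \<in> sets borel" by simp
  define g where "g w = ennreal (indicator (ball 0 1) w * cmod w powr (- a)) * indicator A w" for w :: complex
  have [measurable]: "g \<in> borel_measurable borel" unfolding g_def by measurable
  have *: "indicator {0<..} r * (ennreal (2 * pi * r) * g (rcis r \<theta>)) =
      ennreal (indicator {0<..<1} r * (2 * pi * r powr (1 - a))) * indicator A (rcis r \<theta>)" for r \<theta>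
  proof (cases "0 < r")
    case True
    then have "r * r powr (- a) = r powr (1 - a)"
      using powr_add[of r 1 "- a"] by simp
    with True show ?thesis
      by (auto simp: g_def indicator_def rcis_def norm_mult simp flip: ennreal_mult'' )
  qed simp
  have "emeasure (disc_measure a) A = (\<integral>\<^sup>+w. g w \<partial>lborel)"
    unfolding disc_measure_def g_def by (subst emeasure_density) auto
  also have "\<dots> = (\<integral>\<^sup>+t. (\<integral>\<^sup>+r. ennreal (indicator {0<..<1} r * (2 * pi * r powr (1 - a))) * indicator A (rcis r (2 * pi * t)) \<partial>lborel) * indicator {0..1} t \<partial>lborel)"
    by (subst nn_integral_polar) (simp_all only: *, measurable)
  also have "\<dots> = (\<integral>\<^sup>+t. (\<integral>\<^sup>+r. indicator A (rcis r (2 * pi * t)) \<partial>radial_measure a) \<partial>circle_measure)"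
  proof -
    have "(\<integral>\<^sup>+r. indicator A (rcis r \<theta>) \<partial>radial_measure a) =
        (\<integral>\<^sup>+r. ennreal (indicator {0<..<1} r * (2 * pi * r powr (1 - a))) * indicator A (rcis r \<theta>) \<partial>lborel)" for \<theta>
      unfolding radial_measure_def by (rule nn_integral_density) measurable
    then show ?thesis
      unfolding circle_measure_def by (subst nn_integral_density) (simp_all only: mult.commute, measurable)
  qed
  also have "\<dots> = (\<integral>\<^sup>+x. indicator A (case x of (r, t) \<Rightarrow> rcis r (2 * pi * t)) \<partial>(radial_measure a \<Otimes>\<^sub>M circle_measure))"
    by (subst polar.nn_integral_snd[symmetric]) auto
  also have "\<dots> = emeasure (distr (radial_measure a \<Otimes>\<^sub>M circle_measure) borel (\<lambda>(r, t). rcis r (2 * pi * t))) A"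
    by (subst nn_integral_indicator[symmetric], simp, subst nn_integral_distr) auto
  finally show "emeasure (disc_measure a) A = \<dots>" .
qed simp

lemma nn_integral_disc_polar:
  assumes [measurable]: "f \<in> borel_measurable borel"
  shows "(\<integral>\<^sup>+w. f w \<partial>disc_measure a) = (\<integral>\<^sup>+r. \<integral>\<^sup>+t. f (rcis r (2 * pi * t)) \<partial>circle_measure \<partial>radial_measure a)"
  unfolding disc_measure_polar
  by (subst nn_integral_distr) (auto simp: split_beta' polar.M2.nn_integral_fst[symmetric])

lemma integrable_disc_polar:
  fixes f :: "complex \<Rightarrow> complex"
  assumes f: "integrable (disc_measure a) f"
  shows "integrable (radial_measure a) (\<lambda>r. \<integral>t. f (rcis r (2 * pi * t)) \<partial>circle_measure)"
    and "(\<integral>w. f w \<partial>disc_measure a) = (\<integral>r. \<integral>t. f (rcis r (2 * pi * t)) \<partial>circle_measure \<partial>radial_measure a)"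
proof -
  have [measurable]: "f \<in> borel_measurable borel" using f by auto
  have int: "integrable (radial_measure a \<Otimes>\<^sub>M circle_measure) (\<lambda>(r, t). f (rcis r (2 * pi * t)))"
    using f unfolding disc_measure_polar by (subst (asm) integrable_distr_eq) (auto simp: split_beta')
  show "integrable (radial_measure a) (\<lambda>r. \<integral>t. f (rcis r (2 * pi * t)) \<partial>circle_measure)"
    using polar.integrable_fst'[OF int] by simp
  have "(\<integral>w. f w \<partial>disc_measure a) = (\<integral>x. (case x of (r, t) \<Rightarrow> f (rcis r (2 * pi * t))) \<partial>(radial_measure a \<Otimes>\<^sub>M circle_measure))"
    unfolding disc_measure_polar by (subst integral_distr) (auto simp: split_beta')
  then show "(\<integral>w. f w \<partial>disc_measure a) = (\<integral>r. \<integral>t. f (rcis r (2 * pi * t)) \<partial>circle_measure \<partial>radial_measure a)"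
    using polar.integral_fst'[OF int] by simp
qed

section \<open>Weighted Bergman kernels of the disc\<close>

text \<open>
  The Bergman kernel of the disc with weight \<open>|w| powr (- s)\<close> is \<open>disc_kernel s (z * cnj w)\<close>: the squared
  norm of \<open>w ^ k\<close> is \<open>2 \<pi> / (2 k + 2 - s)\<close>, and \<open>\<Sum>k. (2 k + 2 - s) / (2 \<pi>) x ^ k\<close> is the function below.
\<close>
definition disc_kernel :: "real \<Rightarrow> complex \<Rightarrow> complex"
  where "disc_kernel s x = (2 - of_real s * (1 - x)) / (2 * of_real pi * (1 - x)\<^sup>2)"

text \<open>On u = r exp (2 pi i t) one has du / u = 2 pi i dt, so a mean over the circle is a
  contour integral of g u / u. This is the bridge from Lebesgue integrals to Cauchy's
  formulas.\<close>

lemma circle_measure_integral: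
  fixes g :: "complex \<Rightarrow> complex"
  assumes r: "0 < r" and cont: "continuous_on (sphere 0 r) g"
  shows "integrable circle_measure (\<lambda>t. g (rcis r (2 * pi * t)))"
    and "((\<lambda>u. g u / u) has_contour_integral (2 * of_real pi * \<i> * c)) (circlepath 0 r) \<Longrightarrow>
      (\<integral>t. g (rcis r (2 * pi * t)) \<partial>circle_measure) = c"
proof -
  have circ: "circlepath 0 r t = rcis r (2 * pi * t)" for t
    by (simp add: circlepath rcis_def cis_conv_exp mult_ac)
  have c: "continuous_on UNIV (\<lambda>t. g (rcis r (2 * pi * t)))"
    using r unfolding rcis_def cis_conv_exp
    by (intro continuous_on_compose2[OF cont] continuous_intros) (auto simp: norm_mult)
  then have int: "set_integrable lborel {0..1} (\<lambda>t. g (rcis r (2 * pi * t)))"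
    by (intro borel_integrable_atLeastAtMost') (rule continuous_on_subset, auto)
  have [measurable]: "(\<lambda>t. g (rcis r (2 * pi * t))) \<in> borel_measurable borel"
    using c by (rule borel_measurable_continuous_onI)
  have circle_alt: "circle_measure = density lborel (\<lambda>t. ennreal (indicator {0..1} t))"
    unfolding circle_measure_def by (simp add: ennreal_indicator)
  show "integrable circle_measure (\<lambda>t. g (rcis r (2 * pi * t)))"
    unfolding circle_alt by (subst integrable_density) (use int in \<open>auto simp: set_integrable_def\<close>)
  assume "((\<lambda>u. g u / u) has_contour_integral (2 * of_real pi * \<i> * c)) (circlepath 0 r)"
  then have "((\<lambda>t. 2 * of_real pi * \<i> * g (rcis r (2 * pi * t))) has_integral (2 * of_real pi * \<i> * c)) {0..1}"
    unfolding has_contour_integral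
  proof (rule has_integral_eq[rotated])
    fix t :: real
    have "vector_derivative (circlepath 0 r) (at t) = 2 * of_real pi * \<i> * circlepath 0 r t"
      using vector_derivative_circlepath[of 0 r t] by (simp add: circlepath)
    moreover have "circlepath 0 r t \<noteq> 0" unfolding circlepath using r by simp
    ultimately show "g (circlepath 0 r t) / circlepath 0 r t * vector_derivative (circlepath 0 r) (at t) =
        2 * of_real pi * \<i> * g (rcis r (2 * pi * t))"
      by (simp add: circ)
  qed
  from has_integral_mult_right[OF this, of "1 / (2 * of_real pi * \<i>)"]
  have "((\<lambda>t. g (rcis r (2 * pi * t))) has_integral c) {0..1}"
    by simp
  then show "(\<integral>t. g (rcis r (2 * pi * t)) \<partial>circle_measure) = c"
    unfolding circle_alt using set_borel_integral_eq_integral(2)[OF int]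
    by (subst integral_density) (auto simp: set_lebesgue_integral_def integral_unique)
qed

lemma one_minus_cnj_nonzero: "cmod z < 1 \<Longrightarrow> cmod w \<le> 1 \<Longrightarrow> 1 - z * cnj w \<noteq> 0"
  using mult_mono[of "cmod z" "cmod z" "cmod w" 1] by (auto simp: norm_mult dest!: arg_cong[of _ _ cmod])

text \<open>On the circle of radius \<open>r\<close>, \<open>1 - z * cnj u = (u - w) / u\<close>, which turns both integrals into Cauchy integrals at \<open>w\<close>.\<close>
lemma circle_integral_cauchy:
  assumes G: "G holomorphic_on ball 0 1" and r: "0 < r" "r < 1" and z: "cmod z < 1"
  defines "w \<equiv> z * of_real (r\<^sup>2)"
  shows "integrable circle_measure (\<lambda>t. G (rcis r (2 * pi * t)) / (1 - z * cnj (rcis r (2 * pi * t))))"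
    and "(\<integral>t. G (rcis r (2 * pi * t)) / (1 - z * cnj (rcis r (2 * pi * t))) \<partial>circle_measure) = G w"
    and "integrable circle_measure (\<lambda>t. G (rcis r (2 * pi * t)) / (1 - z * cnj (rcis r (2 * pi * t)))\<^sup>2)"
    and "(\<integral>t. G (rcis r (2 * pi * t)) / (1 - z * cnj (rcis r (2 * pi * t)))\<^sup>2 \<partial>circle_measure) = G w + w * deriv G w"
proof -
  have w: "cmod w < r"
    unfolding w_def using r z mult_strict_mono[of "cmod z" 1 "r\<^sup>2" r]
    by (auto simp: norm_mult power2_eq_square norm_power)
  have sub: "cball 0 r \<subseteq> ball (0::complex) 1" using r by auto
  have cont: "continuous_on (cball 0 r) G"
    using G sub holomorphic_on_imp_continuous_on holomorphic_on_subset by blast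
  have hol: "G holomorphic_on ball 0 r"
    using G r by (elim holomorphic_on_subset) auto
  have nz: "1 - z * cnj u \<noteq> 0" if "cmod u = r" for u
    using one_minus_cnj_nonzero[OF z, of u] r that by auto
  have nzw: "u - w \<noteq> 0" if "cmod u = r" for u
    using w that by auto
  have quot: "1 - z * cnj u = (u - w) / u" if "cmod u = r" for u
  proof -
    have "u \<noteq> 0" "u * cnj u = of_real (r\<^sup>2)"
      using that r by (auto simp: complex_norm_square[symmetric])
    then show ?thesis by (simp add: w_def field_simps)
  qed
  have c1: "continuous_on (sphere 0 r) (\<lambda>u. G u / (1 - z * cnj u))"
    and c2: "continuous_on (sphere 0 r) (\<lambda>u. G u / (1 - z * cnj u)\<^sup>2)"
    using nz by (auto intro!: continuous_intros continuous_on_subset[OF cont])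
  show "integrable circle_measure (\<lambda>t. G (rcis r (2 * pi * t)) / (1 - z * cnj (rcis r (2 * pi * t))))"
    and "integrable circle_measure (\<lambda>t. G (rcis r (2 * pi * t)) / (1 - z * cnj (rcis r (2 * pi * t)))\<^sup>2)"
    using circle_measure_integral(1)[OF r(1) c1] circle_measure_integral(1)[OF r(1) c2] by simp_all
  show "(\<integral>t. G (rcis r (2 * pi * t)) / (1 - z * cnj (rcis r (2 * pi * t))) \<partial>circle_measure) = G w"
  proof (rule circle_measure_integral(2)[OF r(1) c1])
    have "((\<lambda>u. G u / (u - w)) has_contour_integral (2 * of_real pi * \<i> * G w)) (circlepath 0 r)"
      using cont hol w by (intro Cauchy_integral_circlepath) auto
    then show "((\<lambda>u. G u / (1 - z * cnj u) / u) has_contour_integral (2 * of_real pi * \<i> * G w)) (circlepath 0 r)"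
      by (rule has_contour_integral_eq) (use r quot in auto)
  qed
  show "(\<integral>t. G (rcis r (2 * pi * t)) / (1 - z * cnj (rcis r (2 * pi * t)))\<^sup>2 \<partial>circle_measure) = G w + w * deriv G w"
  proof (rule circle_measure_integral(2)[OF r(1) c2])
    \<comment> \<open>By \<open>quot\<close> the integrand G u / (1 - z cnj u)^2 / u equals u G u /
      (u - w)^2. Cauchy's formula for the derivative is therefore applied to u G u, whose derivative
      at w is G w + w G' w.\<close>
    have cu: "continuous_on (cball 0 r) (\<lambda>u. u * G u)" "(\<lambda>u. u * G u) holomorphic_on ball 0 r" "w \<in> ball 0 r"
      using cont hol w by (auto intro!: continuous_intros holomorphic_intros)
    have "G field_differentiable at w"
      using hol cu(3) by (simp add: holomorphic_on_imp_differentiable_at)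
    then have "((\<lambda>u. u * G u) has_field_derivative G w + w * deriv G w) (at w)"
      by (auto intro!: derivative_eq_intros simp: DERIV_deriv_iff_field_differentiable mult.commute)
    from DERIV_unique[OF this Cauchy_derivative_integral_circlepath(2)[OF cu]]
    have "contour_integral (circlepath 0 r) (\<lambda>u. u * G u / (u - w)\<^sup>2) = 2 * of_real pi * \<i> * (G w + w * deriv G w)"
      by (simp add: field_simps)
    then have "((\<lambda>u. u * G u / (u - w)\<^sup>2) has_contour_integral 2 * of_real pi * \<i> * (G w + w * deriv G w)) (circlepath 0 r)"
      using Cauchy_derivative_integral_circlepath(1)[OF cu] has_contour_integral_integral by metis
    then show "((\<lambda>u. G u / (1 - z * cnj u)\<^sup>2 / u) has_contour_integral 2 * of_real pi * \<i> * (G w + w * deriv G w)) (circlepath 0 r)"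
    proof (rule has_contour_integral_eq)
      fix u assume "u \<in> path_image (circlepath 0 r)"
      then have u: "cmod u = r" using r by auto
      have "u \<noteq> 0" using u r by auto
      then show "u * G u / (u - w)\<^sup>2 = G u / (1 - z * cnj u)\<^sup>2 / u"
        using nzw[OF u] unfolding quot[OF u] by (simp add: power_divide power2_eq_square)
    qed
  qed
qed

text \<open>Partial fractions: integrals against the kernel reduce to the two Cauchy integrals
  above.\<close>

lemma disc_kernel_split: "x \<noteq> 1 \<Longrightarrow> disc_kernel s x = (1 / of_real pi) * (1 / (1 - x)\<^sup>2) - (of_real s / (2 * of_real pi)) * (1 / (1 - x))"
  unfolding disc_kernel_def by (simp add: divide_simps power2_eq_square) (simp add: algebra_simps)

lemma circle_integral_disc_kernel:
  assumes G: "G holomorphic_on ball 0 1" and r: "0 < r" "r < 1" and z: "cmod z < 1"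
  defines "w \<equiv> z * of_real (r\<^sup>2)"
  shows "(\<integral>t. disc_kernel s (z * cnj (rcis r (2 * pi * t))) * G (rcis r (2 * pi * t)) \<partial>circle_measure) =
    (2 * (G w + w * deriv G w) - of_real s * G w) / (2 * of_real pi)"
proof -
  note C = circle_integral_cauchy[OF G r z, folded w_def]
  let ?e = "\<lambda>t. rcis r (2 * pi * t)"
  have "(\<integral>t. disc_kernel s (z * cnj (?e t)) * G (?e t) \<partial>circle_measure) =
    (\<integral>t. (1 / of_real pi) * (G (?e t) / (1 - z * cnj (?e t))\<^sup>2) - (of_real s / (2 * of_real pi)) * (G (?e t) / (1 - z * cnj (?e t))) \<partial>circle_measure)"
  proof (rule Bochner_Integration.integral_cong, rule refl)
    fix t
    have "z * cnj (?e t) \<noteq> 1"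
      using one_minus_cnj_nonzero[OF z, of "?e t"] r by auto
    from disc_kernel_split[OF this, of s] show "disc_kernel s (z * cnj (?e t)) * G (?e t) =
      (1 / of_real pi) * (G (?e t) / (1 - z * cnj (?e t))\<^sup>2) - (of_real s / (2 * of_real pi)) * (G (?e t) / (1 - z * cnj (?e t)))"
      by (simp add: left_diff_distrib)
  qed
  also have "\<dots> = (1 / of_real pi) * (G w + w * deriv G w) - (of_real s / (2 * of_real pi)) * G w"
    by (subst Bochner_Integration.integral_diff)
       (simp_all only: integrable_mult_right[OF C(1)] integrable_mult_right[OF C(3)] integral_mult_right_zero C(2,4))
  moreover have "(1 / p) * A - (t / (2 * p)) * B = (2 * A - t * B) / (2 * p)" if "p \<noteq> 0" for A B t p :: complex
    using that by (simp add: field_simps)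
  ultimately show ?thesis by simp
qed

text \<open>The constant is 1 because |1 - x| \<le> 2 and s \<le> 2 bound the numerator by 6, which
  is less than 2 pi.\<close>

lemma disc_kernel_norm_le:
  assumes "cmod x < 1" "0 \<le> s" "s \<le> 2"
  shows "cmod (disc_kernel s x) \<le> 1 / (cmod (1 - x))\<^sup>2"
proof -
  have "cmod (2 - of_real s * (1 - x)) \<le> 2 + s * 2"
    using assms norm_triangle_ineq4[of 2 "of_real s * (1 - x)"] norm_triangle_ineq4[of 1 x]
      mult_left_mono[of "cmod (1 - x)" 2 s] by (simp add: norm_mult)
  also have "\<dots> \<le> 2 * pi" using assms pi_gt3 by linarith
  finally have "cmod (2 - of_real s * (1 - x)) / (2 * pi) / cmod (1 - x)^2 \<le> 1 / cmod (1 - x)^2"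
    by (intro divide_right_mono) auto
  then show ?thesis
    by (simp add: disc_kernel_def norm_divide norm_mult norm_power)
qed

lemma borel_measurable_cnj [measurable]: "cnj \<in> borel_measurable borel"
  by (intro borel_measurable_continuous_onI continuous_intros)

lemma disc_kernel_measurable [measurable]: "disc_kernel s \<in> borel_measurable borel"
  unfolding disc_kernel_def by measurable

lemma disc_kernel_cnj_bound:
  assumes "cmod z < 1" "cmod w < 1" "0 \<le> s" "s \<le> 2"
  shows "cmod (disc_kernel s (z * cnj w)) \<le> 1 / (1 - cmod z)\<^sup>2"
proof -
  have x: "cmod (z * cnj w) \<le> cmod z"
    using assms mult_left_mono[of "cmod w" 1 "cmod z"] by (simp add: norm_mult)
  have "cmod (disc_kernel s (z * cnj w)) \<le> 1 / (cmod (1 - z * cnj w))\<^sup>2"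
    using x assms by (intro disc_kernel_norm_le) auto
  also have "\<dots> \<le> 1 / (1 - cmod z)\<^sup>2"
    using x assms norm_triangle_ineq2[of 1 "z * cnj w"] by (intro frac_le power_mono) auto
  finally show ?thesis .
qed

lemma integrable_disc_kernel:
  assumes G: "integrable (disc_measure s) G" and z: "cmod z < 1" and t: "0 \<le> t" "t \<le> 2"
  shows "integrable (disc_measure s) (\<lambda>w. disc_kernel t (z * cnj w) * G w)"
proof (rule Bochner_Integration.integrable_bound)
  show "integrable (disc_measure s) (\<lambda>w. (1 / (1 - cmod z)\<^sup>2) *\<^sub>R norm (G w))"
    using G by auto
  show "(\<lambda>w. disc_kernel t (z * cnj w) * G w) \<in> borel_measurable (disc_measure s)"
    using borel_measurable_integrable[OF G, measurable] by measurable
  show "AE w in disc_measure s. norm (disc_kernel t (z * cnj w) * G w) \<le> norm ((1 / (1 - cmod z)\<^sup>2) *\<^sub>R norm (G w))"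
    using AE_disc_measure
  proof (rule eventually_mono)
    fix w :: complex assume "w \<noteq> 0 \<and> cmod w < 1"
    then show "norm (disc_kernel t (z * cnj w) * G w) \<le> norm ((1 / (1 - cmod z)\<^sup>2) *\<^sub>R norm (G w))"
      using mult_right_mono[OF disc_kernel_cnj_bound[of z w t], of "norm (G w)"] z t by (simp add: norm_mult)
  qed
qed

text \<open>The angular integrals are Cauchy integrals; the radial integrand that remains is the derivative of \<open>r powr (2 - s) * G (z * r\<^sup>2)\<close>.\<close>
lemma disc_reproducing:
  assumes G: "G holomorphic_on ball 0 1" and int: "integrable (disc_measure s) G"
    and s: "0 \<le> s" "s < 2" and z: "cmod z < 1"
  shows "(\<integral>w. disc_kernel s (z * cnj w) * G w \<partial>disc_measure s) = G z"
proof -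
  define W where "W r = z * of_real (r\<^sup>2)" for r :: real
  define I where "I r = (2 * (G (W r) + W r * deriv G (W r)) - of_real s * G (W r)) / (2 * of_real pi)" for r
  define h where "h r = of_real (r powr (1 - s)) * (2 * (G (W r) + W r * deriv G (W r)) - of_real s * G (W r))" for r
  define J where "J r = (\<integral>t. disc_kernel s (z * cnj (rcis r (2 * pi * t))) * G (rcis r (2 * pi * t)) \<partial>circle_measure)" for r
  note P = integrable_disc_polar[OF integrable_disc_kernel[where t = s, OF int z s(1) less_imp_le[OF s(2)]], folded J_def]
  have JI: "J r = I r" if "0 < r" "r < 1" for r
    using circle_integral_disc_kernel[OF G that z] by (simp add: J_def I_def W_def)
  have Jm [measurable]: "J \<in> borel_measurable borel"
    using P(1) s by (auto dest: borel_measurable_integrable)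
  have eq: "(indicator {0<..<1} r * (2 * pi * r powr (1 - s))) *\<^sub>R J r = indicator {0<..<1} r *\<^sub>R h r" for r
    using JI[of r] by (auto simp: indicator_def h_def I_def scaleR_conv_of_real)
  have "set_integrable lborel {0<..<1} h"
    using P(1) s unfolding radial_measure_def set_integrable_def
    by (subst (asm) integrable_density) (auto simp: eq)
  moreover have "(\<integral>w. disc_kernel s (z * cnj w) * G w \<partial>disc_measure s) = set_lebesgue_integral lborel {0<..<1} h"
    using P(2) s unfolding radial_measure_def set_lebesgue_integral_def
    by (subst (asm) integral_density) (auto simp: eq)
  ultimately have "(\<integral>w. disc_kernel s (z * cnj w) * G w \<partial>disc_measure s) = integral {0<..<1} h"
    by (simp add: set_borel_integral_eq_integral)
  \<comment> \<open>The fundamental theorem is used with derivatives in the interior only, since r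
    powr (2 - s) need not be differentiable at 0. As s < 2 it is continuous there and the lower
    boundary term vanishes; the upper one is G z because W 1 = z.\<close>
  also have "(h has_integral (of_real (1 powr (2 - s)) * G (W 1) - of_real (0 powr (2 - s)) * G (W 0))) {0..1}"
  proof (rule fundamental_theorem_of_calculus_interior)
    have Wb: "W r \<in> ball 0 1" if "0 \<le> r" "r \<le> 1" for r
      using that z mult_mono[of "cmod z" "cmod z" "r\<^sup>2" 1] by (auto simp: W_def norm_mult norm_power power_le_one)
    have "continuous_on {0..1} (\<lambda>r. G (W r))"
      using Wb unfolding W_def
      by (intro continuous_on_compose2[OF holomorphic_on_imp_continuous_on[OF G]] continuous_intros) auto
    then show "continuous_on {0..1} (\<lambda>r. of_real (r powr (2 - s)) * G (W r))"
      using s by (intro continuous_on_mult continuous_on_of_real continuous_on_powr' continuous_on_id continuous_on_const) auto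
    fix r :: real assume r: "r \<in> {0<..<1}"
    have "G field_differentiable at (W r)"
      using holomorphic_on_imp_differentiable_at[OF G _ Wb[of r]] r by auto
    then have "(G has_field_derivative deriv G (W r)) (at (W r))"
      by (simp add: DERIV_deriv_iff_field_differentiable)
    moreover have "((\<lambda>r. z * complex_of_real (r\<^sup>2)) has_vector_derivative (z * of_real (2 * r))) (at r)"
      by (intro has_vector_derivative_mult_right has_vector_derivative_of_real)
         (auto intro!: derivative_eq_intros simp flip: has_real_derivative_iff_has_vector_derivative)
    then have "(W has_vector_derivative (2 * of_real r * z)) (at r)"
      unfolding W_def by (simp add: mult_ac)
    ultimately have "((\<lambda>r. G (W r)) has_vector_derivative (2 * of_real r * z * deriv G (W r))) (at r)"
      using field_vector_diff_chain_at[of W _ r G] by (simp add: o_def)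
    moreover have "((\<lambda>r. complex_of_real (r powr (2 - s))) has_vector_derivative of_real ((2 - s) * r powr (1 - s))) (at r)"
      using r by (intro has_vector_derivative_of_real)
        (auto intro!: derivative_eq_intros simp flip: has_real_derivative_iff_has_vector_derivative)
    ultimately have "((\<lambda>r. of_real (r powr (2 - s)) * G (W r)) has_vector_derivative
       (of_real (r powr (2 - s)) * (2 * of_real r * z * deriv G (W r)) + of_real ((2 - s) * r powr (1 - s)) * G (W r))) (at r)"
      by (rule has_vector_derivative_mult[rotated])
    moreover have "r powr (2 - s) = r * r powr (1 - s)"
      using powr_add[of r 1 "1 - s"] r by simp
    then have "of_real (r powr (2 - s)) * (2 * of_real r * z * deriv G (W r)) + of_real ((2 - s) * r powr (1 - s)) * G (W r) = h r"
      by (simp add: h_def W_def algebra_simps power2_eq_square)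
    ultimately show "((\<lambda>r. of_real (r powr (2 - s)) * G (W r)) has_vector_derivative h r) (at r)" by simp
  qed simp
  then have "integral {0<..<1} h = G z"
    using s by (intro integral_unique) (simp add: W_def has_integral_Icc_iff_Ioo)
  finally show ?thesis .
qed

section \<open>Estimates for Schur's test\<close>

lemma ennreal_lincomb:
  "0 \<le> a \<Longrightarrow> 0 \<le> b \<Longrightarrow> 0 \<le> c \<Longrightarrow> 0 \<le> d \<Longrightarrow>
    ennreal (c * a + d * b) = ennreal c * ennreal a + ennreal d * ennreal b"
  by (simp add: ennreal_mult)

text \<open>With G u = 1 / (1 - cnj z u), which is holomorphic on the disc, the integrand is G u /
  (1 - z cnj u), and Cauchy's formula evaluates the mean as G (z r^2).\<close>

lemma circle_integral_poisson:
  assumes r: "0 < r" "r < 1" and z: "cmod z < 1"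
  shows "(\<integral>\<^sup>+t. ennreal (1 / (cmod (1 - z * cnj (rcis r (2 * pi * t))))\<^sup>2) \<partial>circle_measure) =
    ennreal (1 / (1 - (cmod z)\<^sup>2 * r\<^sup>2))"
proof -
  define G where "G u = 1 / (1 - cnj z * u)" for u
  have nz: "1 - cnj z * u \<noteq> 0" if "cmod u < 1" for u
    using one_minus_cnj_nonzero[of "cnj z" "cnj u"] z that by simp
  have G: "G holomorphic_on ball 0 1"
    unfolding G_def using nz by (auto intro!: holomorphic_intros)
  define e where "e t = rcis r (2 * pi * t)" for t
  have eq: "G (e t) / (1 - z * cnj (e t)) = of_real (1 / (cmod (1 - z * cnj (e t)))\<^sup>2)" for t
  proof -
    have "(1 - cnj z * e t) * (1 - z * cnj (e t)) = of_real ((cmod (1 - z * cnj (e t)))\<^sup>2)"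
      by (subst complex_norm_square) simp
    then show ?thesis by (simp add: G_def)
  qed
  note C = circle_integral_cauchy(1,2)[OF G r z, folded e_def, unfolded eq]
  have int: "integrable circle_measure (\<lambda>t. 1 / (cmod (1 - z * cnj (e t)))\<^sup>2)"
    using integrable_Re[OF C(1)] by simp
  have "of_real (\<integral>t. 1 / (cmod (1 - z * cnj (e t)))\<^sup>2 \<partial>circle_measure) = G (z * of_real (r\<^sup>2))"
    using C(2) by (simp only: integral_complex_of_real)
  also have "\<dots> = of_real (1 / (1 - (cmod z)\<^sup>2 * r\<^sup>2))"
    unfolding G_def of_real_divide of_real_diff of_real_mult complex_norm_square by (simp add: mult_ac)
  finally have "(\<integral>t. 1 / (cmod (1 - z * cnj (e t)))\<^sup>2 \<partial>circle_measure) = 1 / (1 - (cmod z)\<^sup>2 * r\<^sup>2)"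
    by (simp only: of_real_eq_iff)
  then show ?thesis
    using nn_integral_eq_integral[OF int] by (simp add: e_def)
qed

text \<open>Split at u = c. Below c the integrand is u^(-\<alpha>) / c, integrable at 0 since
  \<alpha> < 1; above c it is u^(-\<alpha> - 1), integrable at infinity since \<alpha> > 0. Both
  parts are multiples of c^(-\<alpha>).\<close>

lemma nn_integral_powr_max:
  fixes c \<alpha> :: real
  assumes \<alpha>: "0 < \<alpha>" "\<alpha> < 1" and c: "0 < c"
  shows "(\<integral>\<^sup>+u. ennreal (indicator {0<..<1} u * (u powr (-\<alpha>) / max c u)) \<partial>lborel)
    \<le> ennreal ((1 / (1 - \<alpha>) + 1 / \<alpha>) * c powr (-\<alpha>))"
proof -
  have "(\<integral>\<^sup>+u. ennreal (indicator {0<..<1} u * (u powr (-\<alpha>) / max c u)) \<partial>lborel) \<le>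
    (\<integral>\<^sup>+u. ennreal (1 / c) * ennreal (indicator {0..c} u * u powr (-\<alpha>)) + ennreal (indicator {c..} u * u powr (-\<alpha> - 1)) \<partial>lborel)"
  proof (rule nn_integral_mono)
    fix u :: real
    have "indicator {0<..<1} u * (u powr (-\<alpha>) / max c u) \<le>
       1 / c * (indicator {0..c} u * u powr (-\<alpha>)) + 1 * (indicator {c..} u * u powr (-\<alpha> - 1))"
      using c by (auto simp: indicator_def max_def powr_diff)
    from ennreal_leI[OF this] show "ennreal (indicator {0<..<1} u * (u powr (-\<alpha>) / max c u)) \<le>
      ennreal (1 / c) * ennreal (indicator {0..c} u * u powr (-\<alpha>)) + ennreal (indicator {c..} u * u powr (-\<alpha> - 1))"
      using c by (subst (asm) ennreal_lincomb) (simp_all only: ennreal_1 mult_1, auto)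
  qed
  also have "\<dots> = ennreal (1 / c) * (\<integral>\<^sup>+u. ennreal (indicator {0..c} u * u powr (-\<alpha>)) \<partial>lborel) +
      (\<integral>\<^sup>+u. ennreal (indicator {c..} u * u powr (-\<alpha> - 1)) \<partial>lborel)"
    by (subst nn_integral_add) (auto simp: nn_integral_cmult)
  also have "(\<integral>\<^sup>+u. ennreal (indicator {0..c} u * u powr (-\<alpha>)) \<partial>lborel) = ennreal (c powr (-\<alpha> + 1) / (-\<alpha> + 1))"
    using \<alpha> c by (intro nn_integral_has_integral_lebesgue has_integral_powr_from_0) auto
  also have "(\<integral>\<^sup>+u. ennreal (indicator {c..} u * u powr (-\<alpha> - 1)) \<partial>lborel) = ennreal (- (c powr (-\<alpha> - 1 + 1)) / (-\<alpha> - 1 + 1))"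
    using \<alpha> c by (intro nn_integral_has_integral_lebesgue has_integral_powr_to_inf) auto
  also have "ennreal (1 / c) * ennreal (c powr (-\<alpha> + 1) / (-\<alpha> + 1)) + ennreal (- (c powr (-\<alpha> - 1 + 1)) / (-\<alpha> - 1 + 1)) =
     ennreal ((1 / (1 - \<alpha>) + 1 / \<alpha>) * c powr (-\<alpha>))"
  proof -
    have "c powr (-\<alpha> + 1) = c * c powr (-\<alpha>)" using c powr_add[of c "-\<alpha>" 1] by (simp add: mult.commute)
    then show ?thesis
      using \<alpha> c by (subst ennreal_mult[symmetric], simp, simp, subst ennreal_plus[symmetric]) 
        (auto simp: distrib_right)
  qed
  finally show ?thesis .
qed

text \<open>Two singularities are separated at r = 1/2. To the left of it the factors singular at
  the boundary are at most (4/3) / (3/4) < 2 and only r^e matters; to the right of it r^e \<le>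
  2^|e| and only the boundary matters.\<close>

lemma radial_integrand_bound:
  fixes r e \<alpha> x :: real
  assumes r: "0 < r" "r < 1" and \<alpha>: "0 < \<alpha>" "\<alpha> < 1" and x: "0 \<le> x" "x < 1"
  shows "r powr e * (1 - r\<^sup>2) powr (-\<alpha>) / (1 - x * r\<^sup>2) \<le>
    2 * r powr e + 2 powr \<bar>e\<bar> * ((1 - r) powr (-\<alpha>) / max (1 - x) (1 - r))"
proof (cases "r < 1/2")
  case True
  have r2: "r\<^sup>2 \<le> 1/4" using True r power_mono[of r "1/2" 2] by (simp add: power2_eq_square)
  have x2: "x * r\<^sup>2 \<le> 1/4" using r2 x mult_mono[of x 1 "r\<^sup>2" "1/4"] by simp
  have "(1 - r\<^sup>2) powr (-\<alpha>) \<le> (1 - r\<^sup>2) powr (-1)"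
    using \<alpha> r r2 by (intro powr_mono') auto
  also have "\<dots> \<le> 4/3" using r2 by (simp add: powr_minus field_simps)
  finally have "(1 - r\<^sup>2) powr (-\<alpha>) / (1 - x * r\<^sup>2) \<le> (4/3) / (3/4)"
    using x2 by (intro frac_le) auto
  also have "\<dots> \<le> (2::real)" by simp
  finally have "r powr e * ((1 - r\<^sup>2) powr (-\<alpha>) / (1 - x * r\<^sup>2)) \<le> r powr e * 2"
    by (intro mult_left_mono) auto
  moreover have "0 \<le> 2 powr \<bar>e\<bar> * ((1 - r) powr (-\<alpha>) / max (1 - x) (1 - r))"
    using x r by (auto simp: max_def)
  ultimately show ?thesis by simp
next
  case False
  have "r powr e \<le> (1/2) powr (-\<bar>e\<bar>)"
  proof -
    have "r powr e \<le> r powr (-\<bar>e\<bar>)" using r by (intro powr_mono') auto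
    also have "\<dots> \<le> (1/2) powr (-\<bar>e\<bar>)" using False by (intro powr_mono2') auto
    finally show ?thesis .
  qed
  then have re: "r powr e \<le> 2 powr \<bar>e\<bar>" by (simp add: powr_minus powr_divide)
  have rr: "r\<^sup>2 \<le> r" using r by (simp add: power2_eq_square)
  have "(1 - r\<^sup>2) powr (-\<alpha>) \<le> (1 - r) powr (-\<alpha>)"
    using rr r \<alpha> by (intro powr_mono2') auto
  moreover have "x * r\<^sup>2 \<le> x" "x * r\<^sup>2 \<le> r"
    using mult_mono[of x x "r\<^sup>2" 1] mult_mono[of x 1 "r\<^sup>2" r] x r rr by auto
  ultimately have "(1 - r\<^sup>2) powr (-\<alpha>) / (1 - x * r\<^sup>2) \<le> (1 - r) powr (-\<alpha>) / max (1 - x) (1 - r)"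
    using x r by (intro frac_le) (auto simp: max_def)
  moreover have "0 \<le> 1 - x * r\<^sup>2" using \<open>x * r\<^sup>2 \<le> r\<close> r by simp
  ultimately have "r powr e * ((1 - r\<^sup>2) powr (-\<alpha>) / (1 - x * r\<^sup>2)) \<le> 2 powr \<bar>e\<bar> * ((1 - r) powr (-\<alpha>) / max (1 - x) (1 - r))"
    using re by (intro mult_mono) auto
  then show ?thesis using r by (simp add: add_increasing)
qed

text \<open>The Forelli-Rudin estimate: the power (1 - |w|^2)^(-\<alpha>) is reproduced up to a
  constant. The angular integral is explicit by \<open>circle_integral_poisson\<close>; the
  substitution u = 1 - r reduces the radial one to \<open>nn_integral_powr_max\<close> with c = 1 -
  |z|^2. The condition on \<gamma> is integrability at the origin.\<close>

lemma forelli_rudin: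
  assumes \<alpha>: "0 < \<alpha>" "\<alpha> < 1" and \<gamma>: "a < \<gamma> + 2"
  obtains C where "0 < C" and "\<And>z. cmod z < 1 \<Longrightarrow>
    (\<integral>\<^sup>+w. ennreal ((1 - (cmod w)\<^sup>2) powr (-\<alpha>) * cmod w powr \<gamma> / (cmod (1 - z * cnj w))\<^sup>2) \<partial>disc_measure a)
    \<le> ennreal (C * (1 - (cmod z)\<^sup>2) powr (-\<alpha>))"
proof -
  define e where "e = 1 - a + \<gamma>"
  \<comment> \<open>The summand 2 / (e + 1) comes from the singularity at the origin, the other one
    from the boundary of the disc; 2 pi is the factor of the radial density.\<close>
  define C where "C = 2 * pi * (2 / (e + 1) + 2 powr \<bar>e\<bar> * (1 / (1 - \<alpha>) + 1 / \<alpha>))"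
  have e: "e > -1" using \<gamma> by (simp add: e_def)
  have C: "0 < C" unfolding C_def using e \<alpha> by (intro mult_pos_pos add_pos_pos) auto
  moreover have "(\<integral>\<^sup>+w. ennreal ((1 - (cmod w)\<^sup>2) powr (-\<alpha>) * cmod w powr \<gamma> / (cmod (1 - z * cnj w))\<^sup>2) \<partial>disc_measure a)
    \<le> ennreal (C * (1 - (cmod z)\<^sup>2) powr (-\<alpha>))" if z: "cmod z < 1" for z
  proof -
    define x where "x = (cmod z)\<^sup>2"
    have x: "0 \<le> x" "x < 1" using z by (auto simp: x_def power_less_one_iff)
    have "(\<integral>\<^sup>+w. ennreal ((1 - (cmod w)\<^sup>2) powr (-\<alpha>) * cmod w powr \<gamma> / (cmod (1 - z * cnj w))\<^sup>2) \<partial>disc_measure a) =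
       (\<integral>\<^sup>+r. \<integral>\<^sup>+t. ennreal ((1 - (cmod (rcis r (2 * pi * t)))\<^sup>2) powr (-\<alpha>) * cmod (rcis r (2 * pi * t)) powr \<gamma> / (cmod (1 - z * cnj (rcis r (2 * pi * t))))\<^sup>2) \<partial>circle_measure \<partial>radial_measure a)"
      by (rule nn_integral_disc_polar) measurable
    also have "\<dots> = (\<integral>\<^sup>+r. ennreal ((1 - r\<^sup>2) powr (-\<alpha>) * r powr \<gamma> / (1 - x * r\<^sup>2)) \<partial>radial_measure a)"
    proof (rule nn_integral_cong_AE, use AE_radial_measure in eventually_elim)
      case (elim r)
      have "(\<integral>\<^sup>+t. ennreal ((1 - (cmod (rcis r (2 * pi * t)))\<^sup>2) powr (-\<alpha>) * cmod (rcis r (2 * pi * t)) powr \<gamma> / (cmod (1 - z * cnj (rcis r (2 * pi * t))))\<^sup>2) \<partial>circle_measure) =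
         (\<integral>\<^sup>+t. ennreal ((1 - r\<^sup>2) powr (-\<alpha>) * r powr \<gamma>) * ennreal (1 / (cmod (1 - z * cnj (rcis r (2 * pi * t))))\<^sup>2) \<partial>circle_measure)"
        using elim by (intro nn_integral_cong) (simp flip: ennreal_mult)
      also have "\<dots> = ennreal ((1 - r\<^sup>2) powr (-\<alpha>) * r powr \<gamma>) * ennreal (1 / (1 - x * r\<^sup>2))"
        using elim z by (subst nn_integral_cmult, measurable, subst circle_integral_poisson) (auto simp: x_def)
      also have "\<dots> = ennreal ((1 - r\<^sup>2) powr (-\<alpha>) * r powr \<gamma> / (1 - x * r\<^sup>2))"
        by (simp add: ennreal_mult'[symmetric])
      finally show ?case .
    qed
    also have "\<dots> = (\<integral>\<^sup>+r. ennreal (indicator {0<..<1} r * (2 * pi * r powr (1 - a))) * ennreal ((1 - r\<^sup>2) powr (-\<alpha>) * r powr \<gamma> / (1 - x * r\<^sup>2)) \<partial>lborel)"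
      unfolding radial_measure_def by (rule nn_integral_density) measurable
    also have "\<dots> \<le> (\<integral>\<^sup>+r. ennreal (2 * pi) * (ennreal 2 * ennreal (indicator {0..1} r * r powr e) +
         ennreal (2 powr \<bar>e\<bar>) * ennreal (indicator {0<..<1} (1 + (-1) * r) * ((1 + (-1) * r) powr (-\<alpha>) / max (1 - x) (1 + (-1) * r)))) \<partial>lborel)"
    proof (rule nn_integral_mono)
      fix r :: real
      show "ennreal (indicator {0<..<1} r * (2 * pi * r powr (1 - a))) * ennreal ((1 - r\<^sup>2) powr (-\<alpha>) * r powr \<gamma> / (1 - x * r\<^sup>2))
        \<le> ennreal (2 * pi) * (ennreal 2 * ennreal (indicator {0..1} r * r powr e) +
         ennreal (2 powr \<bar>e\<bar>) * ennreal (indicator {0<..<1} (1 + (-1) * r) * ((1 + (-1) * r) powr (-\<alpha>) / max (1 - x) (1 + (-1) * r))))"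
      proof (cases "r \<in> {0<..<1}")
        case True
        have e_eq: "r powr (1 - a) * r powr \<gamma> = r powr e" using True by (simp add: e_def flip: powr_add)
        have "ennreal (indicator {0<..<1} r * (2 * pi * r powr (1 - a))) * ennreal ((1 - r\<^sup>2) powr (-\<alpha>) * r powr \<gamma> / (1 - x * r\<^sup>2)) =
          ennreal (2 * pi * (r powr e * (1 - r\<^sup>2) powr (-\<alpha>) / (1 - x * r\<^sup>2)))"
          unfolding e_eq[symmetric] using True by (simp add: mult_ac flip: ennreal_mult')
        also have "\<dots> \<le> ennreal (2 * pi * (2 * r powr e + 2 powr \<bar>e\<bar> * ((1 - r) powr (-\<alpha>) / max (1 - x) (1 - r))))"
          using True x \<alpha> by (intro ennreal_leI mult_left_mono radial_integrand_bound) auto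
        also have "\<dots> = ennreal (2 * pi) * (ennreal 2 * ennreal (r powr e) + ennreal (2 powr \<bar>e\<bar>) * ennreal ((1 - r) powr (-\<alpha>) / max (1 - x) (1 - r)))"
        proof -
          have "0 \<le> (1 - r) powr (-\<alpha>) / max (1 - x) (1 - r)" using x True by (auto simp: max_def)
          then have "ennreal (2 * r powr e + 2 powr \<bar>e\<bar> * ((1 - r) powr (-\<alpha>) / max (1 - x) (1 - r))) =
              ennreal 2 * ennreal (r powr e) + ennreal (2 powr \<bar>e\<bar>) * ennreal ((1 - r) powr (-\<alpha>) / max (1 - x) (1 - r))"
            by (intro ennreal_lincomb) auto
          then show ?thesis by (simp only: ennreal_mult'[of "2 * pi"] mult_nonneg_nonneg pi_ge_zero zero_le_numeral)
        qed
        finally show ?thesis using True by (simp add: indicator_def)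
      qed (auto simp: indicator_def)
    qed
    also have "\<dots> = ennreal (2 * pi) * (ennreal 2 * (\<integral>\<^sup>+r. ennreal (indicator {0..1} r * r powr e) \<partial>lborel) +
       ennreal (2 powr \<bar>e\<bar>) * (\<integral>\<^sup>+r. ennreal (indicator {0<..<1} (1 + (-1) * r) * ((1 + (-1) * r) powr (-\<alpha>) / max (1 - x) (1 + (-1) * r))) \<partial>lborel))"
      by (subst nn_integral_cmult, measurable, subst nn_integral_add, measurable,
          subst nn_integral_cmult, measurable, subst nn_integral_cmult, measurable)
    also have "(\<integral>\<^sup>+r. ennreal (indicator {0..1} r * r powr e) \<partial>lborel) = ennreal (1 powr (e + 1) / (e + 1))"
      using e by (intro nn_integral_has_integral_lebesgue has_integral_powr_from_0) auto
    also have "(\<integral>\<^sup>+r. ennreal (indicator {0<..<1} (1 + (-1) * r) * ((1 + (-1) * r) powr (-\<alpha>) / max (1 - x) (1 + (-1) * r))) \<partial>lborel) =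
       (\<integral>\<^sup>+u. ennreal (indicator {0<..<1} u * (u powr (-\<alpha>) / max (1 - x) u)) \<partial>lborel)"
      by (subst (2) nn_integral_real_affine[of _ "-1" 1]) auto
    also have "ennreal (2 * pi) * (ennreal 2 * ennreal (1 powr (e + 1) / (e + 1)) + ennreal (2 powr \<bar>e\<bar>) * \<dots>) \<le>
       ennreal (2 * pi) * (ennreal 2 * ennreal (1 / (e + 1) * (1 - x) powr (-\<alpha>)) + ennreal (2 powr \<bar>e\<bar>) * ennreal ((1 / (1 - \<alpha>) + 1 / \<alpha>) * (1 - x) powr (-\<alpha>)))"
    proof -
      \<comment> \<open>The contribution of the origin does not depend on z; it is absorbed because
        the target power is at least 1.\<close>
      have "1 \<le> (1 - x) powr (-\<alpha>)"
        using powr_mono2'[of "-\<alpha>" "1 - x" 1] \<alpha> x by simp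
      then have "1 powr (e + 1) / (e + 1) \<le> 1 / (e + 1) * (1 - x) powr (-\<alpha>)"
        using e by (simp add: divide_right_mono)
      then show ?thesis
        using x \<alpha> by (intro mult_left_mono add_mono ennreal_leI nn_integral_powr_max) auto
    qed
    also have "\<dots> = ennreal (C * (1 - x) powr (-\<alpha>))"
    proof -
      have "ennreal (2 * pi) * (ennreal 2 * ennreal (b * y) + ennreal d * ennreal (c * y)) = ennreal (2 * pi * (2 * b + d * c) * y)"
        if "0 \<le> b" "0 \<le> c" "0 \<le> d" "0 \<le> y" for b c d y
      proof -
        have "ennreal 2 * ennreal (b * y) + ennreal d * ennreal (c * y) = ennreal (2 * (b * y) + d * (c * y))"
          using that by (intro ennreal_lincomb[symmetric]) auto
        then have "ennreal (2 * pi) * (ennreal 2 * ennreal (b * y) + ennreal d * ennreal (c * y)) =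
            ennreal (2 * pi * (2 * (b * y) + d * (c * y)))"
          by (simp only: ennreal_mult'[of "2 * pi"] mult_nonneg_nonneg pi_ge_zero zero_le_numeral)
        also have "2 * pi * (2 * (b * y) + d * (c * y)) = 2 * pi * (2 * b + d * c) * y"
          by (simp add: algebra_simps)
        finally show ?thesis .
      qed
      from this[of "1 / (e + 1)" "1 / (1 - \<alpha>) + 1 / \<alpha>" "2 powr \<bar>e\<bar>" "(1 - x) powr (-\<alpha>)"]
      show ?thesis using e \<alpha> by (simp add: C_def)
    qed
    finally show ?thesis by (simp only: x_def)
  qed
  ultimately show ?thesis by (rule that)
qed

section \<open>Schur's test\<close>

text \<open>Minimizing Young's inequality over the scaling parameter l gives Hoelder's inequality t
  \<le> X^(1/p) Y^(1/q). The p-th power is as stated because p / q = p - 1.\<close>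

lemma powr_le_from_young:
  fixes t X Y p q :: real
  assumes p: "p > 1" "q > 1" "1/p + 1/q = 1" and t: "0 \<le> t" and X: "0 \<le> X" and Y: "0 < Y"
    and le: "\<And>l. 0 < l \<Longrightarrow> t \<le> l powr p * X / p + l powr (-q) * Y / q"
  shows "t powr p \<le> X * Y powr (p - 1)"
proof (cases "X = 0")
  case True
  have "t = 0"
  proof (rule ccontr)
    assume "t \<noteq> 0"
    with t have tp: "t > 0" by simp
    \<comment> \<open>This l makes the second term equal to t / 2, while the first term is 0; so t
      \<le> t / 2, which is impossible for t > 0.\<close>
    define l where "l = (t * q / (2 * Y)) powr (-1/q)"
    have "l powr (-q) = t * q / (2 * Y)" "l > 0"
      unfolding l_def using tp Y p by (auto simp: powr_powr)
    with le[of l] True Y p tp show False by (simp add: field_simps)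
  qed
  with True p show ?thesis by simp
next
  case False
  with X have Xp: "X > 0" by simp
  \<comment> \<open>The minimizing l balances the two terms: l^(p + q) = Y / X, and p + q = p q for
    conjugate exponents.\<close>
  define l where "l = (Y / X) powr (1 / (p * q))"
  have l: "l > 0" unfolding l_def using Xp Y by simp
  have "l powr p = (Y / X) powr (1 / q)" "l powr (-q) = (Y / X) powr (- 1 / p)"
    unfolding l_def using p by (simp_all add: powr_powr)
  then have lp: "l powr p = Y powr (1/q) / X powr (1/q)" and lq: "l powr (-q) = X powr (1/p) / Y powr (1/p)"
    using Xp Y by (simp_all add: powr_divide powr_minus)
  have "1/p = 1 - 1/q" using p by simp
  then have "X powr (1/p) = X / X powr (1/q)" using Xp by (simp only: powr_diff powr_one)
  moreover have "1/q = 1 - 1/p" using p by simp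
  then have "Y powr (1/q) = Y / Y powr (1/p)" using Y by (simp only: powr_diff powr_one)
  ultimately have "l powr p * X = X powr (1/p) * Y powr (1/q)" "l powr (-q) * Y = X powr (1/p) * Y powr (1/q)"
    unfolding lp lq by (simp_all add: mult.commute)
  with le[OF l] have "t \<le> X powr (1/p) * Y powr (1/q) * (1/p + 1/q)"
    by (simp add: algebra_simps)
  then have "t \<le> X powr (1/p) * Y powr (1/q)" using p by simp
  then have "t powr p \<le> (X powr (1/p) * Y powr (1/q)) powr p"
    using t p by (intro powr_mono2) auto
  also have "\<dots> = X * Y powr (p / q)"
    using Xp Y p by (simp add: powr_mult powr_powr)
  also have "p / q = p - 1" using p by (simp add: field_simps)
  finally show ?thesis .
qed

text \<open>Write f = (f / \<phi>) \<phi> and apply Hoelder's inequality for the measure Q x y dy.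
  The factor with \<phi> is controlled by \<open>q_bound\<close>, at the cost of A^(p - 1); after
  Tonelli the other one is controlled by \<open>p_bound\<close>, at the cost of A. \<open>T\<close>
  is any function dominated by the integral, so the test applies to absolute values of oscillating
  operators.\<close>

lemma schur_test:
  fixes Q :: "'a \<Rightarrow> 'a \<Rightarrow> real" and \<phi> f T :: "'a \<Rightarrow> real"
  assumes M: "sigma_finite_measure M"
    and [measurable]: "case_prod Q \<in> borel_measurable (M \<Otimes>\<^sub>M M)"
      "\<phi> \<in> borel_measurable M" "f \<in> borel_measurable M"
    and Q: "\<And>x y. 0 \<le> Q x y" and f: "\<And>x. 0 \<le> f x" and \<phi>: "AE x in M. 0 < \<phi> x"
    and p: "p > 1" "q > 1" "1/p + 1/q = 1" and A: "0 < A"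
    and q_bound: "AE x in M. (\<integral>\<^sup>+y. ennreal (Q x y * \<phi> y powr q) \<partial>M) \<le> ennreal (A * \<phi> x powr q)"
    and p_bound: "AE y in M. (\<integral>\<^sup>+x. ennreal (Q x y * \<phi> x powr p) \<partial>M) \<le> ennreal (A * \<phi> y powr p)"
    and T: "AE x in M. 0 \<le> T x \<and> ennreal (T x) \<le> (\<integral>\<^sup>+y. ennreal (Q x y * f y) \<partial>M)"
  shows "(\<integral>\<^sup>+x. ennreal (T x powr p) \<partial>M) \<le> ennreal (A powr p) * (\<integral>\<^sup>+x. ennreal (f x powr p) \<partial>M)"
proof -
  interpret sigma_finite_measure M by fact
  interpret pair_sigma_finite M M ..
  define X where "X x = (\<integral>\<^sup>+y. ennreal (Q x y * (f y / \<phi> y) powr p) \<partial>M)" for x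
  have [measurable]: "X \<in> borel_measurable M" unfolding X_def by measurable
  \<comment> \<open>The pointwise Hoelder estimate: the factor Y^(p - 1) with Y = A \<phi>^q becomes
    A^(p - 1) \<phi>^p since q (p - 1) = p. Where X is infinite, so is the right-hand side, because
    A and \<phi> are positive.\<close>
  have "AE x in M. ennreal (T x powr p) \<le> ennreal (A powr (p - 1)) * (ennreal (\<phi> x powr p) * X x)"
    using q_bound T \<phi> AE_space
  proof eventually_elim
    case (elim x)
    then have Tx: "0 \<le> T x" "ennreal (T x) \<le> (\<integral>\<^sup>+y. ennreal (Q x y * f y) \<partial>M)" and ph: "0 < \<phi> x" by auto
    have [measurable]: "Q x \<in> borel_measurable M"
      using measurable_Pair2[of "case_prod Q" M M borel x] elim by simp
    show ?case
    proof (cases "X x")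
      case top
      then show ?thesis using A ph by (simp add: ennreal_mult_top)
    next
      case (real X')
      define Y where "Y = A * \<phi> x powr q"
      have Y: "Y > 0" using A ph by (simp add: Y_def)
      have "T x \<le> l powr p * X' / p + l powr (-q) * Y / q" if l: "0 < l" for l
      proof -
        have "ennreal (T x) \<le> (\<integral>\<^sup>+y. ennreal (Q x y * f y) \<partial>M)" by (rule Tx)
        also have "\<dots> \<le> (\<integral>\<^sup>+y. ennreal (l powr p / p) * ennreal (Q x y * (f y / \<phi> y) powr p) +
             ennreal (l powr (-q) / q) * ennreal (Q x y * \<phi> y powr q) \<partial>M)"
        proof (rule nn_integral_mono_AE, use \<phi> in eventually_elim)
          case (elim y)
          have "f y = (l * (f y / \<phi> y)) * (\<phi> y / l)" using elim l by simp
          also have "\<dots> \<le> (l * (f y / \<phi> y)) powr p / p + (\<phi> y / l) powr q / q"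
            using elim l f[of y] p by (intro Youngs_inequality) auto
          also have "\<dots> = l powr p / p * (f y / \<phi> y) powr p + l powr (-q) / q * \<phi> y powr q"
            using elim l f[of y] by (simp add: powr_mult powr_divide powr_minus field_simps)
          finally have "Q x y * f y \<le> Q x y * (l powr p / p * (f y / \<phi> y) powr p + l powr (-q) / q * \<phi> y powr q)"
            using Q by (intro mult_left_mono) auto
          then have "ennreal (Q x y * f y) \<le> ennreal (l powr p / p * (Q x y * (f y / \<phi> y) powr p) +
              l powr (-q) / q * (Q x y * \<phi> y powr q))"
            by (intro ennreal_leI) (simp add: algebra_simps)
          then show ?case
            by (subst (asm) ennreal_lincomb) (use Q p in auto)
        qed
        also have "\<dots> = ennreal (l powr p / p) * X x + ennreal (l powr (-q) / q) * (\<integral>\<^sup>+y. ennreal (Q x y * \<phi> y powr q) \<partial>M)"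
          unfolding X_def by (subst nn_integral_add, measurable, subst nn_integral_cmult, measurable, subst nn_integral_cmult, measurable)
        also have "\<dots> \<le> ennreal (l powr p / p) * ennreal X' + ennreal (l powr (-q) / q) * ennreal Y"
          using elim real by (intro add_mono mult_left_mono) (auto simp: Y_def)
        also have "\<dots> = ennreal (l powr p * X' / p + l powr (-q) * Y / q)"
          using real Y p by (simp add: ennreal_plus ennreal_mult'[symmetric])
        finally show ?thesis
          using real Y p by (subst (asm) ennreal_le_iff) auto
      qed
      then have "T x powr p \<le> X' * Y powr (p - 1)"
        using p Tx real Y by (intro powr_le_from_young) auto
      moreover have "q * (p - 1) = p" using p by (simp add: field_simps)
      then have "Y powr (p - 1) = A powr (p - 1) * \<phi> x powr p"
        unfolding Y_def using A ph by (simp add: powr_mult powr_powr)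
      ultimately show ?thesis
        using real by (simp add: ennreal_mult[symmetric] ennreal_leI mult_ac)
    qed
  qed
  then have "(\<integral>\<^sup>+x. ennreal (T x powr p) \<partial>M) \<le> (\<integral>\<^sup>+x. ennreal (A powr (p - 1)) * (ennreal (\<phi> x powr p) * X x) \<partial>M)"
    by (rule nn_integral_mono_AE)
  also have "\<dots> = ennreal (A powr (p - 1)) * (\<integral>\<^sup>+x. \<integral>\<^sup>+y. ennreal (\<phi> x powr p) * ennreal (Q x y * (f y / \<phi> y) powr p) \<partial>M \<partial>M)"
  proof (subst nn_integral_cmult, measurable, rule arg_cong2[where f = "(*)"], rule refl, rule nn_integral_cong)
    fix x assume "x \<in> space M"
    then have [measurable]: "Q x \<in> borel_measurable M"
      using measurable_Pair2[of "case_prod Q" M M borel x] by simp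
    show "ennreal (\<phi> x powr p) * X x = (\<integral>\<^sup>+y. ennreal (\<phi> x powr p) * ennreal (Q x y * (f y / \<phi> y) powr p) \<partial>M)"
      unfolding X_def by (rule nn_integral_cmult[symmetric]) measurable
  qed
  also have "(\<integral>\<^sup>+x. \<integral>\<^sup>+y. ennreal (\<phi> x powr p) * ennreal (Q x y * (f y / \<phi> y) powr p) \<partial>M \<partial>M) =
      (\<integral>\<^sup>+y. \<integral>\<^sup>+x. ennreal (\<phi> x powr p) * ennreal (Q x y * (f y / \<phi> y) powr p) \<partial>M \<partial>M)"
    by (rule Fubini'[symmetric]) measurable
  also have "\<dots> = (\<integral>\<^sup>+y. ennreal ((f y / \<phi> y) powr p) * (\<integral>\<^sup>+x. ennreal (Q x y * \<phi> x powr p) \<partial>M) \<partial>M)"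
  proof (rule nn_integral_cong)
    fix y assume "y \<in> space M"
    then have [measurable]: "(\<lambda>x. Q x y) \<in> borel_measurable M"
      using measurable_Pair1[of "case_prod Q" M M borel y] by simp
    have "ennreal (\<phi> x powr p) * ennreal (Q x y * (f y / \<phi> y) powr p) =
        ennreal ((f y / \<phi> y) powr p) * ennreal (Q x y * \<phi> x powr p)" for x
      using Q by (simp add: mult_ac flip: ennreal_mult)
    then show "(\<integral>\<^sup>+x. ennreal (\<phi> x powr p) * ennreal (Q x y * (f y / \<phi> y) powr p) \<partial>M) =
        ennreal ((f y / \<phi> y) powr p) * (\<integral>\<^sup>+x. ennreal (Q x y * \<phi> x powr p) \<partial>M)"
      by (simp only:) (rule nn_integral_cmult, measurable)
  qed
  also have "\<dots> \<le> (\<integral>\<^sup>+y. ennreal A * ennreal (f y powr p) \<partial>M)"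
  proof (rule nn_integral_mono_AE, use p_bound \<phi> in eventually_elim)
    case (elim y)
    have "ennreal ((f y / \<phi> y) powr p) * (\<integral>\<^sup>+x. ennreal (Q x y * \<phi> x powr p) \<partial>M)
        \<le> ennreal ((f y / \<phi> y) powr p) * ennreal (A * \<phi> y powr p)"
      using elim by (intro mult_left_mono) auto
    also have "\<dots> = ennreal A * ennreal (f y powr p)"
      using elim A f[of y] by (simp add: powr_divide flip: ennreal_mult)
    finally show ?case .
  qed
  also have "\<dots> = ennreal A * (\<integral>\<^sup>+y. ennreal (f y powr p) \<partial>M)"
    by (rule nn_integral_cmult) measurable
  also have "ennreal (A powr (p - 1)) * (ennreal A * (\<integral>\<^sup>+y. ennreal (f y powr p) \<partial>M)) =
      ennreal (A powr (p - 1) * A) * (\<integral>\<^sup>+y. ennreal (f y powr p) \<partial>M)"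
    using A by (simp add: ennreal_mult mult.assoc)
  also have "A powr (p - 1) * A = A powr p"
    using A by (simp add: powr_diff)
  finally show ?thesis by (simp add: mult_left_mono)
qed

section \<open>The Hartogs triangle as a product\<close>

lemma vec2_measurable [measurable (raw)]:
  fixes f g :: "'a \<Rightarrow> complex"
  assumes [measurable]: "f \<in> borel_measurable M" "g \<in> borel_measurable M"
  shows "(\<lambda>x. vector [f x, g x] :: complex ^ 2) \<in> borel_measurable M"
proof -
  have "continuous_on UNIV (\<lambda>p :: complex \<times> complex. \<chi> i. if i = 1 then fst p else snd p :: complex ^ 2)"
    by (rule continuous_on_vec_lambda, case_tac "i = 1") (auto intro!: continuous_intros)
  also have "(\<lambda>p :: complex \<times> complex. \<chi> i. if i = 1 then fst p else snd p :: complex ^ 2) = (\<lambda>p. vector [fst p, snd p])"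
    by (auto simp: fun_eq_iff vec_eq_iff forall_2)
  finally have [measurable]: "(\<lambda>p :: complex \<times> complex. vector [fst p, snd p] :: complex ^ 2) \<in> borel_measurable (borel \<Otimes>\<^sub>M borel)"
    unfolding borel_prod by (rule borel_measurable_continuous_onI)
  have "(\<lambda>x. vector [fst (f x, g x), snd (f x, g x)] :: complex ^ 2) \<in> borel_measurable M"
    by (rule measurable_compose[of "\<lambda>x. (f x, g x)" M "borel \<Otimes>\<^sub>M borel"]) measurable
  then show ?thesis by simp
qed

lemma lborel_vec2:
  "(lborel :: (complex ^ 2) measure) = distr (lborel \<Otimes>\<^sub>M lborel) borel (\<lambda>(x, y). vector [x, y])"
  (is "_ = distr _ _ ?v")
proof (rule lborel_eqI)
  fix l u :: "complex ^ 2"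
  assume *: "\<And>b. b \<in> Basis \<Longrightarrow> l \<bullet> b \<le> u \<bullet> b"
  have le: "\<And>b. b \<in> Basis \<Longrightarrow> l $ i \<bullet> b \<le> u $ i \<bullet> b" for i
    using *[of "axis i _"] by (auto simp: inner_axis axis_in_Basis_iff)
  have vb: "?v -` box l u = box (l $ 1) (u $ 1) \<times> box (l $ 2) (u $ 2)"
    by (auto simp: mem_box_cart box_def Basis_vec_def inner_axis forall_2)
  have B: "(Basis :: (complex ^ 2) set) = (\<lambda>b. axis 1 b) ` Basis \<union> (\<lambda>b. axis 2 b) ` Basis"
    by (auto simp: Basis_vec_def UNIV_2)
  have "(\<Prod>b\<in>Basis. (u - l) \<bullet> b) = (\<Prod>b\<in>Basis. (u $ 1 - l $ 1) \<bullet> b) * (\<Prod>b\<in>Basis. (u $ 2 - l $ 2) \<bullet> b)"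
    unfolding B
    by (subst prod.union_disjoint) (auto simp: prod.reindex inj_on_def axis_eq_axis inner_axis inner_diff_left)
  then show "emeasure (distr (lborel \<Otimes>\<^sub>M lborel) borel ?v) (box l u)
      = ennreal (\<Prod>b\<in>Basis. (u - l) \<bullet> b)"
    using le by (subst emeasure_distr)
      (auto simp: vb lborel.emeasure_pair_measure_Times ennreal_mult prod_nonneg inner_diff_left space_pair_measure)
qed simp

lemma vec_nth_measurable [measurable]: "(\<lambda>z :: complex ^ 'n. z $ i) \<in> borel_measurable borel"
  by (intro borel_measurable_continuous_onI continuous_intros)

text \<open>The second coordinate is outermost because the change of variables rescales the first
  one with the second one fixed.\<close>

lemma nn_integral_vec2:
  assumes [measurable]: "f \<in> borel_measurable borel"
  shows "(\<integral>\<^sup>+z. f z \<partial>(lborel :: (complex ^ 2) measure)) = (\<integral>\<^sup>+y. \<integral>\<^sup>+x. f (vector [x, y]) \<partial>lborel \<partial>lborel)"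
  by (subst lborel_vec2, subst nn_integral_distr)
     (auto simp: split_beta' lborel_pair.nn_integral_snd[symmetric])

lemma open_hartogs_triangle: "open hartogs_triangle"
  unfolding hartogs_triangle_def
  by (intro open_Collect_conj open_Collect_less continuous_intros)

lemma hartogs_triangle_borel [measurable]: "hartogs_triangle \<in> sets borel"
  using open_hartogs_triangle by simp

section \<open>Change of variables to the bidisc\<close>

definition bidisc_measure :: "real \<Rightarrow> (complex \<times> complex) measure"
  where "bidisc_measure s = disc_measure 0 \<Otimes>\<^sub>M disc_measure (s + 2)"

lemma sets_bidisc_measure [simp, measurable_cong]: "sets (bidisc_measure s) = sets (borel \<Otimes>\<^sub>M borel)"
  unfolding bidisc_measure_def by (intro sets_pair_measure_cong) auto

lemma space_bidisc_measure [simp]: "space (bidisc_measure s) = UNIV"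
  by (simp add: bidisc_measure_def space_pair_measure)

lemma sigma_finite_bidisc_measure: "sigma_finite_measure (bidisc_measure s)"
  unfolding bidisc_measure_def by (rule sigma_finite_pair_measure) (rule sigma_finite_disc_measure)+

definition hartogs_map :: "complex \<times> complex \<Rightarrow> complex ^ 2"
  where "hartogs_map v = vector [fst v * snd v, snd v]"

lemma hartogs_map_nth [simp]: "hartogs_map v $ 1 = fst v * snd v" "hartogs_map v $ 2 = snd v"
  by (simp_all add: hartogs_map_def)

lemma hartogs_map_measurable [measurable]: "hartogs_map \<in> borel_measurable (borel \<Otimes>\<^sub>M borel)"
  unfolding hartogs_map_def by measurable

lemma hartogs_map_in: "cmod (fst v) < 1 \<Longrightarrow> snd v \<noteq> 0 \<Longrightarrow> cmod (snd v) < 1 \<Longrightarrow> hartogs_map v \<in> hartogs_triangle"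
  using mult_strict_right_mono[of "cmod (fst v)" 1 "cmod (snd v)"] by (auto simp: hartogs_triangle_def norm_mult)

lemma AE_bidisc_measure:
  "AE v in bidisc_measure s. fst v \<noteq> 0 \<and> cmod (fst v) < 1 \<and> snd v \<noteq> 0 \<and> cmod (snd v) < 1"
  unfolding bidisc_measure_def
proof (rule disc.AE_pair_measure)
  show "AE x in disc_measure 0. AE y in disc_measure (s + 2).
      fst (x, y) \<noteq> 0 \<and> cmod (fst (x, y)) < 1 \<and> snd (x, y) \<noteq> 0 \<and> cmod (snd (x, y)) < 1"
    using AE_disc_measure
  proof eventually_elim
    case (elim x)
    show ?case using AE_disc_measure by eventually_elim (use elim in auto)
  qed
qed measurable

text \<open>Here \<open>s\<close> is the exponent p0. The weight is prescribed on the Hartogs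
  triangle only and is arbitrary elsewhere.\<close>

locale hartogs_weight =
  fixes s :: real and \<mu> :: "complex ^ 2 \<Rightarrow> real"
  assumes s: "1 \<le> s" "s < 2"
    and \<mu>: "z \<in> hartogs_triangle \<Longrightarrow> \<mu> z = cmod (z $ 2) powr (- (s + 4))"
begin

abbreviation W :: "(complex ^ 2) measure"
  where "W \<equiv> weighted_measure hartogs_triangle \<mu>"

lemma space_W: "space W = hartogs_triangle"
  by (simp add: weighted_measure_def)

lemma sets_W: "sets W = sets (lebesgue_on hartogs_triangle)"
  by (simp add: weighted_measure_def)

lemma measurable_W: "f \<in> borel_measurable borel \<Longrightarrow> f \<in> borel_measurable W"
  unfolding measurable_cong_sets[OF sets_W refl]
  by (intro measurable_restrict_space1) (simp add: measurable_completion)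

lemma ident_measurable_W: "(\<lambda>z. z) \<in> measurable W borel"
  unfolding measurable_cong_sets[OF sets_W refl]
  by (intro measurable_restrict_space1 measurable_completion) simp

lemma \<mu>_measurable: "(\<lambda>z. ennreal (\<mu> z)) \<in> borel_measurable (lebesgue_on hartogs_triangle)"
proof -
  have "(\<lambda>z. ennreal (cmod (z $ 2) powr (- (s + 4)))) \<in> borel_measurable (lebesgue_on hartogs_triangle)"
    by (intro measurable_restrict_space1 measurable_completion) measurable
  then show ?thesis
    by (rule measurable_cong[THEN iffD1, rotated]) (simp add: \<mu>)
qed

lemma nn_integral_W_lborel:
  assumes [measurable]: "f \<in> borel_measurable borel"
  shows "(\<integral>\<^sup>+z. f z \<partial>W) = (\<integral>\<^sup>+z. ennreal (cmod (z $ 2) powr (- (s + 4))) * f z * indicator hartogs_triangle z \<partial>lborel)"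
proof -
  have "(\<integral>\<^sup>+z. f z \<partial>W) = (\<integral>\<^sup>+z. ennreal (\<mu> z) * f z \<partial>lebesgue_on hartogs_triangle)"
    unfolding weighted_measure_def
    by (rule nn_integral_density[OF \<mu>_measurable]) (intro measurable_restrict_space1 measurable_completion, measurable)
  also have "\<dots> = (\<integral>\<^sup>+z. ennreal (cmod (z $ 2) powr (- (s + 4))) * f z \<partial>lebesgue_on hartogs_triangle)"
    by (rule nn_integral_cong) (simp add: \<mu>)
  also have "\<dots> = (\<integral>\<^sup>+z. ennreal (cmod (z $ 2) powr (- (s + 4))) * f z * indicator hartogs_triangle z \<partial>lebesgue)"
    by (rule nn_integral_restrict_space) simp
  finally show ?thesis by (simp add: nn_integral_completion)
qed

text \<open>For fixed z2 = y the substitution z1 = y x contributes the Jacobian |y|^2, which changes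
  the exponent s + 4 into s + 2, and it maps the unit disc onto the slice |z1| < |y|.\<close>

lemma nn_integral_W:
  assumes [measurable]: "f \<in> borel_measurable borel"
  shows "(\<integral>\<^sup>+z. f z \<partial>W) = (\<integral>\<^sup>+v. f (hartogs_map v) \<partial>bidisc_measure s)"
proof -
  define g where "g z = ennreal (cmod (z $ 2) powr (- (s + 4))) * f z * indicator hartogs_triangle z" for z :: "complex ^ 2"
  have [measurable]: "g \<in> borel_measurable borel" unfolding g_def by measurable
  have [measurable]: "(ball 0 1 :: complex set) \<in> sets borel" by simp
  have "(\<integral>\<^sup>+z. f z \<partial>W) = (\<integral>\<^sup>+z. g z \<partial>lborel)"
    unfolding nn_integral_W_lborel[OF assms] g_def ..
  also have "\<dots> = (\<integral>\<^sup>+y. \<integral>\<^sup>+x. g (vector [x, y]) \<partial>lborel \<partial>lborel)"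
    by (rule nn_integral_vec2) measurable
  also have "\<dots> = (\<integral>\<^sup>+y. ennreal (indicator (ball 0 1) y * cmod y powr (- (s + 2))) *
      (\<integral>\<^sup>+x. ennreal (indicator (ball 0 1) x * cmod x powr (- 0)) * f (hartogs_map (x, y)) \<partial>lborel) \<partial>lborel)"
  proof (rule nn_integral_cong_AE, use AE_lborel_singleton[of 0] in eventually_elim)
    case (elim y)
    have A: "ennreal ((cmod y)\<^sup>2) * g (vector [y * x, y]) =
        ennreal (indicator (ball 0 1) y * cmod y powr (- (s + 2))) * (indicator (ball 0 1) x * f (hartogs_map (x, y)))" for x
    proof -
      have "(cmod y)\<^sup>2 * cmod y powr (- (s + 4)) = cmod y powr (- (s + 2))"
      proof -
        have "- (s + 2) = 2 + - (s + 4)" by simp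
        then show ?thesis using elim by (simp only: powr_add) simp
      qed
      then have "ennreal ((cmod y)\<^sup>2) * ennreal (cmod y powr (- (s + 4))) = ennreal (cmod y powr (- (s + 2)))"
        by (simp flip: ennreal_mult)
      moreover have "vector [y * x, y] \<in> hartogs_triangle \<longleftrightarrow> x \<in> ball 0 1 \<and> y \<in> ball 0 1"
        using elim mult_less_cancel_left_pos[of "cmod y" "cmod x" 1] by (auto simp: hartogs_triangle_def norm_mult)
      ultimately show ?thesis
        by (auto simp: g_def hartogs_map_def mult.commute[of x y] indicator_def mult.assoc[symmetric])
    qed
    \<comment> \<open>The density of \<open>disc_measure 0\<close> is 0 at the origin and 1
      elsewhere on the disc, so the two integrands agree off a null set.\<close>
    have B: "(\<integral>\<^sup>+x. ennreal (indicator (ball 0 1) x * cmod x powr (- 0)) * f (hartogs_map (x, y)) \<partial>lborel) =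
       (\<integral>\<^sup>+x. indicator (ball 0 1) x * f (hartogs_map (x, y)) \<partial>lborel)"
      by (rule nn_integral_cong_AE, use AE_lborel_singleton[of 0] in eventually_elim) (auto simp: indicator_def)
    have "(\<integral>\<^sup>+x. g (vector [x, y]) \<partial>lborel) = ennreal ((cmod y)\<^sup>2) * (\<integral>\<^sup>+x. g (vector [y * x, y]) \<partial>lborel)"
      by (rule nn_integral_complex_cmult) (measurable, rule elim)
    also have "\<dots> = (\<integral>\<^sup>+x. ennreal ((cmod y)\<^sup>2) * g (vector [y * x, y]) \<partial>lborel)"
      by (rule nn_integral_cmult[symmetric]) measurable
    also have "\<dots> = ennreal (indicator (ball 0 1) y * cmod y powr (- (s + 2))) *
        (\<integral>\<^sup>+x. indicator (ball 0 1) x * f (hartogs_map (x, y)) \<partial>lborel)"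
      unfolding A by (rule nn_integral_cmult) measurable
    finally show ?case unfolding B .
  qed
  also have "\<dots> = (\<integral>\<^sup>+y. ennreal (indicator (ball 0 1) y * cmod y powr (- (s + 2))) *
      (\<integral>\<^sup>+x. f (hartogs_map (x, y)) \<partial>disc_measure 0) \<partial>lborel)"
  proof -
    have "(\<integral>\<^sup>+x. f (hartogs_map (x, y)) \<partial>disc_measure 0) =
        (\<integral>\<^sup>+x. ennreal (indicator (ball 0 1) x * cmod x powr (- 0)) * f (hartogs_map (x, y)) \<partial>lborel)" for y
      unfolding disc_measure_def by (rule nn_integral_density) measurable
    then show ?thesis by (simp only:)
  qed
  also have "\<dots> = (\<integral>\<^sup>+y. \<integral>\<^sup>+x. f (hartogs_map (x, y)) \<partial>disc_measure 0 \<partial>disc_measure (s + 2))"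
    unfolding disc_measure_def[of "s + 2"]
    using sigma_finite_measure.borel_measurable_nn_integral[OF sigma_finite_disc_measure, of "\<lambda>y x. f (hartogs_map (x, y))" borel 0]
    by (intro nn_integral_density[symmetric]) measurable
  also have "\<dots> = (\<integral>\<^sup>+v. f (hartogs_map v) \<partial>bidisc_measure s)"
    unfolding bidisc_measure_def by (rule disc.nn_integral_snd) measurable
  finally show ?thesis .
qed

text \<open>\<open>W\<close> carries the Lebesgue sigma-algebra of the triangle and the bidisc the
  Borel one, so the two are compared as image measures on Borel sets. Integrability, Bochner
  integrals and almost-everywhere statements are transferred through this equation.\<close>

lemma distr_W: "distr W borel (\<lambda>z. z) = distr (bidisc_measure s) borel hartogs_map"
proof (rule measure_eqI)
  fix A assume "A \<in> sets (distr W borel (\<lambda>z. z))"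
  then have [measurable]: "A \<in> sets borel" by simp
  have "emeasure (distr W borel (\<lambda>z. z)) A = (\<integral>\<^sup>+z. indicator A z \<partial>W)"
    by (subst nn_integral_indicator[symmetric], simp, subst nn_integral_distr) (auto intro!: measurable_W)
  also have "\<dots> = (\<integral>\<^sup>+v. indicator A (hartogs_map v) \<partial>bidisc_measure s)"
    by (rule nn_integral_W) simp
  also have "\<dots> = emeasure (distr (bidisc_measure s) borel hartogs_map) A"
    by (subst nn_integral_indicator[symmetric], simp, subst nn_integral_distr) auto
  finally show "emeasure (distr W borel (\<lambda>z. z)) A = emeasure (distr (bidisc_measure s) borel hartogs_map) A" .
qed simp

lemma integrable_W:
  fixes f :: "complex ^ 2 \<Rightarrow> complex"
  assumes [measurable]: "f \<in> borel_measurable borel"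
  shows "integrable W f \<longleftrightarrow> integrable (bidisc_measure s) (\<lambda>v. f (hartogs_map v))"
  using integrable_distr_eq[OF ident_measurable_W assms]
    integrable_distr_eq[of hartogs_map "bidisc_measure s" borel f] by (simp add: distr_W)

lemma integral_W:
  fixes f :: "complex ^ 2 \<Rightarrow> complex"
  assumes [measurable]: "f \<in> borel_measurable borel"
  shows "(\<integral>z. f z \<partial>W) = (\<integral>v. f (hartogs_map v) \<partial>bidisc_measure s)"
  using integral_distr[OF ident_measurable_W assms]
    integral_distr[of hartogs_map "bidisc_measure s" borel f] by (simp add: distr_W)

lemma AE_W:
  assumes [measurable]: "Measurable.pred borel P"
  shows "(AE z in W. P z) \<longleftrightarrow> (AE v in bidisc_measure s. P (hartogs_map v))"
proof -
  have P: "{z \<in> space borel. P z} \<in> sets borel" by (rule predE[OF assms])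
  have "(AE z in W. P z) \<longleftrightarrow> (AE z in distr W borel (\<lambda>z. z). P z)"
    by (rule AE_distr_iff[OF ident_measurable_W P, symmetric])
  also have "\<dots> \<longleftrightarrow> (AE z in distr (bidisc_measure s) borel hartogs_map. P z)"
    by (simp only: distr_W)
  also have "\<dots> \<longleftrightarrow> (AE v in bidisc_measure s. P (hartogs_map v))"
    by (rule AE_distr_iff[OF _ P]) measurable
  finally show ?thesis .
qed

text \<open>The transfer to the bidisc works for Borel functions, while the spaces in question
  consist of Lebesgue measurable ones; this supplies Borel representatives.\<close>

lemma ex_borel_W:
  fixes f :: "complex ^ 2 \<Rightarrow> complex"
  assumes f: "f \<in> borel_measurable (lebesgue_on hartogs_triangle)"
  obtains f' where "f' \<in> borel_measurable borel" "AE z in W. f z = f' z"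
proof -
  have f0: "(\<lambda>z. indicator hartogs_triangle z *\<^sub>R f z) \<in> borel_measurable lebesgue"
    using f by (subst (asm) borel_measurable_restrict_space_iff) auto
  have "(\<lambda>z. Re (indicator hartogs_triangle z *\<^sub>R f z)) \<in> borel_measurable lebesgue"
    "(\<lambda>z. Im (indicator hartogs_triangle z *\<^sub>R f z)) \<in> borel_measurable lebesgue"
    using f0 by measurable
  from this[THEN completion_ex_borel_measurable_real] obtain a b
    where [measurable]: "a \<in> borel_measurable lborel" "b \<in> borel_measurable lborel"
      and ab: "AE z in lborel. Re (indicator hartogs_triangle z *\<^sub>R f z) = a z"
        "AE z in lborel. Im (indicator hartogs_triangle z *\<^sub>R f z) = b z"
    by blast
  have "AE z in lborel. z \<in> hartogs_triangle \<longrightarrow> f z = Complex (a z) (b z)"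
    using ab by eventually_elim (auto simp: complex_eq_iff)
  then have "AE z in lebesgue. z \<in> hartogs_triangle \<longrightarrow> f z = Complex (a z) (b z)"
    by (rule AE_completion)
  then have "AE z in W. f z = Complex (a z) (b z)"
    unfolding weighted_measure_def
    by (subst AE_density[OF \<mu>_measurable], subst AE_restrict_space_iff) (auto elim: eventually_mono)
  moreover have "(\<lambda>z. Complex (a z) (b z)) \<in> borel_measurable borel" by measurable
  ultimately show ?thesis using that by blast
qed

end

section \<open>The projection as an integral operator\<close>

lemma nn_integral_disc_powr:
  assumes "a < \<gamma> + 2"
  shows "(\<integral>\<^sup>+w. ennreal (cmod w powr \<gamma>) \<partial>disc_measure a) = ennreal (2 * pi / (2 + \<gamma> - a))"
proof -
  have "(\<integral>\<^sup>+w. ennreal (cmod w powr \<gamma>) \<partial>disc_measure a) =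
     (\<integral>\<^sup>+r. \<integral>\<^sup>+t. ennreal (cmod (rcis r (2 * pi * t)) powr \<gamma>) \<partial>circle_measure \<partial>radial_measure a)"
    by (rule nn_integral_disc_polar) measurable
  also have "\<dots> = (\<integral>\<^sup>+r. ennreal (\<bar>r\<bar> powr \<gamma>) \<partial>radial_measure a)"
    by (simp add: circle_measure_def emeasure_density)
  also have "\<dots> = (\<integral>\<^sup>+r. ennreal (indicator {0<..<1} r * (2 * pi * r powr (1 - a))) * ennreal (\<bar>r\<bar> powr \<gamma>) \<partial>lborel)"
    unfolding radial_measure_def by (rule nn_integral_density) measurable
  also have "\<dots> = (\<integral>\<^sup>+r. ennreal (2 * pi) * ennreal (indicator {0..1} r * r powr (1 - a + \<gamma>)) \<partial>lborel)"
    by (rule nn_integral_cong_AE, use AE_lborel_singleton[of 0] AE_lborel_singleton[of 1] in eventually_elim)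
       (auto simp: indicator_def powr_add ennreal_mult' mult.assoc)
  also have "\<dots> = ennreal (2 * pi) * (\<integral>\<^sup>+r. ennreal (indicator {0..1} r * r powr (1 - a + \<gamma>)) \<partial>lborel)"
    by (rule nn_integral_cmult) measurable
  also have "(\<integral>\<^sup>+r. ennreal (indicator {0..1} r * r powr (1 - a + \<gamma>)) \<partial>lborel) = ennreal (1 powr (1 - a + \<gamma> + 1) / (1 - a + \<gamma> + 1))"
    using assms by (intro nn_integral_has_integral_lebesgue has_integral_powr_from_0) auto
  finally show ?thesis by (simp add: ennreal_mult'[symmetric] algebra_simps)
qed

section \<open>The kernel majorant and its Schur weights\<close>

definition bidisc_majorant :: "complex \<times> complex \<Rightarrow> complex \<times> complex \<Rightarrow> real"
  where "bidisc_majorant u v = cmod (snd u) * cmod (snd v) /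
    ((cmod (1 - fst u * cnj (fst v)))\<^sup>2 * (cmod (1 - snd u * cnj (snd v)))\<^sup>2)"

lemma bidisc_majorant_measurable [measurable]:
  "case_prod bidisc_majorant \<in> borel_measurable ((borel \<Otimes>\<^sub>M borel) \<Otimes>\<^sub>M (borel \<Otimes>\<^sub>M borel))"
  unfolding bidisc_majorant_def split_beta' by measurable

lemma bidisc_majorant_nonneg: "0 \<le> bidisc_majorant u v"
  by (simp add: bidisc_majorant_def)

lemma bidisc_majorant_sym: "bidisc_majorant u v = bidisc_majorant v u"
proof -
  have "cmod (1 - x * cnj y) = cmod (1 - y * cnj x)" for x y
    using complex_mod_cnj[of "1 - x * cnj y"] by (simp add: mult.commute)
  then show ?thesis by (simp add: bidisc_majorant_def mult.commute)
qed

text \<open>One parameter governs both the growth at the boundary and the vanishing at v2 = 0, so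
  powers stay in the family: they only multiply \<gamma>. The vanishing of order \<gamma>
  counteracts the weight |v2|^(-(s+2)).\<close>

definition schur_weight :: "real \<Rightarrow> complex \<times> complex \<Rightarrow> real"
  where "schur_weight \<gamma> v = ((1 - (cmod (fst v))\<^sup>2) * (1 - (cmod (snd v))\<^sup>2)) powr (- \<gamma> / 2) * cmod (snd v) powr \<gamma>"

lemma schur_weight_measurable [measurable]: "schur_weight \<gamma> \<in> borel_measurable (borel \<Otimes>\<^sub>M borel)"
  unfolding schur_weight_def[abs_def] by measurable

lemma schur_weight_powr:
  assumes "cmod (fst v) < 1" "cmod (snd v) < 1"
  shows "schur_weight \<gamma> v powr e = schur_weight (\<gamma> * e) v"
  by (simp add: schur_weight_def powr_mult powr_powr)

lemma schur_weight_pos: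
  assumes "cmod (fst v) < 1" "cmod (snd v) < 1" "snd v \<noteq> 0"
  shows "0 < schur_weight \<gamma> v"
proof -
  have "(cmod (fst v))\<^sup>2 < 1" "(cmod (snd v))\<^sup>2 < 1" using assms by (auto simp: power_less_one_iff)
  then show ?thesis using assms by (auto simp: schur_weight_def)
qed

text \<open>The integral factors, and the Forelli-Rudin estimate with exponent \<gamma>/2 applies to
  each variable. In the second one the power |v2|^(1 + \<gamma>) meets the weight |v2|^(-(s+2)),
  which is integrable at 0 for \<gamma> > s - 1. The remaining factor |u2| is at most |u2|^\<gamma>
  because \<gamma> \<le> 1.\<close>

lemma schur_weight_estimate:
  assumes \<gamma>: "0 < \<gamma>" "s - 1 < \<gamma>" "\<gamma> \<le> 1"
  obtains C where "0 < C" and "AE u in bidisc_measure s.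
    (\<integral>\<^sup>+v. ennreal (bidisc_majorant u v * schur_weight \<gamma> v) \<partial>bidisc_measure s) \<le> ennreal (C * schur_weight \<gamma> u)"
proof -
  define F where "F \<delta> z w = (1 - (cmod w)\<^sup>2) powr (-(\<gamma>/2)) * cmod w powr \<delta> / (cmod (1 - z * cnj w))\<^sup>2" for \<delta> z w
  have [measurable]: "F \<delta> z \<in> borel_measurable borel" for \<delta> z
    unfolding F_def[abs_def] by measurable
  have Fn: "0 \<le> F \<delta> z w" for \<delta> z w by (simp add: F_def)
  obtain C1 where C1: "0 < C1" "\<And>z. cmod z < 1 \<Longrightarrow> (\<integral>\<^sup>+w. ennreal (F 0 z w) \<partial>disc_measure 0) \<le> ennreal (C1 * (1 - (cmod z)\<^sup>2) powr (-(\<gamma>/2)))"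
    using forelli_rudin[of "\<gamma>/2" 0 0] \<gamma> unfolding F_def by auto
  obtain C2 where C2: "0 < C2" "\<And>z. cmod z < 1 \<Longrightarrow> (\<integral>\<^sup>+w. ennreal (F (1 + \<gamma>) z w) \<partial>disc_measure (s + 2)) \<le> ennreal (C2 * (1 - (cmod z)\<^sup>2) powr (-(\<gamma>/2)))"
    using forelli_rudin[of "\<gamma>/2" "s + 2" "1 + \<gamma>"] \<gamma> unfolding F_def by auto
  have "AE u in bidisc_measure s.
    (\<integral>\<^sup>+v. ennreal (bidisc_majorant u v * schur_weight \<gamma> v) \<partial>bidisc_measure s) \<le> ennreal (C1 * C2 * schur_weight \<gamma> u)"
    using AE_bidisc_measure
  proof eventually_elim
    case (elim u)
    have sq: "(cmod (fst u))\<^sup>2 < 1" "(cmod (snd u))\<^sup>2 < 1" using elim by (auto simp: power_less_one_iff)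
    have "(\<integral>\<^sup>+v. ennreal (bidisc_majorant u v * schur_weight \<gamma> v) \<partial>bidisc_measure s) =
      (\<integral>\<^sup>+v. ennreal (cmod (snd u)) * (ennreal (F 0 (fst u) (fst v)) * ennreal (F (1 + \<gamma>) (snd u) (snd v))) \<partial>bidisc_measure s)"
    proof (rule nn_integral_cong_AE, use AE_bidisc_measure in eventually_elim)
      case (elim v)
      then have "(cmod (fst v))\<^sup>2 < 1" "(cmod (snd v))\<^sup>2 < 1" by (auto simp: power_less_one_iff)
      then have "bidisc_majorant u v * schur_weight \<gamma> v = cmod (snd u) * (F 0 (fst u) (fst v) * F (1 + \<gamma>) (snd u) (snd v))"
        using elim by (simp add: bidisc_majorant_def schur_weight_def F_def powr_mult powr_add mult_ac)
      then show ?case using Fn by (simp add: ennreal_mult)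
    qed
    also have "\<dots> = ennreal (cmod (snd u)) * (\<integral>\<^sup>+v. ennreal (F 0 (fst u) (fst v)) * ennreal (F (1 + \<gamma>) (snd u) (snd v)) \<partial>bidisc_measure s)"
      by (rule nn_integral_cmult) measurable
    also have "(\<integral>\<^sup>+v. ennreal (F 0 (fst u) (fst v)) * ennreal (F (1 + \<gamma>) (snd u) (snd v)) \<partial>bidisc_measure s) =
      (\<integral>\<^sup>+x. \<integral>\<^sup>+y. ennreal (F 0 (fst u) x) * ennreal (F (1 + \<gamma>) (snd u) y) \<partial>disc_measure (s + 2) \<partial>disc_measure 0)"
    proof -
      have "(\<lambda>v. ennreal (F 0 (fst u) (fst v)) * ennreal (F (1 + \<gamma>) (snd u) (snd v))) \<in> borel_measurable (disc_measure 0 \<Otimes>\<^sub>M disc_measure (s + 2))"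
        by measurable
      from sigma_finite_measure.nn_integral_fst[OF sigma_finite_disc_measure this] show ?thesis
        by (simp add: bidisc_measure_def)
    qed
    also have "\<dots> = (\<integral>\<^sup>+x. ennreal (F 0 (fst u) x) * (\<integral>\<^sup>+y. ennreal (F (1 + \<gamma>) (snd u) y) \<partial>disc_measure (s + 2)) \<partial>disc_measure 0)"
      by (subst nn_integral_cmult) auto
    also have "\<dots> = (\<integral>\<^sup>+x. ennreal (F 0 (fst u) x) \<partial>disc_measure 0) * (\<integral>\<^sup>+y. ennreal (F (1 + \<gamma>) (snd u) y) \<partial>disc_measure (s + 2))"
      by (rule nn_integral_multc) measurable
    also have "ennreal (cmod (snd u)) * \<dots> \<le> ennreal (cmod (snd u) powr \<gamma>) *
      (ennreal (C1 * (1 - (cmod (fst u))\<^sup>2) powr (-(\<gamma>/2))) * ennreal (C2 * (1 - (cmod (snd u))\<^sup>2) powr (-(\<gamma>/2))))"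
      using elim C1 C2 \<gamma> powr_mono'[of \<gamma> 1 "cmod (snd u)"]
      by (intro mult_mono ennreal_leI) auto
    also have "\<dots> = ennreal (C1 * C2 * schur_weight \<gamma> u)"
      using sq C1(1) C2(1) by (simp add: schur_weight_def powr_mult mult_ac flip: ennreal_mult)
    finally show ?case .
  qed
  then show ?thesis using C1(1) C2(1) by (intro that[of "C1 * C2"]) auto
qed

text \<open>Dominated convergence along sequences tending to z0, applied to the remainder of the
  linear approximation divided by the increment. It tends to 0 pointwise and is dominated by 2
  B.\<close>

lemma has_derivative_integral_param:
  fixes F :: "'a::euclidean_space \<Rightarrow> 'b \<Rightarrow> complex"
  assumes \<delta>: "0 < \<delta>"
    and F: "\<And>z. z \<in> ball z0 \<delta> \<Longrightarrow> integrable M (F z)"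
    and L: "AE w in M. \<forall>z\<in>ball z0 \<delta>. ((\<lambda>z. F z w) has_derivative L z w) (at z)"
    and bound: "AE w in M. \<forall>z\<in>ball z0 \<delta>. \<forall>h. norm (L z w h) \<le> B w * norm h"
    and B: "integrable M B"
    and Lm: "\<And>h. (\<lambda>w. L z0 w h) \<in> borel_measurable M"
  shows "((\<lambda>z. \<integral>w. F z w \<partial>M) has_derivative (\<lambda>h. \<integral>w. L z0 w h \<partial>M)) (at z0)"
proof -
  have z0: "z0 \<in> ball z0 \<delta>" using \<delta> by simp
  have intL: "integrable M (\<lambda>w. L z0 w h)" for h
  proof (rule Bochner_Integration.integrable_bound)
    show "integrable M (\<lambda>w. B w * norm h)" using B by simp
    show "AE w in M. norm (L z0 w h) \<le> norm (B w * norm h)"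
      using bound by eventually_elim (use z0 in \<open>auto intro: order_trans[OF _ abs_ge_self]\<close>)
  qed (rule Lm)
  have lin: "AE w in M. bounded_linear (L z0 w)"
    using L by eventually_elim (use z0 has_derivative_bounded_linear in blast)
  define R where "R w z = F z w - F z0 w - L z0 w (z - z0)" for w z
  have bl: "bounded_linear (\<lambda>h. \<integral>w. L z0 w h \<partial>M)"
  proof
    fix h k :: 'a and r :: real
    have "(\<integral>w. L z0 w (h + k) \<partial>M) = (\<integral>w. L z0 w h + L z0 w k \<partial>M)"
    proof (rule integral_cong_AE)
      show "AE w in M. L z0 w (h + k) = L z0 w h + L z0 w k"
        using lin by eventually_elim (simp add: linear_add bounded_linear.linear)
    qed (intro borel_measurable_add Lm)+
    then show "(\<integral>w. L z0 w (h + k) \<partial>M) = (\<integral>w. L z0 w h \<partial>M) + (\<integral>w. L z0 w k \<partial>M)"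
      by (simp add: intL)
    have "(\<integral>w. L z0 w (r *\<^sub>R h) \<partial>M) = (\<integral>w. r *\<^sub>R L z0 w h \<partial>M)"
    proof (rule integral_cong_AE)
      show "AE w in M. L z0 w (r *\<^sub>R h) = r *\<^sub>R L z0 w h"
        using lin by eventually_elim (simp add: linear_scale bounded_linear.linear)
    qed (intro borel_measurable_scaleR borel_measurable_const Lm)+
    then show "(\<integral>w. L z0 w (r *\<^sub>R h) \<partial>M) = r *\<^sub>R (\<integral>w. L z0 w h \<partial>M)" by simp
    show "\<exists>K. \<forall>h. norm (\<integral>w. L z0 w h \<partial>M) \<le> norm h * K"
    proof (intro exI allI)
      fix h
      have "norm (\<integral>w. L z0 w h \<partial>M) \<le> (\<integral>w. norm (L z0 w h) \<partial>M)" by (rule integral_norm_bound)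
      also have "\<dots> \<le> (\<integral>w. B w * norm h \<partial>M)"
      proof (rule integral_mono_AE)
        show "AE w in M. norm (L z0 w h) \<le> B w * norm h"
          using bound by eventually_elim (use z0 in blast)
      qed (use B intL in auto)
      finally show "norm (\<integral>w. L z0 w h \<partial>M) \<le> norm h * (\<integral>w. B w \<partial>M)" by (simp add: mult.commute)
    qed
  qed
  have "((\<lambda>z. norm ((\<integral>w. F z w \<partial>M) - (\<integral>w. F z0 w \<partial>M) - (\<integral>w. L z0 w (z - z0) \<partial>M)) / norm (z - z0)) \<longlongrightarrow> 0) (at z0 within ball z0 \<delta>)"
    unfolding tendsto_at_iff_sequentially
  proof (intro allI impI)
    fix X :: "nat \<Rightarrow> 'a" assume X: "\<forall>i. X i \<in> ball z0 \<delta> - {z0}" "X \<longlonglongrightarrow> z0"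
    have Rint: "integrable M (\<lambda>w. R w (X i))" for i
      unfolding R_def using F z0 intL X(1) by auto
    have lim: "(\<lambda>i. \<integral>w. norm (R w (X i)) / norm (X i - z0) \<partial>M) \<longlonglongrightarrow> (\<integral>w. 0 \<partial>M)"
    proof (rule integral_dominated_convergence)
      show "integrable M (\<lambda>w. 2 * B w)" using B by simp
      show "(\<lambda>w. norm (R w (X i)) / norm (X i - z0)) \<in> borel_measurable M" for i
        using borel_measurable_integrable[OF Rint[of i], measurable] by measurable
      show "AE w in M. (\<lambda>i. norm (R w (X i)) / norm (X i - z0)) \<longlonglongrightarrow> 0"
        using L
      proof eventually_elim
        case (elim w)
        then have "((\<lambda>z. F z w) has_derivative L z0 w) (at z0 within ball z0 \<delta>)"
          using z0 has_derivative_at_withinI by blast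
        then have "((\<lambda>z. norm (R w z) / norm (z - z0)) \<longlongrightarrow> 0) (at z0 within ball z0 \<delta>)"
          unfolding has_derivative_iff_norm R_def by simp
        then show ?case
          using X unfolding tendsto_at_iff_sequentially by (auto simp: o_def)
      qed
      show "AE w in M. norm (norm (R w (X i)) / norm (X i - z0)) \<le> 2 * B w" for i
        using L bound
      proof eventually_elim
        case (elim w)
        have Xi: "X i \<in> ball z0 \<delta>" "X i \<noteq> z0" using X(1) by auto
        \<comment> \<open>The mean value inequality bounds the increment by B times the distance,
          and the linear term has the same bound; hence the factor 2 in the dominating
          function.\<close>
        have "norm (F (X i) w - F z0 w) \<le> B w * norm (X i - z0)"
        proof (rule differentiable_bound[of "ball z0 \<delta>"])
          show "((\<lambda>z. F z w) has_derivative L z w) (at z within ball z0 \<delta>)" if "z \<in> ball z0 \<delta>" for z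
            using elim that has_derivative_at_withinI by blast
          show "onorm (L z w) \<le> B w" if "z \<in> ball z0 \<delta>" for z
            using elim(2) that by (intro onorm_le) auto
        qed (use Xi z0 in auto)
        moreover have "norm (L z0 w (X i - z0)) \<le> B w * norm (X i - z0)"
          using elim z0 by auto
        ultimately have "norm (R w (X i)) \<le> 2 * B w * norm (X i - z0)"
          unfolding R_def using norm_triangle_ineq4[of "F (X i) w - F z0 w" "L z0 w (X i - z0)"] by simp
        then show ?case using Xi by (simp add: divide_le_eq)
      qed
    qed simp_all
    have le: "norm (norm ((\<integral>w. F (X i) w \<partial>M) - (\<integral>w. F z0 w \<partial>M) - (\<integral>w. L z0 w (X i - z0) \<partial>M)) / norm (X i - z0))
        \<le> (\<integral>w. norm (R w (X i)) / norm (X i - z0) \<partial>M)" for i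
    proof -
      have "(\<integral>w. F (X i) w \<partial>M) - (\<integral>w. F z0 w \<partial>M) - (\<integral>w. L z0 w (X i - z0) \<partial>M) = (\<integral>w. R w (X i) \<partial>M)"
        unfolding R_def using F z0 X(1) intL by simp
      then show ?thesis
        using integral_norm_bound[of M "\<lambda>w. R w (X i)"] by (simp add: divide_right_mono)
    qed
    show "((\<lambda>z. norm ((\<integral>w. F z w \<partial>M) - (\<integral>w. F z0 w \<partial>M) - (\<integral>w. L z0 w (z - z0) \<partial>M)) / norm (z - z0)) \<circ> X) \<longlonglongrightarrow> 0"
      unfolding o_def by (rule Lim_null_comparison[OF always_eventually]) (use le lim in auto)
  qed
  then have "((\<lambda>z. \<integral>w. F z w \<partial>M) has_derivative (\<lambda>h. \<integral>w. L z0 w h \<partial>M)) (at z0 within ball z0 \<delta>)"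
    unfolding has_derivative_iff_norm using bl by simp
  then show ?thesis using z0 by (simp add: at_within_open[OF z0 open_ball])
qed

section \<open>The kernel of the projection on the Hartogs triangle\<close>

definition hartogs_kernel :: "real \<Rightarrow> complex ^ 2 \<Rightarrow> complex ^ 2 \<Rightarrow> complex"
  where "hartogs_kernel s z w = z $ 2 * cnj (w $ 2) * disc_kernel 0 (z $ 1 / z $ 2 * cnj (w $ 1 / w $ 2)) * disc_kernel s (z $ 2 * cnj (w $ 2))"

lemma hartogs_kernel_map:
  "snd v \<noteq> 0 \<Longrightarrow> hartogs_kernel s z (hartogs_map v) = z $ 2 * cnj (snd v) * disc_kernel 0 (z $ 1 / z $ 2 * cnj (fst v)) * disc_kernel s (z $ 2 * cnj (snd v))"
  by (simp add: hartogs_kernel_def)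

lemma hartogs_kernel_measurable [measurable (raw)]:
  assumes [measurable]: "f \<in> borel_measurable M" "g \<in> borel_measurable M"
  shows "(\<lambda>x. hartogs_kernel s (f x) (g x)) \<in> borel_measurable M"
proof -
  have [measurable]: "(\<lambda>x. f x $ i) \<in> borel_measurable M" "(\<lambda>x. g x $ i) \<in> borel_measurable M" for i
    using measurable_compose[OF assms(1) vec_nth_measurable] measurable_compose[OF assms(2) vec_nth_measurable] by auto
  show ?thesis unfolding hartogs_kernel_def by measurable
qed

text \<open>The Hermitian symmetry behind the self-adjointness of the integral operator.\<close>

lemma cnj_hartogs_kernel: "cnj (hartogs_kernel s z w) = hartogs_kernel s w z"
  by (simp add: hartogs_kernel_def disc_kernel_def mult_ac)

lemma hartogs_triangleD:
  fixes z :: "complex ^ 2"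
  assumes "z \<in> hartogs_triangle"
  shows "z $ 2 \<noteq> 0" "cmod (z $ 2) < 1" "cmod (z $ 1 / z $ 2) < 1"
proof -
  show "z $ 2 \<noteq> 0" using assms by (auto simp: hartogs_triangle_def)
  then show "cmod (z $ 2) < 1" "cmod (z $ 1 / z $ 2) < 1"
    using assms by (auto simp: hartogs_triangle_def norm_divide divide_less_eq)
qed

text \<open>The factor pi is the area of the disc in which the first variable runs.\<close>

lemma nn_integral_bidisc_radial:
  assumes [measurable]: "k \<in> borel_measurable borel"
  shows "(\<integral>\<^sup>+v. k (cmod (snd v)) \<partial>bidisc_measure s) = ennreal pi * (\<integral>\<^sup>+r. k r \<partial>radial_measure (s + 2))"
proof -
  have "(\<integral>\<^sup>+w. 1 \<partial>disc_measure 0) = (\<integral>\<^sup>+w. ennreal (cmod w powr 0) \<partial>disc_measure 0)"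
    by (rule nn_integral_cong_AE, use AE_disc_measure in eventually_elim) auto
  also have "\<dots> = ennreal pi" by (subst nn_integral_disc_powr) auto
  finally have pi: "(\<integral>\<^sup>+w. 1 \<partial>disc_measure 0) = ennreal pi" .
  have "(\<integral>\<^sup>+v. k (cmod (snd v)) \<partial>bidisc_measure s) = (\<integral>\<^sup>+y. \<integral>\<^sup>+x. k (cmod y) * 1 \<partial>disc_measure 0 \<partial>disc_measure (s + 2))"
    unfolding bidisc_measure_def by (subst disc.nn_integral_snd[symmetric]) simp_all
  also have "\<dots> = (\<integral>\<^sup>+y. k (cmod y) * ennreal pi \<partial>disc_measure (s + 2))"
    by (subst nn_integral_cmult) (simp_all only: pi, simp)
  also have "\<dots> = ennreal pi * (\<integral>\<^sup>+y. k (cmod y) \<partial>disc_measure (s + 2))"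
    by (subst nn_integral_multc, measurable) (simp add: mult.commute)
  also have "(\<integral>\<^sup>+y. k (cmod y) \<partial>disc_measure (s + 2)) = (\<integral>\<^sup>+r. \<integral>\<^sup>+t. k (cmod (rcis r (2 * pi * t))) \<partial>circle_measure \<partial>radial_measure (s + 2))"
    by (rule nn_integral_disc_polar) measurable
  also have "\<dots> = (\<integral>\<^sup>+r. k r \<partial>radial_measure (s + 2))"
    by (rule nn_integral_cong_AE, use AE_radial_measure in eventually_elim)
       (simp add: circle_measure_def emeasure_density)
  finally show ?thesis .
qed

lemma nn_integral_radial:
  assumes [measurable]: "f \<in> borel_measurable borel"
  shows "(\<integral>\<^sup>+r. f r \<partial>radial_measure a) = (\<integral>\<^sup>+r. ennreal (indicator {0<..<1} r * (2 * pi * r powr (1 - a))) * f r \<partial>lborel)"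
  unfolding radial_measure_def by (rule nn_integral_density) measurable

section \<open>Square-integrable functions and the norm bound for the kernel operator\<close>

context hartogs_weight
begin

lemma borel_measurable_W_iff: "f \<in> borel_measurable W \<longleftrightarrow> f \<in> borel_measurable (lebesgue_on hartogs_triangle)"
  by (rule arg_cong[OF measurable_cong_sets[OF sets_W refl], of "\<lambda>A. f \<in> A"])

lemma AE_W_in: "AE z in W. z \<in> hartogs_triangle"
  using AE_space[of W] by (simp add: space_W)

definition L2 :: "(complex ^ 2 \<Rightarrow> complex) \<Rightarrow> bool"
  where "L2 f \<longleftrightarrow> f \<in> borel_measurable W \<and> (\<integral>\<^sup>+z. ennreal ((cmod (f z))\<^sup>2) \<partial>W) < \<infinity>"

lemma L2_measurable: "L2 f \<Longrightarrow> f \<in> borel_measurable W"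
  by (simp add: L2_def)

lemma L2_cnj: "L2 f \<Longrightarrow> L2 (\<lambda>z. cnj (f z))"
  unfolding L2_def by (auto intro: measurable_compose[OF _ borel_measurable_cnj])

lemma L2_diff:
  assumes f: "L2 f" and g: "L2 g"
  shows "L2 (\<lambda>z. f z - g z)"
proof -
  have [measurable]: "f \<in> borel_measurable W" "g \<in> borel_measurable W" using f g by (auto simp: L2_def)
  have "(\<integral>\<^sup>+z. ennreal ((cmod (f z - g z))\<^sup>2) \<partial>W) \<le> (\<integral>\<^sup>+z. 2 * ennreal ((cmod (f z))\<^sup>2) + 2 * ennreal ((cmod (g z))\<^sup>2) \<partial>W)"
  proof (rule nn_integral_mono)
    fix z
    have "(cmod (f z - g z))\<^sup>2 \<le> (cmod (f z) + cmod (g z))\<^sup>2"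
      using norm_triangle_ineq4 by (intro power_mono) auto
    also have "\<dots> \<le> 2 * (cmod (f z))\<^sup>2 + 2 * (cmod (g z))\<^sup>2"
      using sum_squares_bound[of "cmod (f z)" "cmod (g z)"] by (simp add: power2_sum)
    finally have "ennreal ((cmod (f z - g z))\<^sup>2) \<le> ennreal (2 * (cmod (f z))\<^sup>2 + 2 * (cmod (g z))\<^sup>2)"
      by (rule ennreal_leI)
    then show "ennreal ((cmod (f z - g z))\<^sup>2) \<le> 2 * ennreal ((cmod (f z))\<^sup>2) + 2 * ennreal ((cmod (g z))\<^sup>2)"
      by (simp add: ennreal_mult)
  qed
  also have "\<dots> = 2 * (\<integral>\<^sup>+z. ennreal ((cmod (f z))\<^sup>2) \<partial>W) + 2 * (\<integral>\<^sup>+z. ennreal ((cmod (g z))\<^sup>2) \<partial>W)"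
    by (simp add: nn_integral_add nn_integral_cmult)
  also have "\<dots> < \<infinity>"
    using f g by (auto simp: L2_def ennreal_mult_less_top)
  finally show ?thesis by (simp add: L2_def)
qed

lemma L2_mult_integrable:
  assumes f: "L2 f" and g: "L2 g"
  shows "integrable W (\<lambda>z. f z * g z)"
proof (rule integrableI_bounded)
  have [measurable]: "f \<in> borel_measurable W" "g \<in> borel_measurable W" using f g by (auto simp: L2_def)
  show "(\<lambda>z. f z * g z) \<in> borel_measurable W" by measurable
  have "(\<integral>\<^sup>+z. ennreal (norm (f z * g z)) \<partial>W) \<le> (\<integral>\<^sup>+z. ennreal ((cmod (f z))\<^sup>2) + ennreal ((cmod (g z))\<^sup>2) \<partial>W)"
  proof (rule nn_integral_mono)
    fix z
    have "2 * (cmod (f z) * cmod (g z)) \<le> (cmod (f z))\<^sup>2 + (cmod (g z))\<^sup>2"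
      using sum_squares_bound[of "cmod (f z)" "cmod (g z)"] by simp
    moreover have "0 \<le> cmod (f z) * cmod (g z)" by simp
    ultimately have "norm (f z * g z) \<le> (cmod (f z))\<^sup>2 + (cmod (g z))\<^sup>2"
      unfolding norm_mult by linarith
    then show "ennreal (norm (f z * g z)) \<le> ennreal ((cmod (f z))\<^sup>2) + ennreal ((cmod (g z))\<^sup>2)"
      by (simp flip: ennreal_plus add: ennreal_leI)
  qed
  also have "\<dots> < \<infinity>" using f g by (subst nn_integral_add) (auto simp: L2_def)
  finally show "(\<integral>\<^sup>+z. ennreal (norm (f z * g z)) \<partial>W) < \<infinity>" .
qed

lemma L2_cong_AE:
  assumes "L2 f" "AE z in W. f z = g z" "g \<in> borel_measurable W"
  shows "L2 g"
proof -
  have "(\<integral>\<^sup>+z. ennreal ((cmod (f z))\<^sup>2) \<partial>W) = (\<integral>\<^sup>+z. ennreal ((cmod (g z))\<^sup>2) \<partial>W)"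
    using assms(2) by (intro nn_integral_cong_AE) (auto elim!: eventually_mono)
  then show ?thesis using assms by (simp add: L2_def)
qed

lemma nn_integral_W_snd:
  assumes [measurable]: "k \<in> borel_measurable borel"
  shows "(\<integral>\<^sup>+z. k (cmod (z $ 2)) \<partial>W) = ennreal pi * (\<integral>\<^sup>+r. k r \<partial>radial_measure (s + 2))"
  by (subst nn_integral_W) (simp_all add: nn_integral_bidisc_radial)

text \<open>The radial integrand is r^(\<gamma> - s - 1). For \<gamma> = 2 this shows that z2 is
  square-integrable; for \<gamma> = p it gives the L^p norm of the projected test functions.\<close>

lemma nn_integral_W_snd_powr:
  assumes "s < \<gamma>"
  shows "(\<integral>\<^sup>+z. ennreal (cmod (z $ 2) powr \<gamma>) \<partial>W) = ennreal (2 * pi\<^sup>2 / (\<gamma> - s))"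
proof -
  have "(\<integral>\<^sup>+z. ennreal (cmod (z $ 2) powr \<gamma>) \<partial>W) = (\<integral>\<^sup>+v. ennreal (cmod (snd v) powr \<gamma>) \<partial>bidisc_measure s)"
    by (subst nn_integral_W) simp_all
  also have "\<dots> = ennreal pi * (\<integral>\<^sup>+r. ennreal (r powr \<gamma>) \<partial>radial_measure (s + 2))"
    by (rule nn_integral_bidisc_radial) measurable
  also have "(\<integral>\<^sup>+r. ennreal (r powr \<gamma>) \<partial>radial_measure (s + 2)) =
      (\<integral>\<^sup>+r. ennreal (2 * pi) * ennreal (indicator {0..1} r * r powr (1 - (s + 2) + \<gamma>)) \<partial>lborel)"
    by (subst nn_integral_radial, measurable, rule nn_integral_cong_AE,
        use AE_lborel_singleton[of 0] AE_lborel_singleton[of 1] in eventually_elim)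
       (auto simp: indicator_def mult.assoc simp flip: ennreal_mult powr_add)
  also have "\<dots> = ennreal (2 * pi) * (\<integral>\<^sup>+r. ennreal (indicator {0..1} r * r powr (1 - (s + 2) + \<gamma>)) \<partial>lborel)"
    by (rule nn_integral_cmult) measurable
  also have "(\<integral>\<^sup>+r. ennreal (indicator {0..1} r * r powr (1 - (s + 2) + \<gamma>)) \<partial>lborel) = ennreal (1 powr (1 - (s + 2) + \<gamma> + 1) / (1 - (s + 2) + \<gamma> + 1))"
    using assms by (intro nn_integral_has_integral_lebesgue has_integral_powr_from_0) auto
  finally show ?thesis using assms by (simp add: power2_eq_square mult_ac flip: ennreal_mult)
qed

text \<open>For fixed z both disc kernels are bounded in w. What remains is a multiple of |w2|,
  which is square-integrable because s < 2.\<close>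

lemma L2_hartogs_kernel:
  assumes z: "z \<in> hartogs_triangle"
  shows "L2 (hartogs_kernel s z)"
proof -
  define C where "C = 1 / (1 - cmod (z $ 1 / z $ 2))\<^sup>2 * (1 / (1 - cmod (z $ 2))\<^sup>2)"
  note zD = hartogs_triangleD[OF z]
  have [measurable]: "hartogs_kernel s z \<in> borel_measurable borel" by measurable
  have "(\<integral>\<^sup>+w. ennreal ((cmod (hartogs_kernel s z w))\<^sup>2) \<partial>W) = (\<integral>\<^sup>+v. ennreal ((cmod (hartogs_kernel s z (hartogs_map v)))\<^sup>2) \<partial>bidisc_measure s)"
    by (rule nn_integral_W) measurable
  also have "\<dots> \<le> (\<integral>\<^sup>+v. ennreal (C\<^sup>2) * ennreal (cmod (hartogs_map v $ 2) powr 2) \<partial>bidisc_measure s)"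
  proof (rule nn_integral_mono_AE, use AE_bidisc_measure in eventually_elim)
    case (elim v)
    have "cmod (hartogs_kernel s z (hartogs_map v)) = (cmod (z $ 2) * cmod (snd v)) * (cmod (disc_kernel 0 (z $ 1 / z $ 2 * cnj (fst v))) * cmod (disc_kernel s (z $ 2 * cnj (snd v))))"
      using elim by (simp add: hartogs_kernel_map norm_mult)
    also have "\<dots> \<le> (1 * cmod (snd v)) * C"
      unfolding C_def using elim zD s by (intro mult_mono disc_kernel_cnj_bound) auto
    finally have "(cmod (hartogs_kernel s z (hartogs_map v)))\<^sup>2 \<le> C\<^sup>2 * (cmod (snd v) powr 2)"
      using elim power_mono[of "cmod (hartogs_kernel s z (hartogs_map v))" "(1 * cmod (snd v)) * C" 2]
      by (simp add: power_mult_distrib mult.commute)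
    then show ?case by (simp add: ennreal_leI flip: ennreal_mult)
  qed
  also have "\<dots> = ennreal (C\<^sup>2) * (\<integral>\<^sup>+v. ennreal (cmod (hartogs_map v $ 2) powr 2) \<partial>bidisc_measure s)"
    by (rule nn_integral_cmult) measurable
  also have "(\<integral>\<^sup>+v. ennreal (cmod (hartogs_map v $ 2) powr 2) \<partial>bidisc_measure s) = (\<integral>\<^sup>+z. ennreal (cmod (z $ 2) powr 2) \<partial>W)"
    by (rule nn_integral_W[symmetric]) measurable
  also have "ennreal (C\<^sup>2) * \<dots> < \<infinity>"
    using s nn_integral_W_snd_powr[of 2] by (simp flip: ennreal_mult)
  finally show ?thesis by (auto simp: L2_def intro: measurable_W)
qed

text \<open>The value 0 off the triangle matches the normalization in
  \<open>bergman_projection\<close>, so that the two can be equal as total functions.\<close>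

definition hartogs_projection :: "(complex ^ 2 \<Rightarrow> complex) \<Rightarrow> complex ^ 2 \<Rightarrow> complex"
  where "hartogs_projection f z = (if z \<in> hartogs_triangle then \<integral>w. hartogs_kernel s z w * f w \<partial>W else 0)"

lemma hartogs_projection_cong:
  assumes "f \<in> borel_measurable W" "g \<in> borel_measurable W" "AE z in W. f z = g z"
  shows "hartogs_projection f = hartogs_projection g"
proof
  fix z
  have m: "hartogs_kernel s z \<in> borel_measurable W" by (rule measurable_W) measurable
  have "(\<integral>w. hartogs_kernel s z w * f w \<partial>W) = (\<integral>w. hartogs_kernel s z w * g w \<partial>W)"
  proof (rule integral_cong_AE)
    show "AE w in W. hartogs_kernel s z w * f w = hartogs_kernel s z w * g w" using assms(3) by eventually_elim simp
  qed (use m assms in \<open>auto intro: borel_measurable_times\<close>)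
  then show "hartogs_projection f z = hartogs_projection g z" by (simp add: hartogs_projection_def)
qed

lemma hartogs_projection_bidisc:
  assumes [measurable]: "f \<in> borel_measurable borel" and "z \<in> hartogs_triangle"
  shows "hartogs_projection f z = (\<integral>v. hartogs_kernel s z (hartogs_map v) * f (hartogs_map v) \<partial>bidisc_measure s)"
  using assms(2) integral_W[of "\<lambda>w. hartogs_kernel s z w * f w"] by (simp add: hartogs_projection_def)

lemma hartogs_projection_borel:
  assumes [measurable]: "f \<in> borel_measurable borel"
  shows "hartogs_projection f \<in> borel_measurable borel"
proof -
  have [measurable]: "(\<lambda>z. \<integral>v. hartogs_kernel s z (hartogs_map v) * f (hartogs_map v) \<partial>bidisc_measure s) \<in> borel_measurable borel"
    by (intro sigma_finite_measure.borel_measurable_lebesgue_integral[OF sigma_finite_bidisc_measure]) measurable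
  have "hartogs_projection f = (\<lambda>z. if z \<in> hartogs_triangle then \<integral>v. hartogs_kernel s z (hartogs_map v) * f (hartogs_map v) \<partial>bidisc_measure s else 0)"
    using hartogs_projection_bidisc[OF assms] by (auto simp: fun_eq_iff hartogs_projection_def)
  then show ?thesis by simp
qed

lemma L2_borel:
  assumes f: "L2 f"
  obtains f' where "f' \<in> borel_measurable borel" "AE z in W. f z = f' z" "L2 f'" "hartogs_projection f = hartogs_projection f'"
proof -
  obtain f' where f': "f' \<in> borel_measurable borel" "AE z in W. f z = f' z"
    using ex_borel_W[of f] L2_measurable[OF f] unfolding borel_measurable_W_iff by blast
  show ?thesis
    using f' L2_cong_AE[OF f f'(2) measurable_W[OF f'(1)]] hartogs_projection_cong[OF L2_measurable[OF f] measurable_W[OF f'(1)] f'(2)]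
    by (rule that)
qed

lemma hartogs_kernel_majorant:
  assumes u: "cmod (fst u) < 1" "snd u \<noteq> 0" "cmod (snd u) < 1" and v: "cmod (fst v) < 1" "snd v \<noteq> 0" "cmod (snd v) < 1"
  shows "cmod (hartogs_kernel s (hartogs_map u) (hartogs_map v)) \<le> bidisc_majorant u v"
proof -
  have lt: "cmod (fst u * cnj (fst v)) < 1" "cmod (snd u * cnj (snd v)) < 1"
    using u v mult_strict_mono[of "cmod (fst u)" 1 "cmod (fst v)" 1]
      mult_strict_mono[of "cmod (snd u)" 1 "cmod (snd v)" 1] by (auto simp: norm_mult)
  have "cmod (hartogs_kernel s (hartogs_map u) (hartogs_map v)) =
      (cmod (snd u) * cmod (snd v)) * (cmod (disc_kernel 0 (fst u * cnj (fst v))) * cmod (disc_kernel s (snd u * cnj (snd v))))"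
    using u v by (simp add: hartogs_kernel_map norm_mult)
  also have "\<dots> \<le> (cmod (snd u) * cmod (snd v)) * (1 / (cmod (1 - fst u * cnj (fst v)))\<^sup>2 * (1 / (cmod (1 - snd u * cnj (snd v)))\<^sup>2))"
    using lt s by (intro mult_mono disc_kernel_norm_le) auto
  also have "\<dots> = bidisc_majorant u v" by (simp add: bidisc_majorant_def)
  finally show ?thesis .
qed

lemma hartogs_projection_majorant:
  assumes f: "L2 f" "f \<in> borel_measurable borel"
  shows "AE u in bidisc_measure s. ennreal (cmod (hartogs_projection f (hartogs_map u))) \<le>
    (\<integral>\<^sup>+v. ennreal (bidisc_majorant u v * cmod (f (hartogs_map v))) \<partial>bidisc_measure s)"
  using AE_bidisc_measure
proof eventually_elim
  case (elim u)
  note [measurable] = f(2)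
  have H: "hartogs_map u \<in> hartogs_triangle" using elim by (intro hartogs_map_in) auto
  have "integrable W (\<lambda>w. hartogs_kernel s (hartogs_map u) w * f w)"
    by (rule L2_mult_integrable[OF L2_hartogs_kernel[OF H] f(1)])
  then have int: "integrable (bidisc_measure s) (\<lambda>v. hartogs_kernel s (hartogs_map u) (hartogs_map v) * f (hartogs_map v))"
    by (subst (asm) integrable_W) auto
  have "ennreal (cmod (hartogs_projection f (hartogs_map u))) \<le> (\<integral>\<^sup>+v. ennreal (norm (hartogs_kernel s (hartogs_map u) (hartogs_map v) * f (hartogs_map v))) \<partial>bidisc_measure s)"
    unfolding hartogs_projection_bidisc[OF f(2) H] by (rule integral_norm_bound_ennreal[OF int])
  also have "\<dots> \<le> (\<integral>\<^sup>+v. ennreal (bidisc_majorant u v * cmod (f (hartogs_map v))) \<partial>bidisc_measure s)"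
  proof (rule nn_integral_mono_AE, use AE_bidisc_measure in eventually_elim)
    case (elim v)
    with \<open>fst u \<noteq> 0 \<and> _\<close> have "cmod (hartogs_kernel s (hartogs_map u) (hartogs_map v)) \<le> bidisc_majorant u v"
      by (intro hartogs_kernel_majorant) auto
    then show ?case by (auto simp: norm_mult intro!: ennreal_leI mult_right_mono)
  qed
  finally show ?case .
qed

text \<open>
  The test function \<open>schur_weight \<beta>\<close> needs \<open>s - 1 < \<beta> * e \<le> 1\<close> for both \<open>e = p\<close> and its conjugate
  exponent; the largest admissible \<open>\<beta>\<close> works exactly in the range of the theorem.
\<close>
lemma schur_bidisc:
  assumes p: "s < p" "p * (s - 1) < s"
  obtains A where "0 < A" "\<And>F T. F \<in> borel_measurable (borel \<Otimes>\<^sub>M borel) \<Longrightarrow> (\<And>v. 0 \<le> F v) \<Longrightarrow>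
    AE u in bidisc_measure s. 0 \<le> T u \<and> ennreal (T u) \<le> (\<integral>\<^sup>+v. ennreal (bidisc_majorant u v * F v) \<partial>bidisc_measure s) \<Longrightarrow>
    (\<integral>\<^sup>+u. ennreal (T u powr p) \<partial>bidisc_measure s) \<le> ennreal (A powr p) * (\<integral>\<^sup>+v. ennreal (F v powr p) \<partial>bidisc_measure s)"
proof -
  define q where "q = p / (p - 1)"
  define \<beta> where "\<beta> = 1 / max p q"
  have p1: "p > 1" using p s by simp
  have q1: "q > 1" and pq: "1/p + 1/q = 1"
    unfolding q_def using p1 by (simp_all add: field_simps)
  have b: "0 < \<beta>" using p1 by (simp add: \<beta>_def)
  have gam: "0 < \<beta> * p" "s - 1 < \<beta> * p" "\<beta> * p \<le> 1" "0 < \<beta> * q" "s - 1 < \<beta> * q" "\<beta> * q \<le> 1"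
  proof -
    show "0 < \<beta> * p" "0 < \<beta> * q" using b p1 q1 by auto
    show "\<beta> * p \<le> 1" "\<beta> * q \<le> 1" using p1 q1 by (auto simp: \<beta>_def max_def field_simps)
    \<comment> \<open>One of \<beta> p and \<beta> q equals 1, which exceeds s - 1. The other one is
      p - 1 or 1 / (p - 1), and these exceed s - 1 because of s < p and p (s - 1) < s
      respectively.\<close>
    have pq': "p / q = p - 1" "q / p = 1 / (p - 1)" using p1 by (auto simp: q_def)
    have "(s - 1) * (p - 1) < 1" using p by (simp add: algebra_simps)
    then have "s - 1 < 1 / (p - 1)" using p1 by (simp add: field_simps)
    then show "s - 1 < \<beta> * p" "s - 1 < \<beta> * q"
      using p s p1 q1 pq' by (auto simp: \<beta>_def max_def)
  qed
  obtain C1 where C1: "0 < C1" "AE u in bidisc_measure s.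
    (\<integral>\<^sup>+v. ennreal (bidisc_majorant u v * schur_weight (\<beta> * p) v) \<partial>bidisc_measure s) \<le> ennreal (C1 * schur_weight (\<beta> * p) u)"
    using schur_weight_estimate[OF gam(1,2,3)] .
  obtain C2 where C2: "0 < C2" "AE u in bidisc_measure s.
    (\<integral>\<^sup>+v. ennreal (bidisc_majorant u v * schur_weight (\<beta> * q) v) \<partial>bidisc_measure s) \<le> ennreal (C2 * schur_weight (\<beta> * q) u)"
    using schur_weight_estimate[OF gam(4,5,6)] .
  define A where "A = max C1 C2"
  have wint: "(\<integral>\<^sup>+v. ennreal (bidisc_majorant u v * schur_weight \<beta> v powr e) \<partial>bidisc_measure s) =
      (\<integral>\<^sup>+v. ennreal (bidisc_majorant u v * schur_weight (\<beta> * e) v) \<partial>bidisc_measure s)" for u e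
    by (rule nn_integral_cong_AE, use AE_bidisc_measure in eventually_elim) (simp add: schur_weight_powr)
  have "(\<integral>\<^sup>+u. ennreal (T u powr p) \<partial>bidisc_measure s) \<le> ennreal (A powr p) * (\<integral>\<^sup>+v. ennreal (F v powr p) \<partial>bidisc_measure s)"
    if [measurable]: "F \<in> borel_measurable (borel \<Otimes>\<^sub>M borel)" and F: "\<And>v. 0 \<le> F v" and
      "AE u in bidisc_measure s. 0 \<le> T u \<and> ennreal (T u) \<le> (\<integral>\<^sup>+v. ennreal (bidisc_majorant u v * F v) \<partial>bidisc_measure s)"
    for F T
  proof (rule schur_test[OF sigma_finite_bidisc_measure _ _ _ _ _ _ p1 q1 pq, where Q = bidisc_majorant and \<phi> = "schur_weight \<beta>"])
    show "AE v in bidisc_measure s. 0 < schur_weight \<beta> v"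
      using AE_bidisc_measure by eventually_elim (simp add: schur_weight_pos)
    show "AE x in bidisc_measure s. (\<integral>\<^sup>+y. ennreal (bidisc_majorant x y * schur_weight \<beta> y powr q) \<partial>bidisc_measure s) \<le> ennreal (A * schur_weight \<beta> x powr q)"
      using C2(2) AE_bidisc_measure
    proof eventually_elim
      case (elim u)
      have "ennreal (C2 * schur_weight (\<beta> * q) u) \<le> ennreal (A * schur_weight \<beta> u powr q)"
        using elim C1(1) by (intro ennreal_leI mult_mono) (auto simp: A_def schur_weight_powr le_max_iff_disj intro: less_imp_le[OF schur_weight_pos])
      with elim(1) show ?case unfolding wint by (rule order_trans)
    qed
    \<comment> \<open>Here the integration is over the first variable; the symmetry of the majorant
      reduces this to the same estimate.\<close>
    show "AE y in bidisc_measure s. (\<integral>\<^sup>+x. ennreal (bidisc_majorant x y * schur_weight \<beta> x powr p) \<partial>bidisc_measure s) \<le> ennreal (A * schur_weight \<beta> y powr p)"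
      using C1(2) AE_bidisc_measure
    proof eventually_elim
      case (elim u)
      have "ennreal (C1 * schur_weight (\<beta> * p) u) \<le> ennreal (A * schur_weight \<beta> u powr p)"
        using elim C1(1) by (intro ennreal_leI mult_mono) (auto simp: A_def schur_weight_powr le_max_iff_disj intro: less_imp_le[OF schur_weight_pos])
      with elim(1) show ?case unfolding bidisc_majorant_sym[of _ u] wint by (rule order_trans)
    qed
    show "AE u in bidisc_measure s. 0 \<le> T u \<and> ennreal (T u) \<le> (\<integral>\<^sup>+v. ennreal (bidisc_majorant u v * F v) \<partial>bidisc_measure s)"
      by fact
  qed (use C1 C2 in \<open>auto simp: A_def bidisc_majorant_nonneg F\<close>)
  moreover have "0 < A" using C1 by (simp add: A_def)
  ultimately show ?thesis by (intro that[of A]) auto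
qed

lemma hartogs_projection_Lp_bound:
  assumes p: "s < p" "p * (s - 1) < s"
  obtains A where "0 < A" "\<And>f. L2 f \<Longrightarrow>
    (\<integral>\<^sup>+z. ennreal (cmod (hartogs_projection f z) powr p) \<partial>W) \<le> ennreal (A powr p) * (\<integral>\<^sup>+z. ennreal (cmod (f z) powr p) \<partial>W)"
proof (rule schur_bidisc[OF p])
  fix A assume A: "0 < A" and schur: "\<And>F T. F \<in> borel_measurable (borel \<Otimes>\<^sub>M borel) \<Longrightarrow> (\<And>v. 0 \<le> F v) \<Longrightarrow>
    AE u in bidisc_measure s. 0 \<le> T u \<and> ennreal (T u) \<le> (\<integral>\<^sup>+v. ennreal (bidisc_majorant u v * F v) \<partial>bidisc_measure s) \<Longrightarrow>
    (\<integral>\<^sup>+u. ennreal (T u powr p) \<partial>bidisc_measure s) \<le> ennreal (A powr p) * (\<integral>\<^sup>+v. ennreal (F v powr p) \<partial>bidisc_measure s)"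
  have "(\<integral>\<^sup>+z. ennreal (cmod (hartogs_projection f z) powr p) \<partial>W) \<le> ennreal (A powr p) * (\<integral>\<^sup>+z. ennreal (cmod (f z) powr p) \<partial>W)" if f: "L2 f" for f
  proof -
    obtain f' where f' [measurable]: "f' \<in> borel_measurable borel" and ae: "AE z in W. f z = f' z"
      and L2': "L2 f'" and hp: "hartogs_projection f = hartogs_projection f'"
      using L2_borel[OF f] .
    have [measurable]: "hartogs_projection f' \<in> borel_measurable borel" by (rule hartogs_projection_borel) measurable
    have "(\<integral>\<^sup>+u. ennreal (cmod (hartogs_projection f' (hartogs_map u)) powr p) \<partial>bidisc_measure s) \<le>
      ennreal (A powr p) * (\<integral>\<^sup>+v. ennreal (cmod (f' (hartogs_map v)) powr p) \<partial>bidisc_measure s)"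
      using hartogs_projection_majorant[OF L2' f'] by (intro schur) auto
    also have "(\<integral>\<^sup>+v. ennreal (cmod (f' (hartogs_map v)) powr p) \<partial>bidisc_measure s) = (\<integral>\<^sup>+z. ennreal (cmod (f' z) powr p) \<partial>W)"
      by (rule nn_integral_W[symmetric]) measurable
    also have "\<dots> = (\<integral>\<^sup>+z. ennreal (cmod (f z) powr p) \<partial>W)"
      using ae by (intro nn_integral_cong_AE) (auto elim!: eventually_mono)
    also have "(\<integral>\<^sup>+u. ennreal (cmod (hartogs_projection f' (hartogs_map u)) powr p) \<partial>bidisc_measure s) = (\<integral>\<^sup>+z. ennreal (cmod (hartogs_projection f z) powr p) \<partial>W)"
      unfolding hp by (rule nn_integral_W[symmetric]) measurable
    finally show ?thesis .
  qed
  with A show ?thesis using that by blast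
qed

text \<open>The exponent 2 satisfies both conditions of the L^p bound: each of them amounts to s <
  2.\<close>

lemma hartogs_projection_L2:
  assumes f: "L2 f"
  shows "L2 (hartogs_projection f)"
proof -
  have "s < 2" "2 * (s - 1) < s" using s by auto
  then obtain A where A: "\<And>f. L2 f \<Longrightarrow>
    (\<integral>\<^sup>+z. ennreal (cmod (hartogs_projection f z) powr 2) \<partial>W) \<le> ennreal (A powr 2) * (\<integral>\<^sup>+z. ennreal (cmod (f z) powr 2) \<partial>W)"
    by (rule hartogs_projection_Lp_bound) blast
  obtain f' where f': "f' \<in> borel_measurable borel" "hartogs_projection f = hartogs_projection f'"
    using L2_borel[OF f] .
  then have "hartogs_projection f \<in> borel_measurable W"
    by (simp add: measurable_W hartogs_projection_borel)
  moreover have "(\<integral>\<^sup>+z. ennreal ((cmod (hartogs_projection f z))\<^sup>2) \<partial>W) < \<infinity>"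
    using A[OF f] f by (auto simp: L2_def ennreal_mult_less_top intro: le_less_trans)
  ultimately show ?thesis by (simp add: L2_def)
qed

end

section \<open>Holomorphy of the image of the kernel operator\<close>

definition disc_kernel' :: "real \<Rightarrow> complex \<Rightarrow> complex"
  where "disc_kernel' s x = 2 / (of_real pi * (1 - x) ^ 3) - of_real s / (2 * of_real pi * (1 - x)\<^sup>2)"

lemma disc_kernel_has_field_derivative:
  assumes "x \<noteq> 1"
  shows "(disc_kernel s has_field_derivative disc_kernel' s x) (at x)"
proof -
  have D: "((\<lambda>x. 2 * complex_of_real pi * (1 - x)\<^sup>2) has_field_derivative (- (4 * of_real pi * (1 - x)))) (at x)"
    by (rule derivative_eq_intros refl)+ (simp add: algebra_simps)
  have N: "((\<lambda>x. 2 - complex_of_real s * (1 - x)) has_field_derivative of_real s) (at x)"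
    by (rule derivative_eq_intros refl)+ simp
  have eq: "(t * (2 * p * y\<^sup>2) - (2 - t * y) * (- (4 * p * y))) / ((2 * p * y\<^sup>2) * (2 * p * y\<^sup>2)) =
      2 / (p * y ^ 3) - t / (2 * p * y\<^sup>2)" if "p \<noteq> 0" "y \<noteq> 0" for p t y :: complex
  proof -
    have "(t * (2 * p * y\<^sup>2) - (2 - t * y) * (- (4 * p * y))) = 2 * p * y * (4 - t * y)"
      by (simp add: algebra_simps power2_eq_square)
    moreover have "(2 * p * y\<^sup>2) * (2 * p * y\<^sup>2) = 2 * p * y * (2 * p * y ^ 3)"
      by (simp add: power2_eq_square power3_eq_cube)
    moreover have "2 / (p * y ^ 3) - t / (2 * p * y\<^sup>2) = (4 - t * y) / (2 * p * y ^ 3)"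
      using that by (simp add: diff_divide_distrib power2_eq_square power3_eq_cube mult.assoc)
    ultimately show ?thesis using that by simp
  qed
  have "((\<lambda>x. (2 - of_real s * (1 - x)) / (2 * of_real pi * (1 - x)\<^sup>2)) has_field_derivative
      (of_real s * (2 * of_real pi * (1 - x)\<^sup>2) - (2 - of_real s * (1 - x)) * (- (4 * of_real pi * (1 - x)))) /
      ((2 * of_real pi * (1 - x)\<^sup>2) * (2 * of_real pi * (1 - x)\<^sup>2))) (at x)"
    using assms by (intro DERIV_divide N D) simp
  then show ?thesis
    using assms unfolding disc_kernel_def[abs_def] disc_kernel'_def by (subst (asm) eq) auto
qed

lemma disc_kernel'_measurable [measurable]: "disc_kernel' s \<in> borel_measurable borel"
  unfolding disc_kernel'_def[abs_def] by measurable

lemma disc_kernel_continuous_on: "(\<And>x. x \<in> S \<Longrightarrow> g x \<noteq> 1) \<Longrightarrow> continuous_on S g \<Longrightarrow> continuous_on S (\<lambda>x. disc_kernel s (g x))"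
  and disc_kernel'_continuous_on: "(\<And>x. x \<in> S \<Longrightarrow> g x \<noteq> 1) \<Longrightarrow> continuous_on S g \<Longrightarrow> continuous_on S (\<lambda>x. disc_kernel' s (g x))"
  unfolding disc_kernel_def disc_kernel'_def by (auto intro!: continuous_intros)

text \<open>
  The partial derivatives in \<open>z\<close> of \<open>hartogs_kernel s z (hartogs_map v) / cnj (snd v)\<close>, where \<open>a = cnj (fst v)\<close>
  and \<open>b = cnj (snd v)\<close>.
\<close>
definition hartogs_kernel_D1 :: "real \<Rightarrow> complex ^ 2 \<Rightarrow> complex \<Rightarrow> complex \<Rightarrow> complex"
  where "hartogs_kernel_D1 s z a b = a * disc_kernel' 0 (z $ 1 / z $ 2 * a) * disc_kernel s (z $ 2 * b)"

definition hartogs_kernel_D2 :: "real \<Rightarrow> complex ^ 2 \<Rightarrow> complex \<Rightarrow> complex \<Rightarrow> complex"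
  where "hartogs_kernel_D2 s z a b = disc_kernel 0 (z $ 1 / z $ 2 * a) * disc_kernel s (z $ 2 * b)
    - z $ 1 / z $ 2 * a * disc_kernel' 0 (z $ 1 / z $ 2 * a) * disc_kernel s (z $ 2 * b)
    + z $ 2 * b * disc_kernel 0 (z $ 1 / z $ 2 * a) * disc_kernel' s (z $ 2 * b)"

lemma hartogs_args_neq_1:
  fixes z :: "complex ^ 2"
  assumes "z \<in> hartogs_triangle" "cmod a \<le> 1" "cmod b \<le> 1"
  shows "z $ 1 / z $ 2 * a \<noteq> 1" "z $ 2 * b \<noteq> 1"
  using one_minus_cnj_nonzero[of "z $ 1 / z $ 2" "cnj a"] one_minus_cnj_nonzero[of "z $ 2" "cnj b"]
    hartogs_triangleD[OF assms(1)] assms by auto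

lemma hartogs_kernel_has_derivative:
  assumes z: "z \<in> hartogs_triangle" and ab: "cmod a \<le> 1" "cmod b \<le> 1"
  shows "((\<lambda>z. z $ 2 * disc_kernel 0 (z $ 1 / z $ 2 * a) * disc_kernel s (z $ 2 * b)) has_derivative
    (\<lambda>h. hartogs_kernel_D1 s z a b * h $ 1 + hartogs_kernel_D2 s z a b * h $ 2)) (at z)"
proof -
  note zD = hartogs_triangleD[OF z] and ne = hartogs_args_neq_1[OF z ab]
  have nth: "((\<lambda>z :: complex ^ 2. z $ i) has_derivative (\<lambda>h. h $ i)) (at z)" for i
    by (rule bounded_linear_imp_has_derivative[OF bounded_linear_vec_nth])
  have "((\<lambda>z. z $ 1 / z $ 2 * a) has_derivative (\<lambda>h. (h $ 1 * z $ 2 - z $ 1 * h $ 2) / (z $ 2 * z $ 2) * a)) (at z)"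
    by (intro has_derivative_mult_left has_derivative_divide' nth zD)
  from has_derivative_compose[OF this disc_kernel_has_field_derivative[OF ne(1), THEN has_field_derivative_imp_has_derivative], of 0]
  have 1: "((\<lambda>z. disc_kernel 0 (z $ 1 / z $ 2 * a)) has_derivative (\<lambda>h. disc_kernel' 0 (z $ 1 / z $ 2 * a) * ((h $ 1 * z $ 2 - z $ 1 * h $ 2) / (z $ 2 * z $ 2) * a))) (at z)" .
  have "((\<lambda>z :: complex ^ 2. z $ 2 * b) has_derivative (\<lambda>h. h $ 2 * b)) (at z)"
    by (intro has_derivative_mult_left nth)
  from has_derivative_compose[OF this disc_kernel_has_field_derivative[OF ne(2), THEN has_field_derivative_imp_has_derivative], of s]
  have 2: "((\<lambda>z. disc_kernel s (z $ 2 * b)) has_derivative (\<lambda>h. disc_kernel' s (z $ 2 * b) * (h $ 2 * b))) (at z)" .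
  have eq: "x * k0 * (ks' * (h2 * b)) + (x * (k0' * ((h1 * x - y * h2) / (x * x) * a)) + h2 * k0) * ks =
    (a * k0' * ks) * h1 + (k0 * ks - y / x * a * k0' * ks + x * b * k0 * ks') * h2"
    if "x \<noteq> 0" for x y k0 h2 ks' h1 k0' ks
    using that by (simp add: field_simps)
  show ?thesis
    using has_derivative_mult[OF has_derivative_mult[OF nth[of 2] 1] 2]
    by (simp only: hartogs_kernel_D1_def hartogs_kernel_D2_def eq[OF zD(1)])
qed

text \<open>Treating a and b as independent variables in the closed disc makes the domain compact.
  The denominators do not vanish on it, since |z1 / z2| < 1 and |z2| < 1 on the triangle. The bound
  is therefore uniform in the variable of integration.\<close>

lemma hartogs_kernel_D_bounded:
  assumes K: "compact K" "K \<subseteq> hartogs_triangle"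
  obtains C where "\<And>z a b. z \<in> K \<Longrightarrow> cmod a \<le> 1 \<Longrightarrow> cmod b \<le> 1 \<Longrightarrow> cmod (hartogs_kernel_D1 s z a b) \<le> C \<and> cmod (hartogs_kernel_D2 s z a b) \<le> C"
proof -
  define S where "S = K \<times> (cball (0::complex) 1 \<times> cball (0::complex) 1)"
  have S: "compact S" unfolding S_def by (intro compact_Times K compact_cball)
  have ne: "fst p $ 2 \<noteq> 0" "fst p $ 1 / fst p $ 2 * fst (snd p) \<noteq> 1" "fst p $ 2 * snd (snd p) \<noteq> 1" if "p \<in> S" for p :: "(complex ^ 2) \<times> complex \<times> complex"
    using that K(2) hartogs_triangleD[of "fst p"] hartogs_args_neq_1[of "fst p" "fst (snd p)" "snd (snd p)"]
    by (auto simp: S_def)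
  have "continuous_on S (\<lambda>p. hartogs_kernel_D1 s (fst p) (fst (snd p)) (snd (snd p)))"
    "continuous_on S (\<lambda>p. hartogs_kernel_D2 s (fst p) (fst (snd p)) (snd (snd p)))"
    unfolding hartogs_kernel_D1_def hartogs_kernel_D2_def using ne by (intro continuous_intros disc_kernel_continuous_on disc_kernel'_continuous_on; simp)+
  then have "bounded ((\<lambda>p. hartogs_kernel_D1 s (fst p) (fst (snd p)) (snd (snd p))) ` S)"
    "bounded ((\<lambda>p. hartogs_kernel_D2 s (fst p) (fst (snd p)) (snd (snd p))) ` S)"
    using S by (blast intro: compact_imp_bounded compact_continuous_image)+
  then obtain C1 C2 where C: "\<forall>p\<in>S. cmod (hartogs_kernel_D1 s (fst p) (fst (snd p)) (snd (snd p))) \<le> C1"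
    "\<forall>p\<in>S. cmod (hartogs_kernel_D2 s (fst p) (fst (snd p)) (snd (snd p))) \<le> C2"
    unfolding bounded_iff ball_simps by blast
  show ?thesis
  proof (rule that[of "max C1 C2"])
    fix z a b assume "z \<in> K" "cmod a \<le> 1" "cmod b \<le> 1"
    then have "(z, a, b) \<in> S" by (simp add: S_def)
    from bspec[OF C(1) this] bspec[OF C(2) this] show "cmod (hartogs_kernel_D1 s z a b) \<le> max C1 C2 \<and> cmod (hartogs_kernel_D2 s z a b) \<le> max C1 C2"
      by (simp add: le_max_iff_disj)
  qed
qed

context hartogs_weight
begin

text \<open>Differentiation under the integral sign. The dominating function is a multiple of |v2|
  |f|, which is integrable as a product of two square-integrable functions.\<close>

lemma hartogs_projection_holomorphic:
  assumes f: "L2 f"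
  shows "holomorphic_Cn_on (hartogs_projection f) hartogs_triangle"
  unfolding holomorphic_Cn_on_def
proof
  fix z0 assume z0: "z0 \<in> hartogs_triangle"
  obtain f' where f' [measurable]: "f' \<in> borel_measurable borel" and L2': "L2 f'" and hp: "hartogs_projection f = hartogs_projection f'"
    by (rule L2_borel[OF f]) blast
  obtain \<delta> where \<delta>: "0 < \<delta>" "cball z0 \<delta> \<subseteq> hartogs_triangle"
    using open_contains_cball open_hartogs_triangle z0 by blast
  then have sub: "ball z0 \<delta> \<subseteq> hartogs_triangle" by auto
  obtain C where C: "\<And>z a b. z \<in> cball z0 \<delta> \<Longrightarrow> cmod a \<le> 1 \<Longrightarrow> cmod b \<le> 1 \<Longrightarrow> cmod (hartogs_kernel_D1 s z a b) \<le> C \<and> cmod (hartogs_kernel_D2 s z a b) \<le> C"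
    by (rule hartogs_kernel_D_bounded[where s = s, OF compact_cball \<delta>(2)]) blast
  define G where "G v = cnj (snd v) * f' (hartogs_map v)" for v
  define L where "L z v h = (hartogs_kernel_D1 s z (cnj (fst v)) (cnj (snd v)) * h $ 1 + hartogs_kernel_D2 s z (cnj (fst v)) (cnj (snd v)) * h $ 2) * G v"
    for z :: "complex ^ 2" and v and h :: "complex ^ 2"
  have [measurable]: "G \<in> borel_measurable (borel \<Otimes>\<^sub>M borel)" unfolding G_def[abs_def] by measurable
  have "(\<integral>\<^sup>+z. ennreal ((cmod (cnj (z $ 2)))\<^sup>2) \<partial>W) < \<infinity>"
    using nn_integral_W_snd_powr[of 2] s by simp
  then have "L2 (\<lambda>z. cnj (z $ 2))"
    unfolding L2_def by (auto intro!: measurable_W)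
  from L2_mult_integrable[OF this L2'] have "integrable (bidisc_measure s) G"
    by (subst (asm) integrable_W) (auto simp: G_def[abs_def])
  then have intG: "integrable (bidisc_measure s) (\<lambda>v. 2 * C * norm (G v))" by auto
  have der: "((\<lambda>z. \<integral>v. hartogs_kernel s z (hartogs_map v) * f' (hartogs_map v) \<partial>bidisc_measure s) has_derivative
      (\<lambda>h. \<integral>v. L z0 v h \<partial>bidisc_measure s)) (at z0)"
  proof (rule has_derivative_integral_param[OF \<delta>(1) _ _ _ intG])
    fix z assume "z \<in> ball z0 \<delta>"
    then have "z \<in> hartogs_triangle" using sub by auto
    from L2_mult_integrable[OF L2_hartogs_kernel[OF this] L2']
    show "integrable (bidisc_measure s) (\<lambda>v. hartogs_kernel s z (hartogs_map v) * f' (hartogs_map v))"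
      by (subst (asm) integrable_W) auto
  next
    show "AE v in bidisc_measure s. \<forall>z\<in>ball z0 \<delta>. ((\<lambda>z. hartogs_kernel s z (hartogs_map v) * f' (hartogs_map v)) has_derivative L z v) (at z)"
      using AE_bidisc_measure
    proof eventually_elim
      case (elim v)
      have eq: "(\<lambda>z. hartogs_kernel s z (hartogs_map v) * f' (hartogs_map v)) =
         (\<lambda>z. z $ 2 * disc_kernel 0 (z $ 1 / z $ 2 * cnj (fst v)) * disc_kernel s (z $ 2 * cnj (snd v)) * G v)"
        using elim by (simp add: fun_eq_iff hartogs_kernel_map G_def mult_ac)
      show ?case
        unfolding eq L_def[abs_def] using elim sub
        by (intro ballI has_derivative_mult_left hartogs_kernel_has_derivative) auto
    qed
    show "AE v in bidisc_measure s. \<forall>z\<in>ball z0 \<delta>. \<forall>h. norm (L z v h) \<le> 2 * C * norm (G v) * norm h"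
      using AE_bidisc_measure
    proof (eventually_elim, intro ballI allI)
      fix v z and h :: "complex ^ 2" assume v: "fst v \<noteq> 0 \<and> cmod (fst v) < 1 \<and> snd v \<noteq> 0 \<and> cmod (snd v) < 1" and z: "z \<in> ball z0 \<delta>"
      have CC: "cmod (hartogs_kernel_D1 s z (cnj (fst v)) (cnj (snd v))) \<le> C" "cmod (hartogs_kernel_D2 s z (cnj (fst v)) (cnj (snd v))) \<le> C"
        using C[of z "cnj (fst v)" "cnj (snd v)"] v z by auto
      have C0: "0 \<le> C" using order_trans[OF norm_ge_zero CC(1)] .
      have "norm (hartogs_kernel_D1 s z (cnj (fst v)) (cnj (snd v)) * h $ 1 + hartogs_kernel_D2 s z (cnj (fst v)) (cnj (snd v)) * h $ 2)
         \<le> C * norm h + C * norm h"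
        using CC C0 Finite_Cartesian_Product.norm_nth_le[of h] by (intro order_trans[OF norm_triangle_ineq] add_mono) (auto simp: norm_mult intro!: mult_mono)
      then have "norm (L z v h) \<le> (C * norm h + C * norm h) * norm (G v)"
        unfolding L_def norm_mult by (rule mult_right_mono) simp
      then show "norm (L z v h) \<le> 2 * C * norm (G v) * norm h"
        by (simp add: algebra_simps)
    qed
    show "(\<lambda>v. L z0 v h) \<in> borel_measurable (bidisc_measure s)" for h
      unfolding L_def hartogs_kernel_D1_def hartogs_kernel_D2_def by measurable
  qed
  have "(hartogs_projection f has_derivative (\<lambda>h. \<integral>v. L z0 v h \<partial>bidisc_measure s)) (at z0 within hartogs_triangle)"
  proof (rule has_derivative_transform[OF z0])
    show "((\<lambda>z. \<integral>v. hartogs_kernel s z (hartogs_map v) * f' (hartogs_map v) \<partial>bidisc_measure s) has_derivative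
      (\<lambda>h. \<integral>v. L z0 v h \<partial>bidisc_measure s)) (at z0 within hartogs_triangle)"
      using der by (rule has_derivative_at_withinI)
  qed (simp add: hp hartogs_projection_bidisc)
  \<comment> \<open>Complex linearity passes from the derivative of the kernel to its
    integral.\<close>
  moreover have "(\<integral>v. L z0 v (c *s h) \<partial>bidisc_measure s) = c * (\<integral>v. L z0 v h \<partial>bidisc_measure s)" for c h
    by (subst integral_mult_right_zero[symmetric]) (simp add: L_def algebra_simps)
  ultimately show "\<exists>L. (hartogs_projection f has_derivative L) (at z0 within hartogs_triangle) \<and> (\<forall>c v. L (c *s v) = c * L v)"
    by blast
qed

end

section \<open>Orthogonality\<close>

lemma nn_integral_disc_1_finite:
  assumes "a < 2"
  shows "(\<integral>\<^sup>+w. 1 \<partial>disc_measure a) < \<infinity>"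
proof -
  have "(\<integral>\<^sup>+w. 1 \<partial>disc_measure a) = (\<integral>\<^sup>+w. ennreal (cmod w powr 0) \<partial>disc_measure a)"
    by (rule nn_integral_cong_AE, use AE_disc_measure in eventually_elim) auto
  also have "\<dots> < \<infinity>" using assms by (subst nn_integral_disc_powr) auto
  finally show ?thesis .
qed

text \<open>For a < 2 the disc has finite mass, and |f| \<le> 1 + |f|^2.\<close>

lemma integrable_disc_square:
  fixes f :: "complex \<Rightarrow> complex"
  assumes [measurable]: "f \<in> borel_measurable borel"
    and a: "a < 2" and fin: "(\<integral>\<^sup>+w. ennreal ((cmod (f w))\<^sup>2) \<partial>disc_measure a) < \<infinity>"
  shows "integrable (disc_measure a) f"
proof (rule integrableI_bounded)
  have "(\<integral>\<^sup>+w. ennreal (norm (f w)) \<partial>disc_measure a) \<le> (\<integral>\<^sup>+w. 1 + ennreal ((cmod (f w))\<^sup>2) \<partial>disc_measure a)"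
  proof (rule nn_integral_mono)
    fix w
    have "0 \<le> (cmod (f w) - 1)\<^sup>2" by simp
    moreover have "(cmod (f w) - 1)\<^sup>2 = (cmod (f w))\<^sup>2 + 1 - 2 * cmod (f w)"
      by (simp add: power2_diff)
    ultimately have "norm (f w) \<le> 1 + (cmod (f w))\<^sup>2"
      using norm_ge_zero[of "f w"] by linarith
    then have "ennreal (norm (f w)) \<le> ennreal (1 + (cmod (f w))\<^sup>2)" by (rule ennreal_leI)
    then show "ennreal (norm (f w)) \<le> 1 + ennreal ((cmod (f w))\<^sup>2)" by simp
  qed
  also have "\<dots> < \<infinity>"
    using nn_integral_disc_1_finite[OF a] fin by (subst nn_integral_add) auto
  finally show "(\<integral>\<^sup>+w. ennreal (norm (f w)) \<partial>disc_measure a) < \<infinity>" .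
qed simp

text \<open>The reproducing formula with s = 0 at the centre, where the kernel is the constant 1 /
  pi, is applied to the square of g rescaled to the unit disc. The strict inequality r < R makes
  this square bounded, hence integrable.\<close>

lemma mean_value_square:
  assumes hol: "g holomorphic_on ball c R" and r: "0 < r" "r < R"
  shows "ennreal (pi * r\<^sup>2 * (cmod (g c))\<^sup>2) \<le> (\<integral>\<^sup>+w. ennreal ((cmod (g w))\<^sup>2) * indicator (ball c r) w \<partial>lborel)"
proof -
  \<comment> \<open>Setting the function to 0 outside the disc makes it Borel measurable on the
    whole plane; the values of g off its domain are arbitrary.\<close>
  define \<phi> where "\<phi> w = (if w \<in> ball 0 1 then (g (c + of_real r * w))\<^sup>2 else 0)" for w
  have sub: "c + of_real r * w \<in> ball c R" if "cmod w \<le> 1" for w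
  proof -
    have "r * cmod w \<le> r" using that r mult_left_mono[of "cmod w" 1 r] by simp
    also have "\<dots> < R" by (rule r)
    finally show ?thesis using r by (simp add: dist_norm norm_mult)
  qed
  have contg: "continuous_on (cball 0 1) (\<lambda>w. (g (c + of_real r * w))\<^sup>2)"
    using sub by (intro continuous_intros continuous_on_compose2[OF holomorphic_on_imp_continuous_on[OF hol]]) auto
  have hol\<phi>: "\<phi> holomorphic_on ball 0 1"
  proof (rule holomorphic_transform)
    show "(\<lambda>w. (g (c + of_real r * w))\<^sup>2) holomorphic_on ball 0 1"
      using sub by (intro holomorphic_intros holomorphic_on_compose_gen[OF _ hol, unfolded o_def]) auto
  qed (simp add: \<phi>_def)
  have \<phi>m [measurable]: "\<phi> \<in> borel_measurable borel"
  proof -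
    have "(\<lambda>w. indicator (ball 0 1) w *\<^sub>R (g (c + of_real r * w))\<^sup>2) \<in> borel_measurable borel"
      using contg by (intro borel_measurable_continuous_on_indicator) (auto intro: continuous_on_subset)
    moreover have "(\<lambda>w. indicator (ball 0 1) w *\<^sub>R (g (c + of_real r * w))\<^sup>2) = \<phi>"
      by (auto simp: \<phi>_def indicator_def)
    ultimately show ?thesis by simp
  qed
  have "bounded ((\<lambda>w. (g (c + of_real r * w))\<^sup>2) ` cball 0 1)"
    using contg by (intro compact_imp_bounded compact_continuous_image) auto
  then obtain B where B: "\<forall>w\<in>cball 0 1. norm ((g (c + of_real r * w))\<^sup>2) \<le> B"
    unfolding bounded_iff ball_simps by blast
  have int: "integrable (disc_measure 0) \<phi>"
  proof (rule integrableI_bounded)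
    have "(\<integral>\<^sup>+w. ennreal (norm (\<phi> w)) \<partial>disc_measure 0) \<le> (\<integral>\<^sup>+w. ennreal \<bar>B\<bar> * 1 \<partial>disc_measure 0)"
      using B by (intro nn_integral_mono) (auto simp: \<phi>_def intro!: ennreal_leI order_trans[OF _ abs_ge_self])
    also have "\<dots> < \<infinity>"
      using nn_integral_disc_1_finite[of 0] by (subst nn_integral_cmult) (auto simp: ennreal_mult_less_top)
    finally show "(\<integral>\<^sup>+w. ennreal (norm (\<phi> w)) \<partial>disc_measure 0) < \<infinity>" .
  qed simp
  have "(\<integral>w. disc_kernel 0 (0 * cnj w) * \<phi> w \<partial>disc_measure 0) = \<phi> 0"
    by (rule disc_reproducing[OF hol\<phi> int]) auto
  then have "(\<integral>w. \<phi> w \<partial>disc_measure 0) = of_real pi * (g c)\<^sup>2"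
    by (simp add: disc_kernel_def \<phi>_def field_simps)
  then have "ennreal (pi * (cmod (g c))\<^sup>2) = ennreal (norm (\<integral>w. \<phi> w \<partial>disc_measure 0))"
    by (simp add: norm_mult norm_power)
  also have "\<dots> \<le> (\<integral>\<^sup>+w. ennreal (norm (\<phi> w)) \<partial>disc_measure 0)"
    by (rule integral_norm_bound_ennreal[OF int])
  also have "\<dots> = (\<integral>\<^sup>+w. ennreal (norm (\<phi> w)) \<partial>lborel)"
  proof -
    have [measurable]: "(ball 0 1 :: complex set) \<in> sets borel" by simp
    have "(\<integral>\<^sup>+w. ennreal (norm (\<phi> w)) \<partial>disc_measure 0) = (\<integral>\<^sup>+w. ennreal (indicator (ball 0 1) w * cmod w powr (- 0)) * ennreal (norm (\<phi> w)) \<partial>lborel)"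
      unfolding disc_measure_def by (rule nn_integral_density) measurable
    also have "\<dots> = (\<integral>\<^sup>+w. ennreal (norm (\<phi> w)) \<partial>lborel)"
      by (rule nn_integral_cong_AE, use AE_lborel_singleton[of 0] in eventually_elim) (auto simp: \<phi>_def)
    finally show ?thesis .
  qed
  finally have le: "ennreal (pi * (cmod (g c))\<^sup>2) \<le> (\<integral>\<^sup>+w. ennreal (norm (\<phi> w)) \<partial>lborel)" .
  define \<psi> where "\<psi> w = ennreal ((cmod (g w))\<^sup>2) * indicator (ball c r) w" for w
  have \<psi>m: "\<psi> \<in> borel_measurable borel"
  proof -
    have "(\<lambda>w. indicator (ball c r) w *\<^sub>R g w) \<in> borel_measurable borel"
      using r holomorphic_on_imp_continuous_on[OF hol]
      by (intro borel_measurable_continuous_on_indicator) (auto intro: continuous_on_subset)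
    then have [measurable]: "(\<lambda>w. ennreal ((cmod (indicator (ball c r) w *\<^sub>R g w))\<^sup>2)) \<in> borel_measurable borel"
      by measurable
    have "(\<lambda>w. ennreal ((cmod (indicator (ball c r) w *\<^sub>R g w))\<^sup>2)) = \<psi>"
      by (auto simp: \<psi>_def indicator_def)
    then show ?thesis using \<open>(\<lambda>w. ennreal _) \<in> _\<close> by simp
  qed
  have "(\<integral>\<^sup>+w. \<psi> w \<partial>lborel) = (\<integral>\<^sup>+w. \<psi> w \<partial>distr lborel borel ((+) c))"
    by (simp only: lborel_distr_plus)
  also have "\<dots> = (\<integral>\<^sup>+w. \<psi> (c + w) \<partial>lborel)"
    using \<psi>m by (intro nn_integral_distr) auto
  also have "\<dots> = ennreal ((cmod (of_real r))\<^sup>2) * (\<integral>\<^sup>+w. \<psi> (c + of_real r * w) \<partial>lborel)"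
    using \<psi>m r by (intro nn_integral_complex_cmult) auto
  also have "(\<lambda>w. \<psi> (c + of_real r * w)) = (\<lambda>w. ennreal (norm (\<phi> w)))"
  proof
    fix w
    have "c + of_real r * w \<in> ball c r \<longleftrightarrow> w \<in> ball 0 1"
      using r by (auto simp: dist_norm norm_mult)
    then show "\<psi> (c + of_real r * w) = ennreal (norm (\<phi> w))"
      by (simp add: \<psi>_def \<phi>_def indicator_def norm_power del: mem_ball)
  qed
  finally have "(\<integral>\<^sup>+w. \<psi> w \<partial>lborel) = ennreal (r\<^sup>2) * (\<integral>\<^sup>+w. ennreal (norm (\<phi> w)) \<partial>lborel)"
    by simp
  moreover have "ennreal (pi * r\<^sup>2 * (cmod (g c))\<^sup>2) = ennreal (r\<^sup>2) * ennreal (pi * (cmod (g c))\<^sup>2)"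
    by (simp add: mult_ac flip: ennreal_mult)
  ultimately show ?thesis
    using le unfolding \<psi>_def by (simp add: mult_left_mono)
qed

text \<open>The mean value inequality on the ball of radius |c| / 2 about c. There |w| \<le> 2 |c| <
  1, so the weight |w|^(-(s+2)) is at least (2 |c|)^(-(s+2)), and the unweighted integral is bounded
  by the weighted one.\<close>

lemma punctured_square_bound:
  assumes hol: "g holomorphic_on ball 0 1 - {0}" and [measurable]: "g \<in> borel_measurable borel"
    and I: "(\<integral>\<^sup>+w. ennreal ((cmod (g w))\<^sup>2) \<partial>disc_measure (s + 2)) = ennreal I" "0 \<le> I"
    and s: "0 \<le> s" and c: "c \<noteq> 0" "cmod c < 1/2"
  shows "pi * (cmod c / 2)\<^sup>2 * (cmod (g c))\<^sup>2 \<le> (2 * cmod c) powr (s + 2) * I"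
proof -
  have [measurable]: "(ball 0 1 :: complex set) \<in> sets borel" "ball c (cmod c / 2) \<in> sets borel" by simp_all
  have "g holomorphic_on ball c (cmod c)"
  proof (rule holomorphic_on_subset[OF hol])
    show "ball c (cmod c) \<subseteq> ball 0 1 - {0}"
    proof
      fix w assume w: "w \<in> ball c (cmod c)"
      then have "cmod (w - c) < cmod c" by (simp add: dist_norm norm_minus_commute)
      moreover have "cmod w \<le> cmod (w - c) + cmod c" using norm_triangle_ineq[of "w - c" c] by simp
      ultimately show "w \<in> ball 0 1 - {0}" using c w by auto
    qed
  qed
  then have "ennreal (pi * (cmod c / 2)\<^sup>2 * (cmod (g c))\<^sup>2) \<le>
      (\<integral>\<^sup>+w. ennreal ((cmod (g w))\<^sup>2) * indicator (ball c (cmod c / 2)) w \<partial>lborel)"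
    using c by (intro mean_value_square) auto
  also have "\<dots> \<le> (\<integral>\<^sup>+w. ennreal ((2 * cmod c) powr (s + 2)) *
      (ennreal (indicator (ball 0 1) w * cmod w powr (- (s + 2))) * ennreal ((cmod (g w))\<^sup>2)) \<partial>lborel)"
  proof (rule nn_integral_mono)
    fix w
    show "ennreal ((cmod (g w))\<^sup>2) * indicator (ball c (cmod c / 2)) w \<le> ennreal ((2 * cmod c) powr (s + 2)) *
      (ennreal (indicator (ball 0 1) w * cmod w powr (- (s + 2))) * ennreal ((cmod (g w))\<^sup>2))"
    proof (cases "w \<in> ball c (cmod c / 2)")
      case True
      then have d: "cmod (w - c) < cmod c / 2" by (simp add: dist_norm norm_minus_commute)
      have w: "cmod w \<le> cmod (w - c) + cmod c" "cmod c \<le> cmod w + cmod (w - c)"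
        using norm_triangle_ineq[of "w - c" c] norm_triangle_ineq4[of w "w - c"] by simp_all
      have w0: "0 < cmod w" "cmod w \<le> 2 * cmod c" "cmod w < 1" using w d c by linarith+
      have "1 = cmod w powr (s + 2) * cmod w powr (- (s + 2))"
        using w0 by (simp flip: powr_add)
      also have "\<dots> \<le> (2 * cmod c) powr (s + 2) * cmod w powr (- (s + 2))"
        using w0 s by (intro mult_right_mono powr_mono2) auto
      finally have "1 * (cmod (g w))\<^sup>2 \<le> (2 * cmod c) powr (s + 2) * cmod w powr (- (s + 2)) * (cmod (g w))\<^sup>2"
        by (rule mult_right_mono) simp
      then show ?thesis
        using True w0 by (simp add: ennreal_leI mult.assoc flip: ennreal_mult)
    qed simp
  qed
  also have "\<dots> = ennreal ((2 * cmod c) powr (s + 2)) *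
      (\<integral>\<^sup>+w. ennreal (indicator (ball 0 1) w * cmod w powr (- (s + 2))) * ennreal ((cmod (g w))\<^sup>2) \<partial>lborel)"
    by (rule nn_integral_cmult) measurable
  also have "(\<integral>\<^sup>+w. ennreal (indicator (ball 0 1) w * cmod w powr (- (s + 2))) * ennreal ((cmod (g w))\<^sup>2) \<partial>lborel) = ennreal I"
    unfolding I(1)[symmetric] disc_measure_def by (rule nn_integral_density[symmetric]) measurable
  also have "ennreal ((2 * cmod c) powr (s + 2)) * ennreal I = ennreal ((2 * cmod c) powr (s + 2) * I)"
    using I(2) by (simp add: ennreal_mult)
  finally show ?thesis using I(2) by (subst (asm) ennreal_le_iff) auto
qed

text \<open>The preceding bound gives |g w|^2 = O(|w|^s), so g tends to 0 at the origin. That is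
  Riemann's criterion, w times the function tends to 0, for the removability of the singularity of g
  w / w.\<close>

lemma punctured_extend:
  assumes hol: "g holomorphic_on ball 0 1 - {0}" and g: "g \<in> borel_measurable borel"
    and fin: "(\<integral>\<^sup>+w. ennreal ((cmod (g w))\<^sup>2) \<partial>disc_measure (s + 2)) < \<infinity>" and s: "0 < s"
  obtains G where "G holomorphic_on ball 0 1" "\<And>w. w \<in> ball 0 1 - {0} \<Longrightarrow> G w = g w / w"
proof -
  obtain I where I: "(\<integral>\<^sup>+w. ennreal ((cmod (g w))\<^sup>2) \<partial>disc_measure (s + 2)) = ennreal I" "0 \<le> I"
    using fin by (cases "\<integral>\<^sup>+w. ennreal ((cmod (g w))\<^sup>2) \<partial>disc_measure (s + 2)") auto
  \<comment> \<open>Solving the bound of \<open>punctured_square_bound\<close> for |g c|^2 gives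
    this factor in front of |c|^s.\<close>
  define B where "B = 2 powr (s + 2) * I * 4 / pi"
  have bound: "(cmod (g c))\<^sup>2 \<le> B * cmod c powr s" if "c \<noteq> 0" "cmod c < 1/2" for c
  proof -
    have "pi * (cmod c / 2)\<^sup>2 * (cmod (g c))\<^sup>2 \<le> (2 * cmod c) powr (s + 2) * I"
      using s that by (intro punctured_square_bound[OF hol g I]) auto
    also have "\<dots> = (pi * (cmod c / 2)\<^sup>2) * (B * cmod c powr s)"
      using that by (simp add: B_def powr_mult powr_add power_divide)
    finally show ?thesis using that by (subst (asm) mult_le_cancel_left_pos) auto
  qed
  have "((\<lambda>w. (cmod (g w))\<^sup>2) \<longlongrightarrow> 0) (at 0)"
  proof (rule Lim_null_comparison)
    have "\<forall>\<^sub>F w in at (0::complex). w \<noteq> 0 \<and> cmod w < 1/2"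
      unfolding eventually_at by (intro exI[of _ "1/2"]) auto
    then show "\<forall>\<^sub>F w in at 0. norm ((cmod (g w))\<^sup>2) \<le> B * cmod w powr s"
      by eventually_elim (use bound in auto)
    have "((\<lambda>w::complex. B * cmod w powr s) \<longlongrightarrow> B * 0 powr s) (at 0)"
      using s by (intro tendsto_intros tendsto_powr2) (auto intro!: tendsto_eq_intros)
    then show "((\<lambda>w::complex. B * cmod w powr s) \<longlongrightarrow> 0) (at 0)" using s by simp
  qed
  then have "((\<lambda>w. sqrt ((cmod (g w))\<^sup>2)) \<longlongrightarrow> sqrt 0) (at 0)" by (intro tendsto_intros)
  then have "(g \<longlongrightarrow> 0) (at 0)" by (simp add: tendsto_norm_zero_iff)
  moreover have "\<forall>\<^sub>F w in at 0. g w = (w - 0) * (g w / w)"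
    unfolding eventually_at by (intro exI[of _ 1]) auto
  ultimately have lim: "((\<lambda>w. (w - 0) * (g w / w)) \<longlongrightarrow> 0) (at 0)"
    by (rule Lim_transform_eventually)
  have "(\<lambda>w. g w / w) holomorphic_on ball 0 1 - {0}"
    using hol by (auto intro!: holomorphic_intros)
  then have "\<exists>G. G holomorphic_on ball 0 1 \<and> (\<forall>w\<in>ball 0 1 - {0}. G w = g w / w)"
    using lim by (subst holomorphic_on_extend_lim) auto
  then show ?thesis using that by blast
qed

text \<open>With g w = w G w one has |w|^(-(s+2)) cnj w g w = |w|^(-s) G w. The integral is thus z
  times the reproducing integral of G for the weight |w|^(-s), that is z G z = g z. The same
  identity for squared moduli shows that G is square-integrable.\<close>

lemma punctured_reproducing:
  assumes hol: "g holomorphic_on ball 0 1 - {0}" and g [measurable]: "g \<in> borel_measurable borel"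
    and fin: "(\<integral>\<^sup>+w. ennreal ((cmod (g w))\<^sup>2) \<partial>disc_measure (s + 2)) < \<infinity>"
    and s: "0 < s" "s < 2" and z: "z \<noteq> 0" "cmod z < 1"
  shows "(\<integral>w. z * cnj w * disc_kernel s (z * cnj w) * g w \<partial>disc_measure (s + 2)) = g z"
proof -
  obtain G where G: "G holomorphic_on ball 0 1" "\<And>w. w \<in> ball 0 1 - {0} \<Longrightarrow> G w = g w / w"
    by (rule punctured_extend[OF hol g fin s(1)]) blast
  have [measurable]: "(ball 0 1 :: complex set) \<in> sets borel" by simp
  \<comment> \<open>\<open>G\<close> is known on the disc only; cutting it off there makes it Borel
    measurable.\<close>
  define G' where "G' w = (if w \<in> ball 0 1 then G w else 0)" for w
  have [measurable]: "G' \<in> borel_measurable borel"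
  proof -
    have "(\<lambda>w. indicator (ball 0 1) w *\<^sub>R G w) \<in> borel_measurable borel"
      using holomorphic_on_imp_continuous_on[OF G(1)] by (intro borel_measurable_continuous_on_indicator) auto
    moreover have "(\<lambda>w. indicator (ball 0 1) w *\<^sub>R G w) = G'" by (auto simp: G'_def indicator_def)
    ultimately show ?thesis by simp
  qed
  have hol': "G' holomorphic_on ball 0 1"
    by (rule holomorphic_transform[OF G(1)]) (simp add: G'_def)
  have Gg: "G' w = g w / w" if "w \<noteq> 0" "cmod w < 1" for w
    using G(2)[of w] that by (simp add: G'_def)
  have pw: "cmod w powr (- (s + 2)) * (cmod w)\<^sup>2 = cmod w powr (- s)" if "w \<noteq> 0" for w :: complex
  proof -
    have "- s = - (s + 2) + 2" by simp
    then show ?thesis using that by (simp only: powr_add) simp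
  qed
  have "(\<integral>\<^sup>+w. ennreal ((cmod (G' w))\<^sup>2) \<partial>disc_measure s) = (\<integral>\<^sup>+w. ennreal (indicator (ball 0 1) w * cmod w powr (- s)) * ennreal ((cmod (G' w))\<^sup>2) \<partial>lborel)"
    unfolding disc_measure_def by (rule nn_integral_density) measurable
  also have "\<dots> = (\<integral>\<^sup>+w. ennreal (indicator (ball 0 1) w * cmod w powr (- (s + 2))) * ennreal ((cmod (g w))\<^sup>2) \<partial>lborel)"
  proof (rule nn_integral_cong_AE, use AE_lborel_singleton[of 0] in eventually_elim)
    case (elim w)
    show ?case
    proof (cases "w \<in> ball 0 1")
      case True
      then have gw: "g w = w * G' w" using Gg[OF elim] elim by simp
      have "cmod w powr (- s) * (cmod (G' w))\<^sup>2 = cmod w powr (- (s + 2)) * (cmod (g w))\<^sup>2"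
        unfolding pw[OF elim, symmetric] by (simp add: gw norm_mult power_mult_distrib)
      then show ?thesis using True by (simp flip: ennreal_mult)
    qed simp
  qed
  also have "\<dots> = (\<integral>\<^sup>+w. ennreal ((cmod (g w))\<^sup>2) \<partial>disc_measure (s + 2))"
    unfolding disc_measure_def by (rule nn_integral_density[symmetric]) measurable
  finally have int: "integrable (disc_measure s) G'"
    using fin s by (intro integrable_disc_square) auto
  have "(\<integral>w. z * cnj w * disc_kernel s (z * cnj w) * g w \<partial>disc_measure (s + 2)) =
      (\<integral>w. (indicator (ball 0 1) w * cmod w powr (- (s + 2))) *\<^sub>R (z * cnj w * disc_kernel s (z * cnj w) * g w) \<partial>lborel)"
    unfolding disc_measure_def by (rule integral_density) auto
  also have "\<dots> = (\<integral>w. (indicator (ball 0 1) w * cmod w powr (- s)) *\<^sub>R (z * (disc_kernel s (z * cnj w) * G' w)) \<partial>lborel)"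
  proof (rule integral_cong_AE)
    show "AE w in lborel. (indicator (ball 0 1) w * cmod w powr (- (s + 2))) *\<^sub>R (z * cnj w * disc_kernel s (z * cnj w) * g w) =
        (indicator (ball 0 1) w * cmod w powr (- s)) *\<^sub>R (z * (disc_kernel s (z * cnj w) * G' w))"
      using AE_lborel_singleton[of 0]
    proof eventually_elim
      case (elim w)
      show ?case
      proof (cases "w \<in> ball 0 1")
        case True
        have "complex_of_real (cmod w powr (- s)) * G' w = of_real (cmod w powr (- (s + 2))) * (w * cnj w) * (g w / w)"
          using True Gg[OF elim] by (simp add: pw[OF elim, symmetric] complex_norm_square[symmetric])
        also have "\<dots> = of_real (cmod w powr (- (s + 2))) * cnj w * g w" using elim by simp
        finally show ?thesis using True by (simp add: scaleR_conv_of_real mult_ac)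
      qed simp
    qed
  qed measurable
  also have "\<dots> = (\<integral>w. z * (disc_kernel s (z * cnj w) * G' w) \<partial>disc_measure s)"
    unfolding disc_measure_def by (rule integral_density[symmetric]) auto
  also have "\<dots> = z * G' z"
    using disc_reproducing[OF hol' int] s z by simp
  finally show ?thesis using Gg[OF z] z by simp
qed

section \<open>Holomorphic functions of several variables on complex lines\<close>

lemma bounded_linear_smult_vec: "bounded_linear (\<lambda>t :: complex. t *s (e :: complex ^ 'n))"
  unfolding linear_conv_bounded_linear[symmetric]
  by (rule linearI) (simp_all add: vec_eq_iff algebra_simps)

lemma holomorphic_Cn_on_affine_line:
  fixes f :: "complex ^ 'n \<Rightarrow> complex" and e b :: "complex ^ 'n"
  assumes f: "holomorphic_Cn_on f \<Omega>" "open \<Omega>" and S: "open S" "\<And>t. t \<in> S \<Longrightarrow> b + t *s e \<in> \<Omega>"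
  shows "(\<lambda>t. f (b + t *s e)) holomorphic_on S"
  unfolding holomorphic_on_open[OF S(1)]
proof
  fix t assume "t \<in> S"
  then have z: "b + t *s e \<in> \<Omega>" by (rule S)
  then obtain L where L: "(f has_derivative L) (at (b + t *s e) within \<Omega>)" "\<And>c v. L (c *s v) = c * L v"
    using f(1) unfolding holomorphic_Cn_on_def by blast
  have "((\<lambda>t. b + t *s e) has_derivative (\<lambda>d. d *s e)) (at t)"
    by (auto intro!: derivative_eq_intros bounded_linear_imp_has_derivative bounded_linear_smult_vec)
  moreover have "(f has_derivative L) (at (b + t *s e))"
    using L(1) at_within_open[OF z f(2)] by simp
  ultimately have "((\<lambda>t. f (b + t *s e)) has_derivative (\<lambda>d. L (d *s e))) (at t)"
    by (rule has_derivative_compose)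
  then have "((\<lambda>t. f (b + t *s e)) has_field_derivative L e) (at t)"
    unfolding has_field_derivative_def by (simp add: L(2) mult.commute[of _ "L e"])
  then show "\<exists>D. ((\<lambda>t. f (b + t *s e)) has_field_derivative D) (at t)" by blast
qed

lemma holomorphic_Cn_on_imp_continuous_on: "holomorphic_Cn_on f \<Omega> \<Longrightarrow> continuous_on \<Omega> f"
  unfolding holomorphic_Cn_on_def continuous_on_eq_continuous_within
  using has_derivative_continuous by blast

lemma holomorphic_Cn_on_diff:
  assumes "holomorphic_Cn_on f \<Omega>" "holomorphic_Cn_on g \<Omega>"
  shows "holomorphic_Cn_on (\<lambda>z. f z - g z) \<Omega>"
  unfolding holomorphic_Cn_on_def
proof
  fix z assume "z \<in> \<Omega>"
  then obtain L M where "(f has_derivative L) (at z within \<Omega>)" "\<And>c v. L (c *s v) = c * L v"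
    "(g has_derivative M) (at z within \<Omega>)" "\<And>c v. M (c *s v) = c * M v"
    using assms unfolding holomorphic_Cn_on_def by meson
  then show "\<exists>L. ((\<lambda>z. f z - g z) has_derivative L) (at z within \<Omega>) \<and> (\<forall>c v. L (c *s v) = c * L v)"
    by (intro exI[of _ "\<lambda>v. L v - M v"]) (auto intro: has_derivative_diff simp: right_diff_distrib)
qed

text \<open>In each variable separately \<open>hartogs_map\<close> runs along a complex affine line,
  so a holomorphic function on the triangle pulls back to a function holomorphic in each
  variable.\<close>

lemma hartogs_map_line1: "hartogs_map (x, t) = 0 + t *s vector [x, 1]"
  and hartogs_map_line2: "hartogs_map (t, y) = vector [0, y] + t *s vector [y, 0]"
  by (simp_all add: vec_eq_iff forall_2)

section \<open>Reproduction of the Bergman space and self-adjointness\<close>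

context hartogs_weight
begin

text \<open>The one-variable formulas are iterated: the punctured disc in the second variable, then
  the disc in the first. The conclusion is almost everywhere because the slices of a
  square-integrable function are known to be square-integrable only for almost every value of the
  other variable.\<close>

lemma hartogs_projection_reproducing:
  assumes hol: "holomorphic_Cn_on h hartogs_triangle" and h: "L2 h"
  shows "AE z in W. hartogs_projection h z = h z"
proof -
  define g where "g z = (if z \<in> hartogs_triangle then h z else 0)" for z
  have gm [measurable]: "g \<in> borel_measurable borel"
  proof -
    have "(\<lambda>z. indicator hartogs_triangle z *\<^sub>R h z) \<in> borel_measurable borel"
      by (intro borel_measurable_continuous_on_indicator hartogs_triangle_borel holomorphic_Cn_on_imp_continuous_on hol)
    moreover have "(\<lambda>z. indicator hartogs_triangle z *\<^sub>R h z) = g"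
      by (auto simp: g_def indicator_def)
    ultimately show ?thesis by simp
  qed
  have gh: "AE z in W. h z = g z" using AE_W_in by eventually_elim (simp add: g_def)
  have L2g: "L2 g" by (rule L2_cong_AE[OF h gh measurable_W[OF gm]])
  have hg: "hartogs_projection h = hartogs_projection g"
    by (rule hartogs_projection_cong[OF L2_measurable[OF h] measurable_W[OF gm] gh])
  have hol1: "(\<lambda>t. g (hartogs_map (x, t))) holomorphic_on ball 0 1 - {0}" if "cmod x < 1" for x
  proof (rule holomorphic_transform)
    show "(\<lambda>t. h (0 + t *s vector [x, 1])) holomorphic_on ball 0 1 - {0}"
      using that by (intro holomorphic_Cn_on_affine_line[OF hol open_hartogs_triangle])
        (auto simp: hartogs_map_line1[symmetric] intro!: hartogs_map_in simp del: add_0)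
  qed (use that in \<open>auto simp: g_def hartogs_map_line1[symmetric] hartogs_map_in simp del: add_0\<close>)
  have hol2: "(\<lambda>t. g (hartogs_map (t, y))) holomorphic_on ball 0 1" if "y \<noteq> 0" "cmod y < 1" for y
  proof (rule holomorphic_transform)
    show "(\<lambda>t. h (vector [0, y] + t *s vector [y, 0])) holomorphic_on ball 0 1"
      using that by (intro holomorphic_Cn_on_affine_line[OF hol open_hartogs_triangle])
        (auto simp: hartogs_map_line2[symmetric] intro!: hartogs_map_in)
  qed (use that in \<open>auto simp: g_def hartogs_map_line2[symmetric] hartogs_map_in\<close>)
  have "(\<integral>\<^sup>+v. ennreal ((cmod (g (hartogs_map v)))\<^sup>2) \<partial>bidisc_measure s) = (\<integral>\<^sup>+z. ennreal ((cmod (g z))\<^sup>2) \<partial>W)"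
    by (rule nn_integral_W[symmetric]) measurable
  then have fin: "(\<integral>\<^sup>+v. ennreal ((cmod (g (hartogs_map v)))\<^sup>2) \<partial>bidisc_measure s) \<noteq> \<infinity>"
    using L2g by (simp add: L2_def less_top[symmetric])
  have A1: "AE x in disc_measure 0. (\<integral>\<^sup>+y. ennreal ((cmod (g (hartogs_map (x, y))))\<^sup>2) \<partial>disc_measure (s + 2)) \<noteq> \<infinity>"
  proof (rule nn_integral_PInf_AE)
    show "(\<lambda>x. \<integral>\<^sup>+y. ennreal ((cmod (g (hartogs_map (x, y))))\<^sup>2) \<partial>disc_measure (s + 2)) \<in> borel_measurable (disc_measure 0)"
      by (intro sigma_finite_measure.borel_measurable_nn_integral[OF sigma_finite_disc_measure]) measurable
    show "(\<integral>\<^sup>+x. \<integral>\<^sup>+y. ennreal ((cmod (g (hartogs_map (x, y))))\<^sup>2) \<partial>disc_measure (s + 2) \<partial>disc_measure 0) \<noteq> \<infinity>"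
      using fin unfolding bidisc_measure_def by (subst sigma_finite_measure.nn_integral_fst[OF sigma_finite_disc_measure]) simp_all
  qed
  have A2: "AE y in disc_measure (s + 2). (\<integral>\<^sup>+x. ennreal ((cmod (g (hartogs_map (x, y))))\<^sup>2) \<partial>disc_measure 0) \<noteq> \<infinity>"
  proof (rule nn_integral_PInf_AE)
    show "(\<lambda>y. \<integral>\<^sup>+x. ennreal ((cmod (g (hartogs_map (x, y))))\<^sup>2) \<partial>disc_measure 0) \<in> borel_measurable (disc_measure (s + 2))"
      by (intro sigma_finite_measure.borel_measurable_nn_integral[OF sigma_finite_disc_measure]) measurable
    show "(\<integral>\<^sup>+y. \<integral>\<^sup>+x. ennreal ((cmod (g (hartogs_map (x, y))))\<^sup>2) \<partial>disc_measure 0 \<partial>disc_measure (s + 2)) \<noteq> \<infinity>"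
      using fin unfolding bidisc_measure_def by (subst disc.nn_integral_snd) simp_all
  qed
  \<comment> \<open>The outer integral is taken along the slice through the second coordinate of the
    point u under consideration, so the condition on slices is stated as one on u.\<close>
  have A3: "AE u in bidisc_measure s. (\<integral>\<^sup>+x. ennreal ((cmod (g (hartogs_map (x, snd u))))\<^sup>2) \<partial>disc_measure 0) \<noteq> \<infinity>"
    unfolding bidisc_measure_def
  proof (rule disc.AE_pair_measure)
    have [measurable]: "(\<lambda>u. \<integral>\<^sup>+x. ennreal ((cmod (g (hartogs_map (x, snd u))))\<^sup>2) \<partial>disc_measure 0) \<in> borel_measurable (disc_measure 0 \<Otimes>\<^sub>M disc_measure (s + 2))"
      by (intro sigma_finite_measure.borel_measurable_nn_integral[OF sigma_finite_disc_measure]) measurable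
    show "{u \<in> space (disc_measure 0 \<Otimes>\<^sub>M disc_measure (s + 2)). (\<integral>\<^sup>+x. ennreal ((cmod (g (hartogs_map (x, snd u))))\<^sup>2) \<partial>disc_measure 0) \<noteq> \<infinity>}
      \<in> sets (disc_measure 0 \<Otimes>\<^sub>M disc_measure (s + 2))" by measurable
    show "AE x in disc_measure 0. AE y in disc_measure (s + 2).
        (\<integral>\<^sup>+xa. ennreal ((cmod (g (hartogs_map (xa, snd (x, y)))))\<^sup>2) \<partial>disc_measure 0) \<noteq> \<infinity>"
      using A2 by simp
  qed
  have "AE u in bidisc_measure s. hartogs_projection g (hartogs_map u) = g (hartogs_map u)"
    using AE_bidisc_measure A3
  proof eventually_elim
    case (elim u)
    define a b where "a = fst u" and "b = snd u"
    have ab: "cmod a < 1" "b \<noteq> 0" "cmod b < 1" and u: "u = (a, b)" using elim by (auto simp: a_def b_def)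
    have H: "hartogs_map u \<in> hartogs_triangle" using elim by (intro hartogs_map_in) auto
    define K where "K v = hartogs_kernel s (hartogs_map u) (hartogs_map v) * g (hartogs_map v)" for v
    have [measurable]: "K \<in> borel_measurable (borel \<Otimes>\<^sub>M borel)" unfolding K_def[abs_def] by measurable
    have int: "integrable (disc_measure 0 \<Otimes>\<^sub>M disc_measure (s + 2)) K"
      using L2_mult_integrable[OF L2_hartogs_kernel[OF H] L2g] unfolding K_def[abs_def] bidisc_measure_def[symmetric]
      by (subst (asm) integrable_W) auto
    have "hartogs_projection g (hartogs_map u) = (\<integral>v. K v \<partial>bidisc_measure s)"
      unfolding hartogs_projection_bidisc[OF gm H] K_def ..
    also have "\<dots> = (\<integral>x. \<integral>y. K (x, y) \<partial>disc_measure (s + 2) \<partial>disc_measure 0)"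
      unfolding bidisc_measure_def by (rule disc.integral_fst'[OF int, symmetric])
    also have "\<dots> = (\<integral>x. disc_kernel 0 (a * cnj x) * g (hartogs_map (x, b)) \<partial>disc_measure 0)"
    proof (rule integral_cong_AE)
      show "(\<lambda>x. \<integral>y. K (x, y) \<partial>disc_measure (s + 2)) \<in> borel_measurable (disc_measure 0)"
        by (intro sigma_finite_measure.borel_measurable_lebesgue_integral[OF sigma_finite_disc_measure]) measurable
      show "AE x in disc_measure 0. (\<integral>y. K (x, y) \<partial>disc_measure (s + 2)) = disc_kernel 0 (a * cnj x) * g (hartogs_map (x, b))"
        using AE_disc_measure A1
      proof eventually_elim
        case (elim x)
        have "(\<integral>y. K (x, y) \<partial>disc_measure (s + 2)) =
            (\<integral>y. disc_kernel 0 (a * cnj x) * (b * cnj y * disc_kernel s (b * cnj y) * g (hartogs_map (x, y))) \<partial>disc_measure (s + 2))"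
        proof (rule integral_cong_AE)
          show "AE y in disc_measure (s + 2). K (x, y) = disc_kernel 0 (a * cnj x) * (b * cnj y * disc_kernel s (b * cnj y) * g (hartogs_map (x, y)))"
            using AE_disc_measure by eventually_elim (use ab in \<open>simp add: K_def hartogs_kernel_map u\<close>)
        qed measurable
        also have "\<dots> = disc_kernel 0 (a * cnj x) * g (hartogs_map (x, b))"
          using elim ab s by (subst integral_mult_right_zero, subst punctured_reproducing[OF hol1]) (auto simp: less_top)
        finally show ?case .
      qed
    qed measurable
    also have "\<dots> = g (hartogs_map (a, b))"
    proof (rule disc_reproducing[OF hol2])
      show "integrable (disc_measure 0) (\<lambda>x. g (hartogs_map (x, b)))"
        using elim by (intro integrable_disc_square) (auto simp: b_def less_top)
    qed (use ab in auto)
    finally show ?case by (simp add: u)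
  qed
  then have "AE z in W. hartogs_projection g z = g z"
  proof (subst AE_W)
    have [measurable]: "hartogs_projection g \<in> borel_measurable borel" by (rule hartogs_projection_borel[OF gm])
    show "Measurable.pred borel (\<lambda>z. hartogs_projection g z = g z)" by measurable
  qed
  then show ?thesis using gh unfolding hg by eventually_elim simp
qed

text \<open>Fubini and the Hermitian symmetry of the kernel. The difficulty is absolute convergence:
  the integral of |K u v F v| over v is itself a square-integrable function of u, by the Schur bound
  for the majorant with p = 2.\<close>

lemma hartogs_projection_selfadjoint:
  assumes f: "L2 f" and g: "L2 g"
  shows "(\<integral>z. hartogs_projection f z * cnj (g z) \<partial>W) = (\<integral>z. f z * cnj (hartogs_projection g z) \<partial>W)"
proof -
  obtain f' where f' [measurable]: "f' \<in> borel_measurable borel" and fae: "AE z in W. f z = f' z"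
    and f'L2: "L2 f'" and fh: "hartogs_projection f = hartogs_projection f'"
    using L2_borel[OF f] .
  obtain g' where g' [measurable]: "g' \<in> borel_measurable borel" and gae: "AE z in W. g z = g' z"
    and g'L2: "L2 g'" and gh: "hartogs_projection g = hartogs_projection g'"
    using L2_borel[OF g] .
  have [measurable]: "hartogs_projection f' \<in> borel_measurable borel" "hartogs_projection g' \<in> borel_measurable borel"
    by (rule hartogs_projection_borel, measurable)+
  interpret N: sigma_finite_measure "bidisc_measure s" by (rule sigma_finite_bidisc_measure)
  interpret NN: pair_sigma_finite "bidisc_measure s" "bidisc_measure s" ..
  define F where "F v = f' (hartogs_map v)" for v
  define G where "G v = g' (hartogs_map v)" for v
  define K where "K u v = hartogs_kernel s (hartogs_map u) (hartogs_map v)" for u v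
  have [measurable]: "F \<in> borel_measurable (borel \<Otimes>\<^sub>M borel)" "G \<in> borel_measurable (borel \<Otimes>\<^sub>M borel)"
    "(\<lambda>x. K (fst x) (snd x)) \<in> borel_measurable ((borel \<Otimes>\<^sub>M borel) \<Otimes>\<^sub>M (borel \<Otimes>\<^sub>M borel))"
    "(\<lambda>x. K (snd x) (fst x)) \<in> borel_measurable ((borel \<Otimes>\<^sub>M borel) \<Otimes>\<^sub>M (borel \<Otimes>\<^sub>M borel))"
    unfolding F_def[abs_def] G_def[abs_def] K_def by measurable
  have KF: "integrable (bidisc_measure s) (\<lambda>v. K u v * F v)" if "hartogs_map u \<in> hartogs_triangle" for u
    using L2_mult_integrable[OF L2_hartogs_kernel[OF that] f'L2] unfolding K_def F_def
    by (subst (asm) integrable_W) auto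
  have H: "AE u in bidisc_measure s. hartogs_map u \<in> hartogs_triangle"
    using AE_bidisc_measure by eventually_elim (auto intro: hartogs_map_in)
  \<comment> \<open>The operator with absolute values inside the integral; paired with |G| it
    dominates the double integral.\<close>
  define S where "S u = (\<integral>v. cmod (K u v * F v) \<partial>bidisc_measure s)" for u
  have [measurable]: "S \<in> borel_measurable (borel \<Otimes>\<^sub>M borel)"
    unfolding S_def[abs_def] norm_mult by (intro N.borel_measurable_lebesgue_integral) measurable
  have S0: "0 \<le> S u" for u unfolding S_def by simp
  have Seq: "AE u in bidisc_measure s. (\<integral>\<^sup>+v. ennreal (cmod (K u v * F v)) \<partial>bidisc_measure s) = ennreal (S u)"
    using H unfolding S_def by eventually_elim (intro nn_integral_eq_integral integrable_norm KF, auto)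
  have maj: "AE u in bidisc_measure s. 0 \<le> S u \<and> ennreal (S u) \<le> (\<integral>\<^sup>+v. ennreal (bidisc_majorant u v * cmod (F v)) \<partial>bidisc_measure s)"
    using Seq AE_bidisc_measure
  proof eventually_elim
    case (elim u)
    have "ennreal (S u) = (\<integral>\<^sup>+v. ennreal (cmod (K u v * F v)) \<partial>bidisc_measure s)" using elim(1) ..
    also have "\<dots> \<le> (\<integral>\<^sup>+v. ennreal (bidisc_majorant u v * cmod (F v)) \<partial>bidisc_measure s)"
    proof (rule nn_integral_mono_AE, use AE_bidisc_measure in eventually_elim)
      case (elim v)
      with \<open>fst u \<noteq> 0 \<and> _\<close> have "cmod (K u v) \<le> bidisc_majorant u v"
        unfolding K_def by (intro hartogs_kernel_majorant) auto
      then show ?case by (auto simp: norm_mult intro!: ennreal_leI mult_right_mono)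
    qed
    finally show ?case using S0 by simp
  qed
  have "s < 2" "2 * (s - 1) < s" using s by auto
  then obtain A where schur: "\<And>F T. F \<in> borel_measurable (borel \<Otimes>\<^sub>M borel) \<Longrightarrow> (\<And>v. 0 \<le> F v) \<Longrightarrow>
    AE u in bidisc_measure s. 0 \<le> T u \<and> ennreal (T u) \<le> (\<integral>\<^sup>+v. ennreal (bidisc_majorant u v * F v) \<partial>bidisc_measure s) \<Longrightarrow>
    (\<integral>\<^sup>+u. ennreal (T u powr 2) \<partial>bidisc_measure s) \<le> ennreal (A powr 2) * (\<integral>\<^sup>+v. ennreal (F v powr 2) \<partial>bidisc_measure s)"
    by (rule schur_bidisc) blast
  have "(\<integral>\<^sup>+u. ennreal (S u powr 2) \<partial>bidisc_measure s) \<le> ennreal (A powr 2) * (\<integral>\<^sup>+v. ennreal (cmod (F v) powr 2) \<partial>bidisc_measure s)"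
    using maj by (intro schur) auto
  moreover have F2: "(\<integral>\<^sup>+v. ennreal ((cmod (F v))\<^sup>2) \<partial>bidisc_measure s) < \<infinity>"
    using f'L2 nn_integral_W[of "\<lambda>z. ennreal ((cmod (f' z))\<^sup>2)"] unfolding L2_def F_def by simp
  ultimately have S2: "(\<integral>\<^sup>+u. ennreal ((S u)\<^sup>2) \<partial>bidisc_measure s) < \<infinity>"
    using S0 by (auto simp: ennreal_mult_less_top intro: le_less_trans)
  have G2: "(\<integral>\<^sup>+v. ennreal ((cmod (G v))\<^sup>2) \<partial>bidisc_measure s) < \<infinity>"
    using g'L2 nn_integral_W[of "\<lambda>z. ennreal ((cmod (g' z))\<^sup>2)"] unfolding L2_def G_def by simp
  define P where "P u v = K u v * F v * cnj (G u)" for u v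
  have Pm [measurable]: "case_prod P \<in> borel_measurable (bidisc_measure s \<Otimes>\<^sub>M bidisc_measure s)"
    unfolding P_def[abs_def] split_beta' by measurable
  have P: "integrable (bidisc_measure s \<Otimes>\<^sub>M bidisc_measure s) (case_prod P)"
  proof (rule integrableI_bounded[OF Pm])
    have "(\<integral>\<^sup>+x. ennreal (norm (case_prod P x)) \<partial>(bidisc_measure s \<Otimes>\<^sub>M bidisc_measure s)) =
        (\<integral>\<^sup>+u. \<integral>\<^sup>+v. ennreal (norm (P u v)) \<partial>bidisc_measure s \<partial>bidisc_measure s)"
      using N.nn_integral_fst[OF measurable_compose[OF Pm, of "\<lambda>z. ennreal (norm z)" borel]] by simp
    also have "\<dots> = (\<integral>\<^sup>+u. ennreal (S u) * ennreal (cmod (G u)) \<partial>bidisc_measure s)"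
    proof (rule nn_integral_cong_AE, use Seq H in eventually_elim)
      case (elim u)
      have "(\<integral>\<^sup>+v. ennreal (norm (P u v)) \<partial>bidisc_measure s) = (\<integral>\<^sup>+v. ennreal (cmod (K u v * F v)) * ennreal (cmod (G u)) \<partial>bidisc_measure s)"
        by (simp add: P_def norm_mult flip: ennreal_mult)
      also have "\<dots> = (\<integral>\<^sup>+v. ennreal (cmod (K u v * F v)) \<partial>bidisc_measure s) * ennreal (cmod (G u))"
        using KF[OF elim(2)] by (intro nn_integral_multc) auto
      finally show ?case using elim by simp
    qed
    also have "\<dots> \<le> (\<integral>\<^sup>+u. ennreal ((S u)\<^sup>2) + ennreal ((cmod (G u))\<^sup>2) \<partial>bidisc_measure s)"
    proof (rule nn_integral_mono)
      fix u
      have "2 * (S u * cmod (G u)) \<le> (S u)\<^sup>2 + (cmod (G u))\<^sup>2"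
        using sum_squares_bound[of "S u" "cmod (G u)"] by simp
      moreover have "0 \<le> S u * cmod (G u)" using S0 by simp
      ultimately have "S u * cmod (G u) \<le> (S u)\<^sup>2 + (cmod (G u))\<^sup>2" by linarith
      then show "ennreal (S u) * ennreal (cmod (G u)) \<le> ennreal ((S u)\<^sup>2) + ennreal ((cmod (G u))\<^sup>2)"
        using S0 by (simp add: ennreal_leI flip: ennreal_plus ennreal_mult)
    qed
    also have "\<dots> < \<infinity>" using S2 G2 by (subst nn_integral_add) auto
    finally show "(\<integral>\<^sup>+x. ennreal (norm (case_prod P x)) \<partial>(bidisc_measure s \<Otimes>\<^sub>M bidisc_measure s)) < \<infinity>" .
  qed
  have "(\<integral>z. hartogs_projection f z * cnj (g z) \<partial>W) = (\<integral>z. hartogs_projection f' z * cnj (g' z) \<partial>W)"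
  proof (rule integral_cong_AE)
    show "AE z in W. hartogs_projection f z * cnj (g z) = hartogs_projection f' z * cnj (g' z)"
      using gae by eventually_elim (simp add: fh)
    show "(\<lambda>z. hartogs_projection f z * cnj (g z)) \<in> borel_measurable W"
      using L2_mult_integrable[OF hartogs_projection_L2[OF f] L2_cnj[OF g]] by auto
    show "(\<lambda>z. hartogs_projection f' z * cnj (g' z)) \<in> borel_measurable W"
      using L2_mult_integrable[OF hartogs_projection_L2[OF f'L2] L2_cnj[OF g'L2]] by auto
  qed
  also have "\<dots> = (\<integral>u. hartogs_projection f' (hartogs_map u) * cnj (g' (hartogs_map u)) \<partial>bidisc_measure s)"
    by (rule integral_W) measurable
  also have "\<dots> = (\<integral>u. \<integral>v. P u v \<partial>bidisc_measure s \<partial>bidisc_measure s)"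
  proof (rule integral_cong_AE)
    show "AE u in bidisc_measure s. hartogs_projection f' (hartogs_map u) * cnj (g' (hartogs_map u)) = (\<integral>v. P u v \<partial>bidisc_measure s)"
      using H by eventually_elim (simp add: hartogs_projection_bidisc P_def K_def F_def G_def)
  qed measurable
  also have "\<dots> = (\<integral>v. \<integral>u. P u v \<partial>bidisc_measure s \<partial>bidisc_measure s)"
    by (rule NN.Fubini_integral[OF P, symmetric])
  also have "\<dots> = (\<integral>v. f' (hartogs_map v) * cnj (hartogs_projection g' (hartogs_map v)) \<partial>bidisc_measure s)"
  proof (rule integral_cong_AE)
    show "(\<lambda>v. \<integral>u. P u v \<partial>bidisc_measure s) \<in> borel_measurable (bidisc_measure s)"
      unfolding P_def by (intro N.borel_measurable_lebesgue_integral) (unfold split_beta', measurable)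
    show "AE v in bidisc_measure s. (\<integral>u. P u v \<partial>bidisc_measure s) = f' (hartogs_map v) * cnj (hartogs_projection g' (hartogs_map v))"
      using H
    proof eventually_elim
      case (elim v)
      have "(\<integral>u. P u v \<partial>bidisc_measure s) = (\<integral>u. F v * cnj (K v u * G u) \<partial>bidisc_measure s)"
        by (rule Bochner_Integration.integral_cong) (simp_all add: P_def K_def cnj_hartogs_kernel mult_ac)
      also have "\<dots> = F v * cnj (\<integral>u. K v u * G u \<partial>bidisc_measure s)"
        by (simp only: integral_mult_right_zero Bochner_Integration.integral_cnj)
      finally show ?case
        using elim by (simp add: hartogs_projection_bidisc K_def F_def G_def)
    qed
  qed measurable
  also have "\<dots> = (\<integral>z. f' z * cnj (hartogs_projection g' z) \<partial>W)"
    by (rule integral_W[symmetric]) measurable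
  also have "\<dots> = (\<integral>z. f z * cnj (hartogs_projection g z) \<partial>W)"
  proof (rule integral_cong_AE)
    show "AE z in W. f' z * cnj (hartogs_projection g' z) = f z * cnj (hartogs_projection g z)"
      using fae by eventually_elim (simp add: gh)
    show "(\<lambda>z. f' z * cnj (hartogs_projection g' z)) \<in> borel_measurable W"
      using L2_mult_integrable[OF f'L2 L2_cnj[OF hartogs_projection_L2[OF g'L2]]] by auto
    show "(\<lambda>z. f z * cnj (hartogs_projection g z)) \<in> borel_measurable W"
      using L2_mult_integrable[OF f L2_cnj[OF hartogs_projection_L2[OF g]]] by auto
  qed
  finally show ?thesis .
qed

end

section \<open>The range of exponents\<close>

lemma nn_integral_radial_powr:
  assumes "0 < \<epsilon>"
  shows "(\<integral>\<^sup>+r. ennreal (indicator {\<epsilon><..} r * r powr q) \<partial>radial_measure (s + 2)) =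
    ennreal (2 * pi) * (\<integral>\<^sup>+r. ennreal (indicator {\<epsilon><..<1} r * r powr (q - s - 1)) \<partial>lborel)"
proof -
  have "(\<integral>\<^sup>+r. ennreal (indicator {\<epsilon><..} r * r powr q) \<partial>radial_measure (s + 2)) =
    (\<integral>\<^sup>+r. ennreal (indicator {0<..<1} r * (2 * pi * r powr (1 - (s + 2)))) * ennreal (indicator {\<epsilon><..} r * r powr q) \<partial>lborel)"
    by (rule nn_integral_radial) measurable
  also have "\<dots> = (\<integral>\<^sup>+r. ennreal (2 * pi) * ennreal (indicator {\<epsilon><..<1} r * r powr (q - s - 1)) \<partial>lborel)"
  proof (rule nn_integral_cong)
    fix r :: real
    have "q - s - 1 = (1 - (s + 2)) + q" by simp
    then have "r powr (q - s - 1) = r powr (1 - (s + 2)) * r powr q" by (simp only: powr_add)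
    then show "ennreal (indicator {0<..<1} r * (2 * pi * r powr (1 - (s + 2)))) * ennreal (indicator {\<epsilon><..} r * r powr q) =
        ennreal (2 * pi) * ennreal (indicator {\<epsilon><..<1} r * r powr (q - s - 1))"
      using assms by (auto simp: indicator_def mult.assoc simp flip: ennreal_mult)
  qed
  also have "\<dots> = ennreal (2 * pi) * (\<integral>\<^sup>+r. ennreal (indicator {\<epsilon><..<1} r * r powr (q - s - 1)) \<partial>lborel)"
    by (rule nn_integral_cmult) measurable
  finally show ?thesis .
qed

lemma nn_integral_powr_truncated_finite:
  assumes "0 < \<epsilon>" "\<epsilon> < (1::real)"
  obtains J where "0 \<le> J" "(\<integral>\<^sup>+r. ennreal (indicator {\<epsilon><..<1} r * r powr e) \<partial>lborel) = ennreal J"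
proof -
  have "(\<integral>\<^sup>+r. ennreal (indicator {\<epsilon><..<1} r * r powr e) \<partial>lborel) \<le> (\<integral>\<^sup>+r. ennreal (\<epsilon> powr (- \<bar>e\<bar>)) * indicator {\<epsilon>..1} r \<partial>lborel)"
  proof (rule nn_integral_mono)
    fix r :: real
    show "ennreal (indicator {\<epsilon><..<1} r * r powr e) \<le> ennreal (\<epsilon> powr (- \<bar>e\<bar>)) * indicator {\<epsilon>..1} r"
    proof (cases "r \<in> {\<epsilon><..<1}")
      case True
      then have "r powr e \<le> r powr (- \<bar>e\<bar>)" using assms by (intro powr_mono') auto
      also have "\<dots> \<le> \<epsilon> powr (- \<bar>e\<bar>)" using True assms by (intro powr_mono2') auto
      finally show ?thesis using True by (simp add: ennreal_leI)
    qed simp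
  qed
  also have "\<dots> < \<infinity>" using assms by (simp add: nn_integral_cmult_indicator ennreal_mult_less_top)
  finally show ?thesis using that
    by (cases "\<integral>\<^sup>+r. ennreal (indicator {\<epsilon><..<1} r * r powr e) \<partial>lborel") auto
qed

text \<open>On (0, 1) smaller exponents give larger powers, so r^e is compared with r^0 or r^(-1).
  The second bound grows without limit as the cutoff tends to 0 and drives the failure at both ends,
  endpoints included.\<close>

lemma nn_integral_powr_truncated_ge:
  assumes \<epsilon>: "0 < \<epsilon>" "\<epsilon> < (1::real)"
  shows "e \<le> 0 \<Longrightarrow> ennreal (1 - \<epsilon>) \<le> (\<integral>\<^sup>+r. ennreal (indicator {\<epsilon><..<1} r * r powr e) \<partial>lborel)"
    and "e \<le> -1 \<Longrightarrow> ennreal (- ln \<epsilon>) \<le> (\<integral>\<^sup>+r. ennreal (indicator {\<epsilon><..<1} r * r powr e) \<partial>lborel)"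
proof -
  assume e: "e \<le> 0"
  have "ennreal (1 - \<epsilon>) = (\<integral>\<^sup>+r. indicator {\<epsilon><..<1} r \<partial>lborel)" using \<epsilon> by simp
  also have "\<dots> \<le> (\<integral>\<^sup>+r. ennreal (indicator {\<epsilon><..<1} r * r powr e) \<partial>lborel)"
  proof (rule nn_integral_mono)
    fix r :: real
    show "indicator {\<epsilon><..<1} r \<le> ennreal (indicator {\<epsilon><..<1} r * r powr e)"
      using \<epsilon> e powr_mono'[of e 0 r] by (cases "r \<in> {\<epsilon><..<1}") auto
  qed
  finally show "ennreal (1 - \<epsilon>) \<le> (\<integral>\<^sup>+r. ennreal (indicator {\<epsilon><..<1} r * r powr e) \<partial>lborel)" .
next
  assume e: "e \<le> -1"
  have "((\<lambda>r. 1 / r) has_integral (ln 1 - ln \<epsilon>)) {\<epsilon>..1}"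
    using \<epsilon> by (intro fundamental_theorem_of_calculus)
      (auto intro!: derivative_eq_intros simp flip: has_real_derivative_iff_has_vector_derivative)
  then have "ennreal (- ln \<epsilon>) = (\<integral>\<^sup>+r. ennreal (indicator {\<epsilon>..1} r * (1 / r)) \<partial>lborel)"
    using \<epsilon> by (subst nn_integral_has_integral_lebesgue) auto
  also have "\<dots> \<le> (\<integral>\<^sup>+r. ennreal (indicator {\<epsilon><..<1} r * r powr e) \<partial>lborel)"
  proof (rule nn_integral_mono_AE, use AE_lborel_singleton[of \<epsilon>] AE_lborel_singleton[of 1] in eventually_elim)
    case (elim r)
    show ?case
    proof (cases "r \<in> {\<epsilon><..<1}")
      case True
      then have "r powr (-1) \<le> r powr e" using \<epsilon> e by (intro powr_mono') auto
      then show ?thesis using True \<epsilon> by (simp add: powr_minus_divide ennreal_leI)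
    qed (use elim in \<open>auto simp: indicator_def\<close>)
  qed
  finally show "ennreal (- ln \<epsilon>) \<le> (\<integral>\<^sup>+r. ennreal (indicator {\<epsilon><..<1} r * r powr e) \<partial>lborel)" .
qed

section \<open>Identification with the Bergman projection\<close>

context hartogs_weight
begin

lemma Lp_space_iff:
  "f \<in> Lp_space p hartogs_triangle \<mu> \<longleftrightarrow> f \<in> borel_measurable W \<and> (\<integral>\<^sup>+z. ennreal (cmod (f z) powr p) \<partial>W) < \<infinity>"
  by (auto simp: Lp_space_def Lp_norm_def Let_def borel_measurable_W_iff less_top)

lemma Lp_norm_eq:
  "0 \<le> I \<Longrightarrow> (\<integral>\<^sup>+z. ennreal (cmod (f z) powr p) \<partial>W) = ennreal I \<Longrightarrow> Lp_norm p hartogs_triangle \<mu> f = ennreal (I powr (1 / p))"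
  by (simp add: Lp_norm_def)

lemma Lp_space_2_iff: "f \<in> Lp_space 2 hartogs_triangle \<mu> \<longleftrightarrow> L2 f"
  by (simp add: Lp_space_iff L2_def)

lemma bergman_space_iff: "f \<in> bergman_space hartogs_triangle \<mu> \<longleftrightarrow> L2 f \<and> holomorphic_Cn_on f hartogs_triangle"
  by (simp add: bergman_space_def Lp_space_2_iff)

lemma hartogs_projection_in_bergman_space: "L2 f \<Longrightarrow> hartogs_projection f \<in> bergman_space hartogs_triangle \<mu>"
  by (simp add: bergman_space_iff hartogs_projection_L2 hartogs_projection_holomorphic)

text \<open>For h in the Bergman space self-adjointness moves the operator onto h, and the
  reproducing property removes it there.\<close>

lemma hartogs_projection_orthogonal:
  assumes f: "L2 f" and h: "h \<in> bergman_space hartogs_triangle \<mu>"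
  shows "L2_inner hartogs_triangle \<mu> (\<lambda>z. f z - hartogs_projection f z) h = 0"
proof -
  have h2: "L2 h" and hol: "holomorphic_Cn_on h hartogs_triangle" using h by (auto simp: bergman_space_iff)
  have int: "integrable W (\<lambda>z. f z * cnj (h z))" "integrable W (\<lambda>z. hartogs_projection f z * cnj (h z))"
    by (intro L2_mult_integrable L2_cnj hartogs_projection_L2 f h2)+
  have "(\<integral>z. hartogs_projection f z * cnj (h z) \<partial>W) = (\<integral>z. f z * cnj (hartogs_projection h z) \<partial>W)"
    by (rule hartogs_projection_selfadjoint[OF f h2])
  also have "\<dots> = (\<integral>z. f z * cnj (h z) \<partial>W)"
  proof (rule integral_cong_AE)
    show "AE z in W. f z * cnj (hartogs_projection h z) = f z * cnj (h z)"
      using hartogs_projection_reproducing[OF hol h2] by eventually_elim simp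
    show "(\<lambda>z. f z * cnj (hartogs_projection h z)) \<in> borel_measurable W"
      using L2_mult_integrable[OF f L2_cnj[OF hartogs_projection_L2[OF h2]]] by auto
  qed (use int in auto)
  finally show ?thesis
    using int by (simp add: L2_inner_def left_diff_distrib)
qed

text \<open>The set where d is non-zero is open by continuity and Lebesgue null because the weight
  is positive; hence it is empty.\<close>

lemma AE_W_zero_imp_zero:
  assumes cont: "continuous_on hartogs_triangle d" and ae: "AE z in W. d z = (0 :: complex)"
    and z: "z \<in> hartogs_triangle"
  shows "d z = 0"
proof (rule ccontr)
  assume nz: "d z \<noteq> 0"
  define U where "U = {z \<in> hartogs_triangle. d z \<in> - {0}}"
  have "open U"
    unfolding U_def using continuous_on_open_vimage[OF open_hartogs_triangle, of d] cont
    by (auto simp: vimage_def Int_def conj_commute)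
  have "AE z in lebesgue_on hartogs_triangle. 0 < ennreal (\<mu> z) \<longrightarrow> d z = 0"
    using ae unfolding weighted_measure_def by (subst (asm) AE_density[OF \<mu>_measurable])
  then have "AE z in lebesgue. z \<in> hartogs_triangle \<longrightarrow> 0 < ennreal (\<mu> z) \<longrightarrow> d z = 0"
    by (subst (asm) AE_restrict_space_iff) auto
  then have "AE z in lebesgue. z \<notin> U"
  proof eventually_elim
    case (elim z)
    then show ?case using hartogs_triangleD(1)[of z] by (auto simp: U_def \<mu>)
  qed
  then have "U \<in> null_sets lebesgue"
    using AE_iff_null_sets[of U lebesgue] \<open>open U\<close> by auto
  then have "negligible U" by (simp add: negligible_iff_null_sets)
  then show False
    using open_not_negligible[OF \<open>open U\<close>] nz z by (auto simp: U_def)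
qed

text \<open>For uniqueness, the difference d of two candidates lies in the Bergman space and is
  orthogonal to it, in particular to itself. It therefore vanishes almost everywhere, and by
  continuity everywhere on the triangle.\<close>

lemma bergman_projection_eq_hartogs_projection:
  assumes f: "L2 f"
  shows "bergman_projection hartogs_triangle \<mu> f = hartogs_projection f"
  unfolding bergman_projection_def
proof (rule the_equality)
  show "hartogs_projection f \<in> bergman_space hartogs_triangle \<mu> \<and> (\<forall>z. z \<notin> hartogs_triangle \<longrightarrow> hartogs_projection f z = 0) \<and>
     (\<forall>h\<in>bergman_space hartogs_triangle \<mu>. L2_inner hartogs_triangle \<mu> (\<lambda>z. f z - hartogs_projection f z) h = 0)"
    using hartogs_projection_in_bergman_space[OF f] hartogs_projection_orthogonal[OF f] by (simp add: hartogs_projection_def)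
next
  fix g assume g: "g \<in> bergman_space hartogs_triangle \<mu> \<and> (\<forall>z. z \<notin> hartogs_triangle \<longrightarrow> g z = 0) \<and>
     (\<forall>h\<in>bergman_space hartogs_triangle \<mu>. L2_inner hartogs_triangle \<mu> (\<lambda>z. f z - g z) h = 0)"
  define d where "d z = g z - hartogs_projection f z" for z
  have g2: "L2 g" "holomorphic_Cn_on g hartogs_triangle" using g by (auto simp: bergman_space_iff)
  have d2: "L2 d" unfolding d_def[abs_def] by (rule L2_diff[OF g2(1) hartogs_projection_L2[OF f]])
  have dh: "holomorphic_Cn_on d hartogs_triangle"
    unfolding d_def[abs_def] by (rule holomorphic_Cn_on_diff[OF g2(2) hartogs_projection_holomorphic[OF f]])
  have db: "d \<in> bergman_space hartogs_triangle \<mu>" using d2 dh by (simp add: bergman_space_iff)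
  have "(\<integral>z. (f z - g z) * cnj (d z) \<partial>W) = 0" "(\<integral>z. (f z - hartogs_projection f z) * cnj (d z) \<partial>W) = 0"
    using g db hartogs_projection_orthogonal[OF f db] by (auto simp: L2_inner_def)
  moreover have "integrable W (\<lambda>z. (f z - g z) * cnj (d z))" "integrable W (\<lambda>z. (f z - hartogs_projection f z) * cnj (d z))"
    by (intro L2_mult_integrable L2_diff L2_cnj f g2 d2 hartogs_projection_L2)+
  ultimately have "(\<integral>z. (f z - hartogs_projection f z) * cnj (d z) - (f z - g z) * cnj (d z) \<partial>W) = 0"
    by simp
  \<comment> \<open>Subtracting the two orthogonality relations, both tested against d, leaves the
    squared norm of d.\<close>
  moreover have "(f z - hartogs_projection f z) * cnj (d z) - (f z - g z) * cnj (d z) = of_real ((cmod (d z))\<^sup>2)" for z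
    by (subst complex_norm_square) (simp add: d_def algebra_simps)
  ultimately have "(\<integral>z. (cmod (d z))\<^sup>2 \<partial>W) = 0"
    by (simp only: integral_complex_of_real of_real_eq_0_iff)
  moreover have "integrable W (\<lambda>z. (cmod (d z))\<^sup>2)"
    using d2 by (intro integrableI_bounded) (auto simp: L2_def)
  ultimately have "AE z in W. (cmod (d z))\<^sup>2 = 0"
    by (subst (asm) integral_nonneg_eq_0_iff_AE) auto
  then have "AE z in W. d z = 0" by simp
  then have "d z = 0" if "z \<in> hartogs_triangle" for z
    using that by (rule AE_W_zero_imp_zero[OF holomorphic_Cn_on_imp_continuous_on[OF dh]])
  then show "g = hartogs_projection f"
    using g by (auto simp: fun_eq_iff d_def hartogs_projection_def)
qed

section \<open>Test functions and the two directions of the equivalence\<close>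

definition test_fun :: "(real \<Rightarrow> real) \<Rightarrow> complex ^ 2 \<Rightarrow> complex"
  where "test_fun k z = z $ 2 * of_real (k (cmod (z $ 2)))"

lemma nn_integral_test_fun:
  assumes [measurable]: "k \<in> borel_measurable borel"
  shows "(\<integral>\<^sup>+z. ennreal (cmod (test_fun k z) powr p) \<partial>W) = ennreal pi * (\<integral>\<^sup>+r. ennreal (\<bar>r * k r\<bar> powr p) \<partial>radial_measure (s + 2))"
proof -
  have "(\<integral>\<^sup>+z. ennreal (cmod (test_fun k z) powr p) \<partial>W) = (\<integral>\<^sup>+z. (\<lambda>r. ennreal (\<bar>r * k r\<bar> powr p)) (cmod (z $ 2)) \<partial>W)"
    by (simp add: test_fun_def norm_mult abs_mult)
  also have "\<dots> = ennreal pi * (\<integral>\<^sup>+r. ennreal (\<bar>r * k r\<bar> powr p) \<partial>radial_measure (s + 2))"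
    by (rule nn_integral_W_snd) measurable
  finally show ?thesis .
qed

lemma test_fun_L2:
  assumes [measurable]: "k \<in> borel_measurable borel" and B: "\<And>r. \<bar>k r\<bar> \<le> B"
  shows "L2 (test_fun k)"
  unfolding L2_def
proof
  show "test_fun k \<in> borel_measurable W"
    unfolding test_fun_def[abs_def] by (rule measurable_W) measurable
  have "(\<integral>\<^sup>+z. ennreal ((cmod (test_fun k z))\<^sup>2) \<partial>W) \<le> (\<integral>\<^sup>+z. ennreal (B\<^sup>2) * ennreal (cmod (z $ 2) powr 2) \<partial>W)"
  proof (rule nn_integral_mono)
    fix z :: "complex ^ 2"
    have "(k (cmod (z $ 2)))\<^sup>2 \<le> B\<^sup>2" using power_mono[OF B[of "cmod (z $ 2)"], of 2] by simp
    from mult_left_mono[OF this, of "(cmod (z $ 2))\<^sup>2"]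
    have "(cmod (test_fun k z))\<^sup>2 \<le> B\<^sup>2 * (cmod (z $ 2))\<^sup>2"
      by (simp add: test_fun_def norm_mult power_mult_distrib mult.commute)
    then show "ennreal ((cmod (test_fun k z))\<^sup>2) \<le> ennreal (B\<^sup>2) * ennreal (cmod (z $ 2) powr 2)"
      by (simp add: ennreal_leI flip: ennreal_mult)
  qed
  also have "\<dots> = ennreal (B\<^sup>2) * (\<integral>\<^sup>+z. ennreal (cmod (z $ 2) powr 2) \<partial>W)"
    by (rule nn_integral_cmult) (rule measurable_W, measurable)
  also have "\<dots> < \<infinity>" using s by (subst nn_integral_W_snd_powr) (auto simp flip: ennreal_mult)
  finally show "(\<integral>\<^sup>+z. ennreal ((cmod (test_fun k z))\<^sup>2) \<partial>W) < \<infinity>" .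
qed

text \<open>The angular mean of the second disc kernel is its value (2 - s) / (2 pi) at 0, so a
  radial profile k enters only through one moment. The first disc kernel reproduces the constant
  1.\<close>

lemma hartogs_projection_test_fun:
  assumes [measurable]: "k \<in> borel_measurable borel" and B: "\<And>r. \<bar>k r\<bar> \<le> B" and z: "z \<in> hartogs_triangle"
  shows "hartogs_projection (test_fun k) z = of_real ((2 - s) / (2 * pi) * (\<integral>r. r\<^sup>2 * k r \<partial>radial_measure (s + 2))) * z $ 2"
proof -
  define a b where "a = z $ 1 / z $ 2" and "b = z $ 2"
  have ab: "b \<noteq> 0" "cmod b < 1" "cmod a < 1" using hartogs_triangleD[OF z] by (auto simp: a_def b_def)
  define K where "K v = hartogs_kernel s z (hartogs_map v) * test_fun k (hartogs_map v)" for v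
  have tm [measurable]: "test_fun k \<in> borel_measurable borel" unfolding test_fun_def[abs_def] by measurable
  have [measurable]: "K \<in> borel_measurable (borel \<Otimes>\<^sub>M borel)" unfolding K_def[abs_def] by measurable
  have int: "integrable (disc_measure 0 \<Otimes>\<^sub>M disc_measure (s + 2)) K"
    using L2_mult_integrable[OF L2_hartogs_kernel[OF z] test_fun_L2[OF assms(1) B]] unfolding K_def[abs_def] bidisc_measure_def[symmetric]
    by (subst (asm) integrable_W) auto
  define \<psi> where "\<psi> y = b * cnj y * disc_kernel s (b * cnj y) * (y * of_real (k (cmod y)))" for y
  have [measurable]: "\<psi> \<in> borel_measurable borel" unfolding \<psi>_def[abs_def] by measurable
  have int\<psi>: "integrable (disc_measure (s + 2)) \<psi>"
  proof (rule integrableI_bounded)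
    define C where "C = B / (1 - cmod b)\<^sup>2"
    have C: "0 \<le> C" unfolding C_def using B[of 0] by (intro divide_nonneg_nonneg) auto
    have "(\<integral>\<^sup>+y. ennreal (norm (\<psi> y)) \<partial>disc_measure (s + 2)) \<le> (\<integral>\<^sup>+y. ennreal C * ennreal (cmod y powr 2) \<partial>disc_measure (s + 2))"
    proof (rule nn_integral_mono_AE, use AE_disc_measure in eventually_elim)
      case (elim y)
      have "norm (\<psi> y) = (cmod b * (cmod (disc_kernel s (b * cnj y)) * \<bar>k (cmod y)\<bar>)) * (cmod y)\<^sup>2"
        by (simp add: \<psi>_def norm_mult power2_eq_square)
      also have "\<dots> \<le> (1 * (1 / (1 - cmod b)\<^sup>2 * B)) * (cmod y)\<^sup>2"
        using elim ab s B by (intro mult_right_mono mult_mono disc_kernel_cnj_bound) auto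
      finally have "norm (\<psi> y) \<le> C * (cmod y powr 2)" by (simp add: C_def)
      then show ?case using C by (simp add: ennreal_leI flip: ennreal_mult)
    qed
    also have "\<dots> = ennreal C * (\<integral>\<^sup>+y. ennreal (cmod y powr 2) \<partial>disc_measure (s + 2))"
      by (rule nn_integral_cmult) measurable
    also have "\<dots> < \<infinity>" using s by (subst nn_integral_disc_powr) (auto simp: ennreal_mult_less_top)
    finally show "(\<integral>\<^sup>+y. ennreal (norm (\<psi> y)) \<partial>disc_measure (s + 2)) < \<infinity>" .
  qed simp
  define c where "c = (2 - s) / (2 * pi)"
  have hol1: "(\<lambda>w. 1 :: complex) holomorphic_on ball 0 1" by simp
  have "(\<integral>y. \<psi> y \<partial>disc_measure (s + 2)) = (\<integral>r. \<integral>t. \<psi> (rcis r (2 * pi * t)) \<partial>circle_measure \<partial>radial_measure (s + 2))"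
    by (rule integrable_disc_polar(2)[OF int\<psi>])
  also have "\<dots> = (\<integral>r. b * of_real c * of_real (r\<^sup>2 * k r) \<partial>radial_measure (s + 2))"
  proof (rule integral_cong_AE)
    show "(\<lambda>r. \<integral>t. \<psi> (rcis r (2 * pi * t)) \<partial>circle_measure) \<in> borel_measurable (radial_measure (s + 2))"
      using integrable_disc_polar(1)[OF int\<psi>] by auto
    show "AE r in radial_measure (s + 2). (\<integral>t. \<psi> (rcis r (2 * pi * t)) \<partial>circle_measure) = b * of_real c * of_real (r\<^sup>2 * k r)"
      using AE_radial_measure
    proof eventually_elim
      case (elim r)
      \<comment> \<open>The product of v2 and its conjugate is r^2, so the kernel is the only factor
        that depends on the angle.\<close>
      have "\<psi> (rcis r \<theta>) = (b * of_real (r\<^sup>2 * k r)) * (disc_kernel s (b * cnj (rcis r \<theta>)) * 1)" for \<theta>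
      proof -
        have "rcis r \<theta> * cnj (rcis r \<theta>) = of_real (r\<^sup>2)"
          by (subst complex_norm_square[symmetric]) simp
        then show ?thesis using elim by (simp add: \<psi>_def mult_ac)
      qed
      then have "(\<integral>t. \<psi> (rcis r (2 * pi * t)) \<partial>circle_measure) = (b * of_real (r\<^sup>2 * k r)) * (\<integral>t. disc_kernel s (b * cnj (rcis r (2 * pi * t))) * 1 \<partial>circle_measure)"
        by (simp only: integral_mult_right_zero)
      also have "(\<integral>t. disc_kernel s (b * cnj (rcis r (2 * pi * t))) * 1 \<partial>circle_measure) = of_real c"
        using elim ab by (subst circle_integral_disc_kernel[OF hol1]) (auto simp: c_def)
      finally show ?case by (simp add: mult_ac)
    qed
  qed measurable
  also have "\<dots> = b * of_real c * of_real (\<integral>r. r\<^sup>2 * k r \<partial>radial_measure (s + 2))"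
    by (simp only: integral_mult_right_zero integral_complex_of_real)
  finally have I\<psi>: "(\<integral>y. \<psi> y \<partial>disc_measure (s + 2)) = b * of_real c * of_real (\<integral>r. r\<^sup>2 * k r \<partial>radial_measure (s + 2))" .
  have "hartogs_projection (test_fun k) z = (\<integral>v. K v \<partial>bidisc_measure s)"
    unfolding hartogs_projection_bidisc[OF tm z] K_def ..
  also have "\<dots> = (\<integral>x. \<integral>y. K (x, y) \<partial>disc_measure (s + 2) \<partial>disc_measure 0)"
    unfolding bidisc_measure_def by (rule disc.integral_fst'[OF int, symmetric])
  also have "\<dots> = (\<integral>x. disc_kernel 0 (a * cnj x) * (\<integral>y. \<psi> y \<partial>disc_measure (s + 2)) \<partial>disc_measure 0)"
  proof (rule Bochner_Integration.integral_cong[OF refl])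
    fix x
    have "(\<integral>y. K (x, y) \<partial>disc_measure (s + 2)) = (\<integral>y. disc_kernel 0 (a * cnj x) * \<psi> y \<partial>disc_measure (s + 2))"
    proof (rule integral_cong_AE)
      show "AE y in disc_measure (s + 2). K (x, y) = disc_kernel 0 (a * cnj x) * \<psi> y"
        using AE_disc_measure by eventually_elim (simp add: K_def hartogs_kernel_map \<psi>_def test_fun_def a_def b_def)
    qed measurable
    then show "(\<integral>y. K (x, y) \<partial>disc_measure (s + 2)) = disc_kernel 0 (a * cnj x) * (\<integral>y. \<psi> y \<partial>disc_measure (s + 2))"
      by simp
  qed
  also have "\<dots> = (\<integral>x. disc_kernel 0 (a * cnj x) * 1 \<partial>disc_measure 0) * (\<integral>y. \<psi> y \<partial>disc_measure (s + 2))"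
    by simp
  also have "(\<integral>x. disc_kernel 0 (a * cnj x) * 1 \<partial>disc_measure 0) = 1"
  proof (rule disc_reproducing[OF hol1])
    show "integrable (disc_measure 0) (\<lambda>w. 1 :: complex)"
      using nn_integral_disc_1_finite[of 0] by (intro integrable_disc_square) auto
  qed (use ab in auto)
  finally show ?thesis
    unfolding I\<psi> by (simp add: b_def c_def mult_ac)
qed

lemma Lp_bounded_bergman_projection:
  assumes p: "s < p" "p * (s - 1) < s"
  shows "Lp_bounded p hartogs_triangle \<mu> (bergman_projection hartogs_triangle \<mu>)"
proof -
  obtain A where A: "0 < A" "\<And>f. L2 f \<Longrightarrow>
    (\<integral>\<^sup>+z. ennreal (cmod (hartogs_projection f z) powr p) \<partial>W) \<le> ennreal (A powr p) * (\<integral>\<^sup>+z. ennreal (cmod (f z) powr p) \<partial>W)"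
    using hartogs_projection_Lp_bound[OF p] by blast
  have p0: "0 < p" using p s by simp
  show ?thesis
    unfolding Lp_bounded_def
  proof (intro exI[of _ A] ballI)
    fix f assume "f \<in> Lp_space p hartogs_triangle \<mu> \<inter> Lp_space 2 hartogs_triangle \<mu>"
    then have L2: "L2 f" and fin: "(\<integral>\<^sup>+z. ennreal (cmod (f z) powr p) \<partial>W) < \<infinity>"
      by (auto simp: Lp_space_2_iff Lp_space_iff[of f p])
    obtain a where a: "0 \<le> a" "(\<integral>\<^sup>+z. ennreal (cmod (f z) powr p) \<partial>W) = ennreal a"
      using fin by (cases "\<integral>\<^sup>+z. ennreal (cmod (f z) powr p) \<partial>W") auto
    have le: "(\<integral>\<^sup>+z. ennreal (cmod (hartogs_projection f z) powr p) \<partial>W) \<le> ennreal (A powr p * a)"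
      using A(2)[OF L2] a by (simp add: ennreal_mult)
    then obtain b where b: "0 \<le> b" "(\<integral>\<^sup>+z. ennreal (cmod (hartogs_projection f z) powr p) \<partial>W) = ennreal b"
      by (cases "\<integral>\<^sup>+z. ennreal (cmod (hartogs_projection f z) powr p) \<partial>W") (auto simp: top_unique)
    have "b \<le> A powr p * a" using le a(1) unfolding b(2) by (subst (asm) ennreal_le_iff) auto
    then have "b powr (1 / p) \<le> (A powr p * a) powr (1 / p)"
      using b(1) p0 by (intro powr_mono2) auto
    also have "\<dots> = A * a powr (1 / p)"
      using A(1) a(1) p0 by (simp add: powr_mult powr_powr)
    finally have "ennreal (b powr (1 / p)) \<le> ennreal A * ennreal (a powr (1 / p))"
      using A(1) by (simp add: ennreal_leI flip: ennreal_mult)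
    then show "Lp_norm p hartogs_triangle \<mu> (bergman_projection hartogs_triangle \<mu> f) \<le> ennreal A * Lp_norm p hartogs_triangle \<mu> f"
      unfolding bergman_projection_eq_hartogs_projection[OF L2] Lp_norm_eq[OF a] Lp_norm_eq[OF b] .
  qed
qed

text \<open>
  The radial profiles \<open>r powr (q - 2)\<close>, cut off near the origin, probe both ends of the range of
  exponents: \<open>q = 2\<close> below it and the conjugate exponent \<open>q\<close> above it.
\<close>
lemma hartogs_projection_cutoff:
  fixes \<epsilon> q :: real
  assumes \<epsilon>: "0 < \<epsilon>" "\<epsilon> < 1"
  defines "k \<equiv> \<lambda>r. indicator {\<epsilon><..<1} r * r powr (q - 2)"
  obtains J where "0 \<le> J" "(\<integral>\<^sup>+r. ennreal (indicator {\<epsilon><..<1} r * r powr (q - s - 1)) \<partial>lborel) = ennreal J"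
    "L2 (test_fun k)"
    "\<forall>z\<in>hartogs_triangle. hartogs_projection (test_fun k) z = of_real ((2 - s) * J) * z $ 2"
    "\<forall>p. (\<integral>\<^sup>+z. ennreal (cmod (test_fun k z) powr p) \<partial>W) =
      ennreal (2 * pi\<^sup>2) * (\<integral>\<^sup>+r. ennreal (indicator {\<epsilon><..<1} r * r powr ((q - 1) * p - s - 1)) \<partial>lborel)"
proof -
  obtain J where J: "0 \<le> J" "(\<integral>\<^sup>+r. ennreal (indicator {\<epsilon><..<1} r * r powr (q - s - 1)) \<partial>lborel) = ennreal J"
    using nn_integral_powr_truncated_finite[OF \<epsilon>] by blast
  have km [measurable]: "k \<in> borel_measurable borel" unfolding k_def by measurable
  have B: "\<bar>k r\<bar> \<le> \<epsilon> powr (- \<bar>q - 2\<bar>)" for r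
  proof (cases "r \<in> {\<epsilon><..<1}")
    case True
    then have "r powr (q - 2) \<le> r powr (- \<bar>q - 2\<bar>)" using \<epsilon> by (intro powr_mono') auto
    also have "\<dots> \<le> \<epsilon> powr (- \<bar>q - 2\<bar>)" using True \<epsilon> by (intro powr_mono2') auto
    finally show ?thesis using True by (simp add: k_def)
  qed (simp add: k_def)
  \<comment> \<open>With this profile the moment that determines the projection has integrand r^q;
    the radial density r^(-s - 1) then yields the exponent q - s - 1 of J.\<close>
  have rq: "r\<^sup>2 * k r = indicator {\<epsilon><..<1} r * r powr q" for r
  proof (cases "r \<in> {\<epsilon><..<1}")
    case True
    have "q = 2 + (q - 2)" by simp
    then have "r powr q = r powr 2 * r powr (q - 2)" by (metis powr_add)
    then show ?thesis using True \<epsilon> by (simp add: k_def)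
  qed (simp add: k_def)
  have rad: "(\<integral>\<^sup>+r. ennreal (indicator {\<epsilon><..<1} r * r powr e) \<partial>radial_measure (s + 2)) =
      ennreal (2 * pi) * (\<integral>\<^sup>+r. ennreal (indicator {\<epsilon><..<1} r * r powr (e - s - 1)) \<partial>lborel)" for e
  proof -
    have "(\<integral>\<^sup>+r. ennreal (indicator {\<epsilon><..<1} r * r powr e) \<partial>radial_measure (s + 2)) =
        (\<integral>\<^sup>+r. ennreal (indicator {\<epsilon><..} r * r powr e) \<partial>radial_measure (s + 2))"
      by (rule nn_integral_cong_AE, use AE_radial_measure in eventually_elim) (auto simp: indicator_def)
    then show ?thesis using nn_integral_radial_powr[OF \<epsilon>(1)] by simp
  qed
  have "(\<integral>r. r\<^sup>2 * k r \<partial>radial_measure (s + 2)) = enn2real (\<integral>\<^sup>+r. ennreal (r\<^sup>2 * k r) \<partial>radial_measure (s + 2))"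
    by (rule integral_eq_nn_integral) (auto simp: rq)
  also have "\<dots> = 2 * pi * J"
    unfolding rq rad J(2) using J(1) by (simp flip: ennreal_mult)
  finally have c: "(2 - s) / (2 * pi) * (\<integral>r. r\<^sup>2 * k r \<partial>radial_measure (s + 2)) = (2 - s) * J" by simp
  show ?thesis
  proof (rule that[OF J])
    show "L2 (test_fun k)" by (rule test_fun_L2[OF km B])
    show "\<forall>z\<in>hartogs_triangle. hartogs_projection (test_fun k) z = of_real ((2 - s) * J) * z $ 2"
      using hartogs_projection_test_fun[OF km B] unfolding c by blast
    show "\<forall>p. (\<integral>\<^sup>+z. ennreal (cmod (test_fun k z) powr p) \<partial>W) =
      ennreal (2 * pi\<^sup>2) * (\<integral>\<^sup>+r. ennreal (indicator {\<epsilon><..<1} r * r powr ((q - 1) * p - s - 1)) \<partial>lborel)"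
    proof
      fix p
      have "\<bar>r * k r\<bar> powr p = indicator {\<epsilon><..<1} r * r powr ((q - 1) * p)" for r
      proof (cases "r \<in> {\<epsilon><..<1}")
        case True
        have "q - 1 = 1 + (q - 2)" by simp
        then have "r powr (q - 1) = r powr 1 * r powr (q - 2)" by (metis powr_add)
        then have "\<bar>r * k r\<bar> = r powr (q - 1)" using True \<epsilon> by (simp add: k_def)
        then show ?thesis using True by (simp add: powr_powr)
      qed (simp add: k_def)
      then have "(\<integral>\<^sup>+z. ennreal (cmod (test_fun k z) powr p) \<partial>W) = ennreal pi *
          (ennreal (2 * pi) * (\<integral>\<^sup>+r. ennreal (indicator {\<epsilon><..<1} r * r powr ((q - 1) * p - s - 1)) \<partial>lborel))"
        by (simp only: nn_integral_test_fun[OF km] rad)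
      also have "\<dots> = ennreal (2 * pi\<^sup>2) * (\<integral>\<^sup>+r. ennreal (indicator {\<epsilon><..<1} r * r powr ((q - 1) * p - s - 1)) \<partial>lborel)"
      proof -
        have "ennreal (2 * pi\<^sup>2) = ennreal pi * ennreal (2 * pi)"
          by (subst ennreal_mult[symmetric]) (simp_all add: power2_eq_square)
        then show ?thesis by (simp only: mult.assoc)
      qed
      finally show "(\<integral>\<^sup>+z. ennreal (cmod (test_fun k z) powr p) \<partial>W) =
        ennreal (2 * pi\<^sup>2) * (\<integral>\<^sup>+r. ennreal (indicator {\<epsilon><..<1} r * r powr ((q - 1) * p - s - 1)) \<partial>lborel)" .
    qed
  qed
qed

text \<open>The integrand is at least 1 / r near the origin, up to a constant, so the integral
  diverges at least logarithmically.\<close>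

lemma nn_integral_W_snd_powr_infinite:
  assumes "\<gamma> \<le> s"
  shows "(\<integral>\<^sup>+z. ennreal (cmod (z $ 2) powr \<gamma>) \<partial>W) = \<infinity>"
proof (rule ccontr)
  assume "(\<integral>\<^sup>+z. ennreal (cmod (z $ 2) powr \<gamma>) \<partial>W) \<noteq> \<infinity>"
  then obtain I where I: "0 \<le> I" "(\<integral>\<^sup>+z. ennreal (cmod (z $ 2) powr \<gamma>) \<partial>W) = ennreal I"
    by (cases "\<integral>\<^sup>+z. ennreal (cmod (z $ 2) powr \<gamma>) \<partial>W") auto
  \<comment> \<open>Chosen so that - ln \<epsilon> = I + 1: the part beyond \<epsilon> is then at
    least 2 pi^2 (I + 1), which exceeds I.\<close>
  define \<epsilon> where "\<epsilon> = exp (- I - 1)"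
  have \<epsilon>: "0 < \<epsilon>" "\<epsilon> < 1" using I(1) by (auto simp: \<epsilon>_def)
  have "ennreal (- ln \<epsilon>) \<le> (\<integral>\<^sup>+r. ennreal (indicator {\<epsilon><..<1} r * r powr (\<gamma> - s - 1)) \<partial>lborel)"
    using assms by (intro nn_integral_powr_truncated_ge \<epsilon>) auto
  then have "ennreal pi * (ennreal (2 * pi) * ennreal (- ln \<epsilon>)) \<le> ennreal pi * (\<integral>\<^sup>+r. ennreal (indicator {\<epsilon><..} r * r powr \<gamma>) \<partial>radial_measure (s + 2))"
    unfolding nn_integral_radial_powr[OF \<epsilon>(1)] by (intro mult_left_mono) auto
  also have "\<dots> = (\<integral>\<^sup>+z. ennreal (indicator {\<epsilon><..} (cmod (z $ 2)) * cmod (z $ 2) powr \<gamma>) \<partial>W)"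
    by (rule nn_integral_W_snd[symmetric]) measurable
  also have "\<dots> \<le> ennreal I"
    unfolding I(2)[symmetric] by (intro nn_integral_mono) (auto simp: indicator_def)
  also have "ennreal pi * (ennreal (2 * pi) * ennreal (- ln \<epsilon>)) = ennreal (pi * (2 * pi * (I + 1)))"
    using I(1) unfolding \<epsilon>_def by (subst ennreal_mult[symmetric], simp, simp, subst ennreal_mult[symmetric]) auto
  finally have "pi * (2 * pi * (I + 1)) \<le> I"
    using I(1) by (subst (asm) ennreal_le_iff) auto
  moreover have "1 * (I + 1) \<le> (pi * (2 * pi)) * (I + 1)"
  proof (rule mult_right_mono)
    have "1 * 1 \<le> pi * (2 * pi)" using pi_gt3 by (intro mult_mono) auto
    then show "1 \<le> pi * (2 * pi)" by simp
  qed (use I in simp)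
  ultimately show False by (simp add: mult.assoc)
qed

lemma nn_integral_const_mult_snd:
  assumes "\<And>z. z \<in> hartogs_triangle \<Longrightarrow> g z = of_real c * z $ 2" "0 \<le> c"
  shows "(\<integral>\<^sup>+z. ennreal (cmod (g z) powr p) \<partial>W) = ennreal (c powr p) * (\<integral>\<^sup>+z. ennreal (cmod (z $ 2) powr p) \<partial>W)"
proof -
  have "(\<integral>\<^sup>+z. ennreal (cmod (g z) powr p) \<partial>W) = (\<integral>\<^sup>+z. ennreal (c powr p) * ennreal (cmod (z $ 2) powr p) \<partial>W)"
    using assms by (intro nn_integral_cong) (simp add: space_W norm_mult powr_mult flip: ennreal_mult)
  also have "\<dots> = ennreal (c powr p) * (\<integral>\<^sup>+z. ennreal (cmod (z $ 2) powr p) \<partial>W)"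
    by (rule nn_integral_cmult) (rule measurable_W, measurable)
  finally show ?thesis .
qed

text \<open>A single function is enough: a test function supported away from z2 = 0 has finite L^p
  norm, while its projection is a non-zero multiple of z2, whose L^p norm is infinite for p \<le>
  s.\<close>

lemma not_Lp_bounded_small_exponent:
  assumes p: "1 \<le> p" "p \<le> s"
  shows "\<not> Lp_bounded p hartogs_triangle \<mu> (bergman_projection hartogs_triangle \<mu>)"
proof
  assume "Lp_bounded p hartogs_triangle \<mu> (bergman_projection hartogs_triangle \<mu>)"
  then obtain C where C: "\<And>f. f \<in> Lp_space p hartogs_triangle \<mu> \<inter> Lp_space 2 hartogs_triangle \<mu> \<Longrightarrow>
    Lp_norm p hartogs_triangle \<mu> (bergman_projection hartogs_triangle \<mu> f) \<le> ennreal C * Lp_norm p hartogs_triangle \<mu> f"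
    unfolding Lp_bounded_def by blast
  \<comment> \<open>The exponent 2 - 2 is the q - 2 of \<open>hartogs_projection_cutoff\<close> at q
    = 2; the profile is the indicator function of (1/2, 1).\<close>
  define k where "k = (\<lambda>r::real. indicator {1/2<..<1} r * r powr (2 - 2))"
  have half: "0 < (1/2::real)" "1/2 < (1::real)" by auto
  obtain J where J: "0 \<le> J" "(\<integral>\<^sup>+r. ennreal (indicator {1/2<..<1} r * r powr (2 - s - 1)) \<partial>lborel) = ennreal J"
    and f: "L2 (test_fun k)"
      "\<forall>z\<in>hartogs_triangle. hartogs_projection (test_fun k) z = of_real ((2 - s) * J) * z $ 2"
      "\<forall>p. (\<integral>\<^sup>+z. ennreal (cmod (test_fun k z) powr p) \<partial>W) =
        ennreal (2 * pi\<^sup>2) * (\<integral>\<^sup>+r. ennreal (indicator {1/2<..<1} r * r powr ((2 - 1) * p - s - 1)) \<partial>lborel)"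
    using hartogs_projection_cutoff[OF half, of 2, folded k_def] .
  have "ennreal (1 - 1/2) \<le> ennreal J"
    unfolding J(2)[symmetric] using s by (intro nn_integral_powr_truncated_ge half) auto
  then have "J > 0" using J(1) by (subst (asm) ennreal_le_iff) auto
  then have c: "0 < (2 - s) * J" using s by simp
  obtain I where I: "0 \<le> I" "(\<integral>\<^sup>+r. ennreal (indicator {1/2<..<1} r * r powr ((2 - 1) * p - s - 1)) \<partial>lborel) = ennreal I"
    using nn_integral_powr_truncated_finite[OF half] by blast
  have fI: "(\<integral>\<^sup>+z. ennreal (cmod (test_fun k z) powr p) \<partial>W) = ennreal (2 * pi\<^sup>2 * I)"
    unfolding f(3)[rule_format] I(2) using I(1) by (simp flip: ennreal_mult)
  have "(\<integral>\<^sup>+z. ennreal (cmod (hartogs_projection (test_fun k) z) powr p) \<partial>W) = \<infinity>"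
    using nn_integral_const_mult_snd[OF f(2)[rule_format]] nn_integral_W_snd_powr_infinite[OF p(2)] s \<open>J > 0\<close>
    by (auto simp: ennreal_mult_top)
  then have "Lp_norm p hartogs_triangle \<mu> (bergman_projection hartogs_triangle \<mu> (test_fun k)) = \<infinity>"
    unfolding bergman_projection_eq_hartogs_projection[OF f(1)] by (simp add: Lp_norm_def)
  moreover have "Lp_norm p hartogs_triangle \<mu> (test_fun k) = ennreal ((2 * pi\<^sup>2 * I) powr (1 / p))"
    using I(1) by (intro Lp_norm_eq fI) auto
  moreover have "test_fun k \<in> Lp_space p hartogs_triangle \<mu> \<inter> Lp_space 2 hartogs_triangle \<mu>"
    using f(1) L2_measurable[OF f(1)] fI by (simp add: Lp_space_iff[of _ p] Lp_space_2_iff)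
  ultimately have "\<infinity> \<le> ennreal C * ennreal ((2 * pi\<^sup>2 * I) powr (1 / p))"
    using C by metis
  then show False by (simp add: top_unique ennreal_mult_eq_top_iff)
qed

text \<open>For the conjugate exponent q the same integral J gives both the p-th power of the norm
  of the test function and the coefficient of its projection. Boundedness would force J \<le> D
  J^(1/p), so J^(1/q) \<le> D, whereas q \<le> s makes J unbounded as \<epsilon> tends to 0.\<close>

lemma not_Lp_bounded_large_exponent:
  assumes p: "s < p" "s \<le> p * (s - 1)"
  shows "\<not> Lp_bounded p hartogs_triangle \<mu> (bergman_projection hartogs_triangle \<mu>)"
proof
  assume "Lp_bounded p hartogs_triangle \<mu> (bergman_projection hartogs_triangle \<mu>)"
  then obtain C where C: "\<And>f. f \<in> Lp_space p hartogs_triangle \<mu> \<inter> Lp_space 2 hartogs_triangle \<mu> \<Longrightarrow>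
    Lp_norm p hartogs_triangle \<mu> (bergman_projection hartogs_triangle \<mu> f) \<le> ennreal C * Lp_norm p hartogs_triangle \<mu> f"
    unfolding Lp_bounded_def by blast
  have p1: "1 < p" using p s by simp
  define q where "q = p / (p - 1)"
  have qp: "(q - 1) * p = q" using p1 by (simp add: q_def field_simps)
  have qs: "q \<le> s" unfolding q_def using p p1 by (simp add: divide_le_eq algebra_simps)
  define N where "N = 2 * pi\<^sup>2 / (p - s)"
  have N: "N > 0" using p by (simp add: N_def)
  \<comment> \<open>\<open>D\<close> is the bound on J^(1/q) that the constant \<open>C\<close>
    would imply, with |C| since C may be negative. X and \<epsilon> are then chosen so that J \<ge>
    - ln \<epsilon> = X = (D + 1)^q contradicts it.\<close>
  define D where "D = \<bar>C\<bar> * (2 * pi\<^sup>2) powr (1 / p) / ((2 - s) * N powr (1 / p))"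
  have D: "0 \<le> D" unfolding D_def using s by (intro divide_nonneg_nonneg mult_nonneg_nonneg) auto
  define X where "X = (D + 1) powr q"
  have X: "X > 0" unfolding X_def using D by simp
  define \<epsilon> where "\<epsilon> = exp (- X)"
  have \<epsilon>: "0 < \<epsilon>" "\<epsilon> < 1" using X by (auto simp: \<epsilon>_def)
  define k where "k = (\<lambda>r::real. indicator {\<epsilon><..<1} r * r powr (q - 2))"
  obtain J where J: "0 \<le> J" "(\<integral>\<^sup>+r. ennreal (indicator {\<epsilon><..<1} r * r powr (q - s - 1)) \<partial>lborel) = ennreal J"
    and f: "L2 (test_fun k)"
      "\<forall>z\<in>hartogs_triangle. hartogs_projection (test_fun k) z = of_real ((2 - s) * J) * z $ 2"
      "\<forall>p. (\<integral>\<^sup>+z. ennreal (cmod (test_fun k z) powr p) \<partial>W) =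
        ennreal (2 * pi\<^sup>2) * (\<integral>\<^sup>+r. ennreal (indicator {\<epsilon><..<1} r * r powr ((q - 1) * p - s - 1)) \<partial>lborel)"
    using hartogs_projection_cutoff[OF \<epsilon>, of q, folded k_def] .
  have "ennreal (- ln \<epsilon>) \<le> ennreal J"
    unfolding J(2)[symmetric] using qs by (intro nn_integral_powr_truncated_ge \<epsilon>) auto
  then have XJ: "X \<le> J" using J(1) X by (subst (asm) ennreal_le_iff) (auto simp: \<epsilon>_def)
  then have J0: "J > 0" using X by simp
  have fJ: "(\<integral>\<^sup>+z. ennreal (cmod (test_fun k z) powr p) \<partial>W) = ennreal (2 * pi\<^sup>2 * J)"
    unfolding f(3)[rule_format] qp J(2) using J(1) by (simp flip: ennreal_mult)
  have "(\<integral>\<^sup>+z. ennreal (cmod (hartogs_projection (test_fun k) z) powr p) \<partial>W) = ennreal (((2 - s) * J) powr p * N)"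
    using nn_integral_const_mult_snd[OF f(2)[rule_format]] nn_integral_W_snd_powr[OF p(1)] s J0 N
    by (simp add: N_def flip: ennreal_mult)
  then have "Lp_norm p hartogs_triangle \<mu> (hartogs_projection (test_fun k)) = ennreal ((((2 - s) * J) powr p * N) powr (1 / p))"
    using N by (intro Lp_norm_eq) auto
  also have "(((2 - s) * J) powr p * N) powr (1 / p) = (2 - s) * J * N powr (1 / p)"
    using N J0 s p1 by (simp add: powr_mult powr_powr)
  finally have Pf: "Lp_norm p hartogs_triangle \<mu> (bergman_projection hartogs_triangle \<mu> (test_fun k)) = ennreal ((2 - s) * J * N powr (1 / p))"
    unfolding bergman_projection_eq_hartogs_projection[OF f(1)] .
  have nf: "Lp_norm p hartogs_triangle \<mu> (test_fun k) = ennreal ((2 * pi\<^sup>2 * J) powr (1 / p))"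
    using J(1) by (intro Lp_norm_eq fJ) auto
  have "test_fun k \<in> Lp_space p hartogs_triangle \<mu> \<inter> Lp_space 2 hartogs_triangle \<mu>"
    using f(1) L2_measurable[OF f(1)] fJ by (simp add: Lp_space_iff[of _ p] Lp_space_2_iff)
  from C[OF this] have "ennreal ((2 - s) * J * N powr (1 / p)) \<le> ennreal C * ennreal ((2 * pi\<^sup>2 * J) powr (1 / p))"
    unfolding Pf nf .
  also have "\<dots> \<le> ennreal (\<bar>C\<bar> * (2 * pi\<^sup>2 * J) powr (1 / p))"
    by (subst ennreal_mult) (auto intro!: mult_right_mono ennreal_leI)
  finally have "(2 - s) * J * N powr (1 / p) \<le> \<bar>C\<bar> * (2 * pi\<^sup>2 * J) powr (1 / p)"
    by (subst (asm) ennreal_le_iff) auto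
  also have "\<dots> = D * ((2 - s) * N powr (1 / p)) * J powr (1 / p)"
    using N s J0 by (simp add: D_def powr_mult)
  finally have "((2 - s) * N powr (1 / p)) * J \<le> ((2 - s) * N powr (1 / p)) * (D * J powr (1 / p))"
    by (simp add: mult_ac)
  then have JD: "J \<le> D * J powr (1 / p)"
    using N s by (subst (asm) mult_le_cancel_left_pos) auto
  have "J = J powr (1 / q) * J powr (1 / p)"
  proof -
    have "1 / q + 1 / p = 1" using p1 by (simp add: q_def field_simps)
    then show ?thesis using J0 by (simp flip: powr_add)
  qed
  with JD J0 have "J powr (1 / q) \<le> D"
    by (metis mult_le_cancel_right_pos powr_gt_zero less_irrefl)
  moreover have "D + 1 \<le> J powr (1 / q)"
  proof -
    have q0: "q > 0" using p1 by (simp add: q_def)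
    have "D + 1 = X powr (1 / q)" unfolding X_def using D q0 by (simp add: powr_powr)
    also have "\<dots> \<le> J powr (1 / q)" using XJ X q0 by (intro powr_mono2) auto
    finally show ?thesis .
  qed
  ultimately show False by simp
qed

lemma Lp_bounded_bergman_projection_iff:
  assumes "1 \<le> p"
  shows "Lp_bounded p hartogs_triangle \<mu> (bergman_projection hartogs_triangle \<mu>) \<longleftrightarrow> s < p \<and> p * (s - 1) < s"
proof (cases "s < p")
  case True
  show ?thesis
  proof (cases "p * (s - 1) < s")
    case lt: True
    show ?thesis using Lp_bounded_bergman_projection[OF True lt] True lt by simp
  next
    case False
    then have "s \<le> p * (s - 1)" by simp
    from not_Lp_bounded_large_exponent[OF True this] show ?thesis using False by simp
  qed
next
  case False
  then have "p \<le> s" by simp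
  from not_Lp_bounded_small_exponent[OF assms this] show ?thesis using False by simp
qed

end

section \<open>The conjugate exponent as an extended real number\<close>

theorem corollary1p4:
  fixes p0 p :: real and p0' :: ennreal and \<mu> :: "complex ^ 2 \<Rightarrow> real"
  assumes "1 \<le> p0" and "p0 < 2"
    and "1 / ennreal p0 + 1 / p0' = 1"
    and "\<And>z. z \<in> hartogs_triangle \<Longrightarrow> \<mu> z = cmod (z $ 2) powr (- (p0 + 4))"
    and "1 \<le> p"
  shows "Lp_bounded p hartogs_triangle \<mu> (bergman_projection hartogs_triangle \<mu>)
    \<longleftrightarrow> p0 < p \<and> ennreal p < p0'"
proof -
  interpret hartogs_weight p0 \<mu>
    using assms by unfold_locales auto
  have inv: "1 / ennreal p0 = ennreal (1 / p0)"
    using assms(1) by (simp add: divide_ennreal flip: ennreal_1)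
  have "ennreal p < p0' \<longleftrightarrow> p * (p0 - 1) < p0"
  proof (cases p0')
    case top
    \<comment> \<open>An infinite conjugate exponent contributes 1 / p0' = 0 and forces p0 = 1. Then
      \<open>p * (p0 - 1) < p0\<close> reads 0 < 1, and both sides hold.\<close>
    then have "ennreal (1 / p0) = ennreal 1" using assms(3) inv by simp
    then have "p0 = 1" using assms(1) by (subst (asm) ennreal_inj) auto
    then show ?thesis using top by simp
  next
    case (real x)
    \<comment> \<open>In the extended non-negative reals 1 / 0 is infinite, so p0' = 0 contradicts
      the conjugacy relation.\<close>
    have x: "x > 0"
    proof (rule ccontr)
      assume "\<not> x > 0"
      then have "p0' = 0" using real by simp
      then show False using assms(3) by (simp add: divide_ennreal_def)
    qed
    then have "1 / p0' = ennreal (1 / x)"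
      using real by (simp add: divide_ennreal flip: ennreal_1)
    then have "ennreal (1 / p0 + 1 / x) = ennreal 1"
      using assms(1,3) inv x by simp
    then have "1 / p0 + 1 / x = 1"
      using assms(1) x by (subst (asm) ennreal_inj) auto
    \<comment> \<open>Clearing denominators; p0 = 1 would give 1 / x = 0. As p0 - 1 is then
      positive, p < x can be multiplied by it.\<close>
    then have "x * (p0 - 1) = p0" and "p0 - 1 \<noteq> 0"
      using assms(1) x by (auto simp: field_simps)
    then have "p < x \<longleftrightarrow> p * (p0 - 1) < p0"
      using mult_less_cancel_right_pos[of "p0 - 1" p x] assms(1) by simp
    then show ?thesis using real assms(5) by (simp add: ennreal_less_iff)
  qed
  then show ?thesis
    using Lp_bounded_bergman_projection_iff[OF assms(5)] by simp
qed

end
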